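(* For all $i,j\in\{0,1,2\}$, the second-order Riesz transform $R_{ij}=X_iX_j\Delta^{-1}$ is not bounded from $H^1$ to $L^1$.
   Context: **The group.** $G=\mathbb{R}^2\ltimes\mathbb{R}^+$ is the set $\mathbb{R}^2\times(0,\infty)$ with product $(x_1,x_2,a)\cdot(x_1',x_2',a')=(x_1+a x_1',x_2+a x_2',aa')$ and identity $e=(0,0,1)$. The right Haar measure is $d\rho(x_1,x_2,a)=a^{-1}dx_1dx_2da$; $L^p$ and $\|\cdot\|_p$ are taken with respect to $\rho$. The modular function is $\delta(x_1,x_2,a)=a^{-2}$. $d$ is the left-invariant hyperbolic metric on $G$, and $r(x)=d(x,e)$ is given by $\cosh r(x_1,x_2,a)=\frac{a+a^{-1}+a^{-1}(x_1^2+x_2^2)}{2}$. Convolution is $f*g(x)=\int_G f(xy^{-1})g(y)\,d\rho(y)$. **Hardy space.** A Calderón–Zygmund set is a parallelepiped $R=[b_1-L/2,b_1+L/2]\times[b_2-L/2,b_2+L/2]\times[a e^{-r},a e^{r}]$, where $b_1,b_2\in\mathbb{R}$ and $L>0$, $r>0$, $a\in\mathbb{R}^+$ satisfy $e^2ar\le L<e^8ar$ if $r<1$, and $ae^{2r}\le L<ae^{8r}$ if $r\ge1$. An atom is a function $A\in L^1$ supported in a Calderón–Zygmund set $R$ with $\|A\|_\infty\le\rho(R)^{-1}$ and $\int A\,d\rho=0$. $H^1$ is the space of all $f\in L^1$ of the form $f=\sum_j\lambda_jA_j$ with $A_j$ atoms, $\lambda_j\in\mathbb{C}$, $\sum_j|\lambda_j|<\infty$;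 $\|f\|_{H^1}$ is the infimum of $\sum_j|\lambda_j|$ over such decompositions. **Laplacian and Riesz transforms.** Let $X_0=a\partial_a$, $X_1=a\partial_{x_1}$, $X_2=a\partial_{x_2}$ (left-invariant vector fields) and $\Delta=-(X_0^2+X_1^2+X_2^2)$. The operator $\Delta^{-1}$ is regarded as the convolution operator $f\mapsto f*W$ with $W(x)=\frac{1}{4\pi}\delta^{1/2}(x)\frac{1}{\sinh r(x)}$. Thus $R_{ij}f=X_iX_j(f*W)$ for $f\in C_c^\infty(G)$. An operator $T$ defined on $C_c^\infty(G)$ is said to be bounded from $H^1$ to $L^1$ if there is a constant $C$ such that $\|Tf\|_1\le C\|f\|_{H^1}$ for all $f\in C_c^\infty(G)\cap H^1$ (with $\|Tf\|_1=\infty$ if $Tf\notin L^1$). *)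

theory Defs
  imports "HOL-Analysis.Analysis"
begin

type_synonym pt = "real \<times> real \<times> real"

definition G :: "pt set" where
  "G = {(x1, x2, a). a > 0}"

fun gmult :: "pt \<Rightarrow> pt \<Rightarrow> pt" where
  "gmult (x1, x2, a) (y1, y2, b) = (x1 + a * y1, x2 + a * y2, a * b)"

definition gone :: pt where
  "gone = (0, 0, 1)"

fun ginv :: "pt \<Rightarrow> pt" where
  "ginv (x1, x2, a) = (- x1 / a, - x2 / a, 1 / a)"

lemma gmult_closed: "x \<in> G \<Longrightarrow> y \<in> G \<Longrightarrow> gmult x y \<in> G"
  by (auto simp: G_def)

lemma ginv_closed: "x \<in> G \<Longrightarrow> ginv x \<in> G"
  by (auto simp: G_def)

lemma gmult_gone: "gmult x gone = x" "gmult gone x = x"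
  by (cases x; simp add: gone_def)+

lemma gmult_assoc: "gmult (gmult x y) z = gmult x (gmult y z)"
  by (cases x; cases y; cases z; simp add: algebra_simps)

lemma gmult_ginv: "x \<in> G \<Longrightarrow> gmult x (ginv x) = gone" "x \<in> G \<Longrightarrow> gmult (ginv x) x = gone"
  by (auto simp: G_def gone_def)

(* The space of this measure is G, so measurability, integrability and almost-everywhere
   statements never see the values of a function outside G. *)
definition rho :: "pt measure" where
  "rho = density (restrict_space lborel G) (\<lambda>(x1, x2, a). ennreal (1 / a))"

lemma space_rho: "space rho = G"
  by (simp add: rho_def space_restrict_space)

fun modular :: "pt \<Rightarrow> real" where
  "modular (x1, x2, a) = 1 / a\<^sup>2"

fun cosh_dist :: "pt \<Rightarrow> real" where
  "cosh_dist (x1, x2, a) = (a + 1 / a + (x1\<^sup>2 + x2\<^sup>2) / a) / 2"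

definition dist_e :: "pt \<Rightarrow> real" where
  "dist_e x = arcosh (cosh_dist x)"

lemma cosh_dist_e:
  assumes "x \<in> G" shows "cosh (dist_e x) = cosh_dist x" and "dist_e x \<ge> 0"
proof -
  obtain x1 x2 a where x: "x = (x1, x2, a)" by (cases x)
  have a: "a > 0" using assms by (simp add: G_def x)
  have "a + 1 / a - 2 = (a - 1)\<^sup>2 / a" using a by (simp add: field_simps power2_eq_square)
  moreover have "(a - 1)\<^sup>2 / a \<ge> 0" "(x1\<^sup>2 + x2\<^sup>2) / a \<ge> 0" using a by auto
  ultimately have "cosh_dist x \<ge> 1" unfolding x by simp
  then show "cosh (dist_e x) = cosh_dist x" "dist_e x \<ge> 0"
    by (simp_all add: dist_e_def cosh_arcosh_real arcosh_nonneg_real)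
qed

definition conv :: "(pt \<Rightarrow> complex) \<Rightarrow> (pt \<Rightarrow> complex) \<Rightarrow> pt \<Rightarrow> complex" where
  "conv f g x = (LINT y|rho. f (gmult x (ginv y)) * g y)"

(* sinh (dist_e gone) = 0, so W gone = 0 here; the single point gone is rho-null. *)
definition W :: "pt \<Rightarrow> real" where
  "W x = 1 / (4 * pi) * modular x powr (1 / 2) * (1 / sinh (dist_e x))"

(* X i is only ever applied to functions smooth on the open set G (f * W is smooth for
   f in C_c^infinity(G)), where vector_derivative is the actual partial derivative. *)
definition X :: "nat \<Rightarrow> (pt \<Rightarrow> complex) \<Rightarrow> pt \<Rightarrow> complex" where
  "X i F = (\<lambda>(x1, x2, a).
     if i = 0 then a *\<^sub>R vector_derivative (\<lambda>t. F (x1, x2, t)) (at a)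
     else if i = 1 then a *\<^sub>R vector_derivative (\<lambda>t. F (t, x2, a)) (at x1)
     else a *\<^sub>R vector_derivative (\<lambda>t. F (x1, t, a)) (at x2))"

definition riesz :: "nat \<Rightarrow> nat \<Rightarrow> (pt \<Rightarrow> complex) \<Rightarrow> pt \<Rightarrow> complex" where
  "riesz i j f = X i (X j (conv f (\<lambda>x. complex_of_real (W x))))"

primrec Ck_on :: "nat \<Rightarrow> pt set \<Rightarrow> (pt \<Rightarrow> complex) \<Rightarrow> bool" where
  "Ck_on 0 S f \<longleftrightarrow> continuous_on S f"
| "Ck_on (Suc k) S f \<longleftrightarrow> (\<forall>x\<in>S. f differentiable (at x)) \<and>
     (\<forall>v. Ck_on k S (\<lambda>x. frechet_derivative f (at x) v))"

(* Elements of C_c^infinity(G), extended by zero to the whole type. *)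
definition test_fun :: "(pt \<Rightarrow> complex) \<Rightarrow> bool" where
  "test_fun f \<longleftrightarrow> (\<forall>k. Ck_on k G f) \<and>
     (\<exists>K. compact K \<and> K \<subseteq> G \<and> (\<forall>x. x \<notin> K \<longrightarrow> f x = 0))"

definition cz_set :: "pt set \<Rightarrow> bool" where
  "cz_set R \<longleftrightarrow> (\<exists>b1 b2 L r a. L > 0 \<and> r > 0 \<and> a > 0 \<and>
     (if r < 1 then exp 2 * a * r \<le> L \<and> L < exp 8 * a * r
      else a * exp (2 * r) \<le> L \<and> L < a * exp (8 * r)) \<and>
     R = {b1 - L / 2 .. b1 + L / 2} \<times> {b2 - L / 2 .. b2 + L / 2} \<times> {a * exp (- r) .. a * exp r})"

(* Elements of L^1 are classes modulo null sets, so the support and the L^infinity conditions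
   are imposed almost everywhere. *)
definition atom :: "(pt \<Rightarrow> complex) \<Rightarrow> bool" where
  "atom A \<longleftrightarrow> integrable rho A \<and>
     (\<exists>R. cz_set R \<and> (AE x in rho. x \<notin> R \<longrightarrow> A x = 0) \<and>
        (AE x in rho. norm (A x) \<le> 1 / measure rho R)) \<and>
     (LINT x|rho. A x) = 0"

(* The series converges in L^1: atoms have L^1 norm at most 1. *)
definition atomic_decomp ::
    "(pt \<Rightarrow> complex) \<Rightarrow> (nat \<Rightarrow> complex) \<Rightarrow> (nat \<Rightarrow> pt \<Rightarrow> complex) \<Rightarrow> bool" where
  "atomic_decomp f c A \<longleftrightarrow> (\<forall>j. atom (A j)) \<and> summable (\<lambda>j. norm (c j)) \<and>
     (\<lambda>n. LINT x|rho. norm (f x - (\<Sum>j<n. c j * A j x))) \<longlonglongrightarrow> 0"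

definition H1 :: "(pt \<Rightarrow> complex) set" where
  "H1 = {f. integrable rho f \<and> (\<exists>c A. atomic_decomp f c A)}"

definition H1_norm :: "(pt \<Rightarrow> complex) \<Rightarrow> real" where
  "H1_norm f = Inf {(\<Sum>j. norm (c j)) | c A. atomic_decomp f c A}"

definition bounded_H1_L1 :: "((pt \<Rightarrow> complex) \<Rightarrow> pt \<Rightarrow> complex) \<Rightarrow> bool" where
  "bounded_H1_L1 T \<longleftrightarrow> (\<exists>C::real. \<forall>f. test_fun f \<and> f \<in> H1 \<longrightarrow>
     integrable rho (T f) \<and> (LINT x|rho. norm (T f x)) \<le> C * H1_norm f)"

end

theory Submission
  imports Defs "HOL-Probability.Probability"
begin

text \<open>
  The kernel of \<open>\<Delta>\<inverse>\<close> sends a function on \<open>G\<close> that lives very close to the boundary \<open>a = 0\<close> of the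
  half-space to an almost explicit limit.  Take \<open>f\<close> equal to \<open>p(u)\<close>, a smooth function of mean zero on a
  square, times a cut-off in the height \<open>b\<close> that lives on \<open>[exp (-8r), exp (-6r)]\<close> and is normalised to
  total mass one with respect to \<open>db/b\<close>.  The support lies in a
  Calderon-Zygmund set of measure \<open>8r\<close> and the normalised cut-off is at most a constant times \<open>1/r\<close>.
  Hence \<open>f\<close> is a multiple of an atom, with a factor that depends only on the supremum of \<open>p\<close> and not on \<open>r\<close>
  (\<open>probe_H1\<close>).

  As \<open>r\<close> tends to infinity, \<open>R\<^sub>i\<^sub>j f\<close> converges pointwise to the convolution of \<open>p\<close> with the kernel
  \<open>X\<^sub>i X\<^sub>j (1 / (2\<pi> (|w|\<^sup>2 + a\<^sup>2)))\<close> on the plane, for each height \<open>a\<close> (\<open>riesz_probe_tendsto\<close>).  If \<open>R\<^sub>i\<^sub>j\<close> were bounded,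
  Fatou's lemma would bound the integral over \<open>G\<close> of the modulus of this limit by a constant times
  the supremum of \<open>|p|\<close> (\<open>boundary_riesz_bounded\<close>).

  This is impossible.  The limit kernel is homogeneous under the dilations of the half-space, so at
  height \<open>a\<close> it acts on the frequency \<open>\<xi>\<close> as multiplication by \<open>m(a\<xi>)\<close> with a continuous function \<open>m\<close> that does not
  vanish identically on \<open>\<xi> \<noteq> 0\<close> (\<open>fourier_nonzero_exists\<close>).  Every frequency of \<open>p\<close> is therefore seen on a range of
  heights of fixed logarithmic length, and frequencies that are far apart are seen on disjoint
  ranges.  So the integral is at least a constant times the sum of the moduli of lacunary Fourier
  coefficients of \<open>p\<close> (\<open>boundary_riesz_lower_bound\<close>).  A Riesz product with \<open>N\<close> factors and amplitude
  \<open>1/sqrt N\<close> is bounded uniformly in \<open>N\<close> while its \<open>N\<close> lacunary coefficients have size \<open>1/sqrt N\<close>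
  (\<open>lacunary_test_exists\<close>), so the sum grows like \<open>sqrt N\<close>.
\<close>

section \<open>Smooth functions\<close>

text \<open>The witness is the whole sequence of derivatives, which makes differentiation a shift.\<close>

definition smooth1 :: "(real \<Rightarrow> real) \<Rightarrow> bool" where
  "smooth1 h \<longleftrightarrow> (\<exists>D. D 0 = h \<and> (\<forall>n x. (D n has_real_derivative D (Suc n) x) (at x)))"

lemma smooth1_deriv:
  assumes "smooth1 h"
  obtains h' where "smooth1 h'" "\<And>x. (h has_real_derivative h' x) (at x)"
proof -
  obtain D where D: "D 0 = h" "\<And>n x. (D n has_real_derivative D (Suc n) x) (at x)"
    using assms by (auto simp: smooth1_def)
  have "smooth1 (D 1)"
    unfolding smooth1_def by (rule exI[of _ "\<lambda>n. D (Suc n)"]) (use D in auto)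
  with D show ?thesis by (intro that[of "D 1"]) (auto simp: D(1)[symmetric])
qed

lemma smooth1_cos: "smooth1 cos"
  unfolding smooth1_def
proof (intro exI[of _ "\<lambda>n x. cos (x + real n * (pi / 2))"] conjI allI)
  fix n :: nat and x :: real
  have "x + real (Suc n) * (pi / 2) = (x + real n * (pi / 2)) + pi / 2"
    by (simp add: field_simps)
  then have "cos (x + real (Suc n) * (pi / 2)) = - sin (x + real n * (pi / 2))"
    by (metis cos_add cos_pi_half diff_0 mult.right_neutral mult_zero_right sin_pi_half)
  then show "((\<lambda>x. cos (x + real n * (pi / 2))) has_real_derivative cos (x + real (Suc n) * (pi / 2))) (at x)"
    by (auto intro!: derivative_eq_intros)
qed auto

definition bump :: "real \<Rightarrow> real" where
  "bump x = (if x > 0 then exp (- 1 / x) else 0)"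

lemma bump_nonneg: "0 \<le> bump x" and bump_le_1: "bump x \<le> 1"
  and bump_eq_0: "x \<le> 0 \<Longrightarrow> bump x = 0"
  by (auto simp: bump_def)

lemma bump_ge: "1 \<le> x \<Longrightarrow> exp (-1) \<le> bump x"
  by (auto simp: bump_def divide_simps)

lemma poly_inverse_exp_tendsto_0:
  "((\<lambda>x::real. poly p (1 / x) * exp (- 1 / x)) \<longlongrightarrow> 0) (at_right 0)"
proof -
  have "((\<lambda>y::real. \<Sum>i\<le>degree p. coeff p i * (y ^ i / exp y)) \<longlongrightarrow> (\<Sum>i\<le>degree p. coeff p i * 0)) at_top"
    by (intro tendsto_intros tendsto_power_div_exp_0)
  then have "((\<lambda>y::real. poly p y / exp y) \<longlongrightarrow> 0) at_top"
    by (simp add: poly_altdef sum_divide_distrib)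
  from filterlim_compose[OF this filterlim_inverse_at_top_right]
  show ?thesis by (simp add: exp_minus field_simps)
qed

text \<open>Every derivative of the bump is a polynomial in \<open>1/x\<close> times \<open>exp (-1/x)\<close> on the positive
  half-line, and exponential decay beats the polynomial at the origin.\<close>

lemma smooth1_bump: "smooth1 bump"
proof -
  define P :: "nat \<Rightarrow> real poly" where
    "P = rec_nat 1 (\<lambda>_ p. [:0, 0, 1:] * (p - pderiv p))"
  define D where "D n x = (if x > 0 then poly (P n) (1 / x) * exp (- 1 / x) else 0)" for n and x :: real
  have P0: "P 0 = 1" and PS: "P (Suc n) = [:0, 0, 1:] * (P n - pderiv (P n))" for n
    by (simp_all add: P_def)
  have "(D n has_real_derivative D (Suc n) x) (at x)" for n x
  proof -
    consider "x > 0" | "x < 0" | "x = 0" by linarith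
    then show ?thesis
    proof cases
      case 1
      have "((\<lambda>x. poly (P n) (1 / x) * exp (- 1 / x)) has_real_derivative D (Suc n) x) (at x)"
        using 1 unfolding D_def PS
        by (auto intro!: derivative_eq_intros poly_DERIV[THEN DERIV_chain2] simp: field_simps power2_eq_square)
      then show ?thesis
        by (rule has_field_derivative_transform_within_open[of _ _ _ "{0<..}"]) (use 1 in \<open>auto simp: D_def\<close>)
    next
      case 2
      have "((\<lambda>x. 0) has_real_derivative D (Suc n) x) (at x)"
        using 2 by (simp add: D_def)
      then show ?thesis
        by (rule has_field_derivative_transform_within_open[of _ _ _ "{..<0}"]) (use 2 in \<open>auto simp: D_def\<close>)
    next
      case 3
      have "((\<lambda>h. (D n (0 + h) - D n 0) / h) \<longlongrightarrow> 0) (at 0)"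
        unfolding filterlim_at_split
      proof
        have "((\<lambda>x::real. poly (pCons 0 (P n)) (1 / x) * exp (- 1 / x)) \<longlongrightarrow> 0) (at_right 0)"
          by (rule poly_inverse_exp_tendsto_0)
        then show "((\<lambda>h. (D n (0 + h) - D n 0) / h) \<longlongrightarrow> 0) (at_right 0)"
          by (rule Lim_transform_eventually)
            (auto simp: eventually_at_right_field D_def intro!: exI[of _ 1])
        show "((\<lambda>h. (D n (0 + h) - D n 0) / h) \<longlongrightarrow> 0) (at_left 0)"
          by (rule Lim_transform_eventually[of "\<lambda>_. 0"])
            (auto simp: eventually_at_left_field D_def intro!: exI[of _ "-1"])
      qed
      then show ?thesis using 3 by (simp add: DERIV_def D_def)
    qed
  qed
  moreover have "D 0 = bump"
    by (auto simp: D_def bump_def P0 fun_eq_iff)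
  ultimately show ?thesis unfolding smooth1_def by blast
qed

text \<open>Smoothness of all orders is proved coinductively: a family of differentiable functions that
  is closed under directional derivatives consists of smooth functions.  The algebra generated by
  the ridge functions of smooth functions of one variable is such a family, and it contains
  all the test functions that occur below.\<close>

inductive smooth_alg :: "(pt \<Rightarrow> complex) \<Rightarrow> bool" where
  const: "smooth_alg (\<lambda>_. c)"
| ridge: "smooth1 h \<Longrightarrow> smooth_alg (\<lambda>z. complex_of_real (h (v \<bullet> z + t)))"
| add: "smooth_alg F \<Longrightarrow> smooth_alg F' \<Longrightarrow> smooth_alg (\<lambda>z. F z + F' z)"
| mult: "smooth_alg F \<Longrightarrow> smooth_alg F' \<Longrightarrow> smooth_alg (\<lambda>z. F z * F' z)"

lemma smooth_alg_derivative:
  assumes "smooth_alg F"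
  shows "\<exists>F'. (\<forall>z. (F has_derivative F' z) (at z)) \<and> (\<forall>v. smooth_alg (\<lambda>z. F' z v))"
  using assms
proof (induction rule: smooth_alg.induct)
  case (const c)
  show ?case by (intro exI[of _ "\<lambda>_ _. 0"]) (auto intro: smooth_alg.const)
next
  case (ridge h v t)
  obtain h' where h': "smooth1 h'" "\<And>x. (h has_real_derivative h' x) (at x)"
    using smooth1_deriv[OF ridge] by blast
  have "((\<lambda>z. complex_of_real (h (v \<bullet> z + t))) has_derivative
      (\<lambda>y. complex_of_real (h' (v \<bullet> z + t)) * complex_of_real (v \<bullet> y))) (at z)" for z
  proof -
    have "((\<lambda>z. h (v \<bullet> z + t)) has_derivative (\<lambda>y. h' (v \<bullet> z + t) * (v \<bullet> y))) (at z)"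
      by (rule has_derivative_compose[of "\<lambda>z. v \<bullet> z + t" "\<lambda>y. v \<bullet> y" z UNIV h "(*) (h' (v \<bullet> z + t))"])
        (use h'(2)[of "v \<bullet> z + t"] in \<open>auto simp: has_field_derivative_def intro!: derivative_eq_intros\<close>)
    from has_derivative_of_real[OF this, where 'a = complex] show ?thesis
      by simp
  qed
  moreover have "smooth_alg (\<lambda>z. complex_of_real (h' (v \<bullet> z + t)) * complex_of_real (v \<bullet> y))" for y
    by (rule smooth_alg.mult[OF smooth_alg.ridge[OF h'(1)] smooth_alg.const])
  ultimately show ?case
    by (intro exI[of _ "\<lambda>z y. complex_of_real (h' (v \<bullet> z + t)) * complex_of_real (v \<bullet> y)"]) blast
next
  case (add F G)
  obtain F' G' where *: "\<And>z. (F has_derivative F' z) (at z)" "\<And>v. smooth_alg (\<lambda>z. F' z v)"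
     "\<And>z. (G has_derivative G' z) (at z)" "\<And>v. smooth_alg (\<lambda>z. G' z v)"
    using add.IH by blast
  show ?case
    by (intro exI[of _ "\<lambda>z v. F' z v + G' z v"] conjI allI smooth_alg.add * has_derivative_add)
next
  case (mult F G)
  obtain F' G' where *: "\<And>z. (F has_derivative F' z) (at z)" "\<And>v. smooth_alg (\<lambda>z. F' z v)"
     "\<And>z. (G has_derivative G' z) (at z)" "\<And>v. smooth_alg (\<lambda>z. G' z v)"
    using mult.IH by blast
  show ?case
    by (intro exI[of _ "\<lambda>z v. F z * G' z v + F' z v * G z"] conjI allI smooth_alg.add smooth_alg.mult
        * has_derivative_mult mult.hyps)
qed

lemma smooth_alg_Ck_on: "smooth_alg F \<Longrightarrow> Ck_on k S F"
proof (induction k arbitrary: F)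
  case 0
  obtain F' where F': "\<And>z. (F has_derivative F' z) (at z)"
    using smooth_alg_derivative[OF 0] by blast
  then show ?case by (auto intro!: continuous_at_imp_continuous_on has_derivative_continuous)
next
  case (Suc k)
  obtain F' where F': "\<And>z. (F has_derivative F' z) (at z)" "\<And>v. smooth_alg (\<lambda>z. F' z v)"
    using smooth_alg_derivative[OF Suc.prems] by blast
  have "frechet_derivative F (at z) = F' z" for z
    using frechet_derivative_at[OF F'(1)] by simp
  with F' Suc.IH show ?case by (auto simp: differentiable_def)
qed

lemma smooth_alg_continuous: "smooth_alg F \<Longrightarrow> continuous_on S F"
  using smooth_alg_Ck_on[of F 0 S] by simp

definition plane_smooth :: "(real \<times> real \<Rightarrow> complex) \<Rightarrow> bool" where
  "plane_smooth p \<longleftrightarrow> smooth_alg (\<lambda>z. p (fst z, fst (snd z)))"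

lemma plane_smooth_const: "plane_smooth (\<lambda>_. c)"
  and plane_smooth_add: "plane_smooth p \<Longrightarrow> plane_smooth q \<Longrightarrow> plane_smooth (\<lambda>u. p u + q u)"
  and plane_smooth_mult: "plane_smooth p \<Longrightarrow> plane_smooth q \<Longrightarrow> plane_smooth (\<lambda>u. p u * q u)"
  by (auto simp: plane_smooth_def intro: smooth_alg.intros)

lemma plane_smooth_ridge:
  assumes "smooth1 h" shows "plane_smooth (\<lambda>u. complex_of_real (h (v \<bullet> u + t)))"
  using smooth_alg.ridge[OF assms, of "(fst v, snd v, 0)" t]
  by (simp add: plane_smooth_def inner_prod_def)

lemma plane_smooth_continuous:
  assumes "plane_smooth p" shows "continuous_on S p"
proof -
  have "continuous_on UNIV (\<lambda>z::pt. p (fst z, fst (snd z)))"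
    by (rule smooth_alg_continuous[OF assms[unfolded plane_smooth_def]])
  then have "continuous_on UNIV (\<lambda>u. (\<lambda>z::pt. p (fst z, fst (snd z))) (fst u, snd u, 0))"
    by (rule continuous_on_compose2) (auto intro!: continuous_intros)
  then show ?thesis by (auto intro: continuous_on_subset)
qed

definition square :: "(real \<times> real) set" where
  "square = {-1..1} \<times> {-1..1}"

lemma square_cbox: "square = cbox (-1, -1) (1, 1)"
  by (simp add: square_def cbox_Pair_eq)

definition plane_bump :: "real \<times> real \<Rightarrow> real" where
  "plane_bump u = bump (1 + fst u) * bump (1 - fst u) * (bump (1 + snd u) * bump (1 - snd u))"

lemma plane_bump_bounds: "0 \<le> plane_bump u" "plane_bump u \<le> 1"
  unfolding plane_bump_def by (intro mult_nonneg_nonneg mult_le_one bump_nonneg bump_le_1)+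

lemma plane_bump_outside: "u \<notin> square \<Longrightarrow> plane_bump u = 0"
  by (cases u) (auto simp: plane_bump_def square_def not_le bump_eq_0)

lemma plane_smooth_plane_bump: "plane_smooth (\<lambda>u. complex_of_real (plane_bump u))"
proof -
  have "plane_smooth (\<lambda>u. complex_of_real (bump (v \<bullet> u + t)))" for v t
    by (rule plane_smooth_ridge[OF smooth1_bump])
  from this[of "(1, 0)" 1] this[of "(-1, 0)" 1] this[of "(0, 1)" 1] this[of "(0, -1)" 1]
  have "plane_smooth (\<lambda>u. complex_of_real (bump (1 + fst u)))" "plane_smooth (\<lambda>u. complex_of_real (bump (1 - fst u)))"
    "plane_smooth (\<lambda>u. complex_of_real (bump (1 + snd u)))" "plane_smooth (\<lambda>u. complex_of_real (bump (1 - snd u)))"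
    by (simp_all add: inner_prod_def add.commute)
  then show ?thesis unfolding plane_bump_def of_real_mult
    by (intro plane_smooth_mult)
qed

text \<open>The cut-off in the dilation variable lives on \<open>[exp (-8r), exp (-6r)]\<close> and is bounded below
  on all of that interval except for a part of bounded logarithmic length.  As \<open>r\<close> grows, the
  normalised cut-off is therefore bounded by a multiple of \<open>1/r\<close>, as an atom requires.\<close>

definition height_cut :: "real \<Rightarrow> real \<Rightarrow> real" where
  "height_cut r b = bump (exp (8 * r) * b - 1) * bump (2 - 2 * exp (6 * r) * b)"

lemma height_cut_bounds: "0 \<le> height_cut r b" "height_cut r b \<le> 1"
  unfolding height_cut_def by (intro mult_nonneg_nonneg mult_le_one bump_nonneg bump_le_1)+

lemma height_cut_outside:
  assumes "b \<notin> {exp (-8 * r)..exp (-6 * r)}" shows "height_cut r b = 0"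
proof -
  have "exp (8 * r) * b \<le> 1 \<or> 1 \<le> exp (6 * r) * b"
    using assms by (auto simp: exp_minus field_simps)
  then show ?thesis by (auto simp: height_cut_def bump_eq_0)
qed

lemma height_cut_ge:
  assumes "2 * exp (-8 * r) \<le> b" "b \<le> exp (-6 * r) / 2" shows "exp (-2) \<le> height_cut r b"
proof -
  have "1 \<le> exp (8 * r) * b - 1" "1 \<le> 2 - 2 * exp (6 * r) * b"
    using assms by (auto simp: exp_minus field_simps)
  then have "exp (-1) * exp (-1) \<le> height_cut r b"
    unfolding height_cut_def by (intro mult_mono bump_ge) (auto simp: bump_nonneg)
  then show ?thesis by (simp add: exp_add[symmetric])
qed

lemma test_fun_product:
  assumes "plane_smooth p" and supp: "\<And>u. u \<notin> square \<Longrightarrow> p u = 0"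
  shows "test_fun (\<lambda>(u1, u2, b). p (u1, u2) * complex_of_real (c * height_cut r b))"
proof -
  have eq: "(\<lambda>(u1, u2, b). p (u1, u2) * complex_of_real (c * height_cut r b)) =
     (\<lambda>z. p (fst z, fst (snd z)) * (complex_of_real c *
       (complex_of_real (bump ((0, 0, exp (8 * r)) \<bullet> z + (- 1))) *
        complex_of_real (bump ((0, 0, - 2 * exp (6 * r)) \<bullet> z + 2)))))"
    by (auto simp: height_cut_def inner_prod_def algebra_simps)
  have "smooth_alg (\<lambda>(u1, u2, b). p (u1, u2) * complex_of_real (c * height_cut r b))"
    unfolding eq by (intro smooth_alg.intros smooth1_bump assms(1)[unfolded plane_smooth_def])
  moreover have "compact ({-1..1::real} \<times> {-1..1::real} \<times> {exp (-8 * r)..exp (-6 * r)})"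
    by (intro compact_Times compact_Icc)
  moreover have "{-1..1} \<times> {-1..1} \<times> {exp (-8 * r)..exp (-6 * r)} \<subseteq> G"
    by (auto simp: G_def intro: less_le_trans[OF exp_gt_zero])
  moreover have "(\<lambda>(u1, u2, b). p (u1, u2) * complex_of_real (c * height_cut r b)) z = 0"
    if "z \<notin> {-1..1} \<times> {-1..1} \<times> {exp (-8 * r)..exp (-6 * r)}" for z
  proof -
    obtain u1 u2 b where z: "z = (u1, u2, b)" by (cases z)
    show ?thesis
  proof (cases "(u1, u2) \<in> square")
    case True
    then have "height_cut r b = 0" using that unfolding z by (intro height_cut_outside) (auto simp: square_def)
    then show ?thesis by (simp add: z)
  qed (simp add: supp z)
  qed
  ultimately show ?thesis
    unfolding test_fun_def
    by (intro conjI allI smooth_alg_Ck_on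
        exI[of _ "{-1..1} \<times> {-1..1} \<times> {exp (-8 * r)..exp (-6 * r)}"]) (assumption | rule impI)+
qed

section \<open>Fourier coefficients of a lacunary Riesz product\<close>

definition fourier :: "(real \<times> real \<Rightarrow> complex) \<Rightarrow> real \<times> real \<Rightarrow> complex" where
  "fourier p \<xi> = (LINT u|lborel. p u * cis (- (\<xi> \<bullet> u)))"

definition square_fun :: "(real \<times> real \<Rightarrow> complex) \<Rightarrow> bool" where
  "square_fun p \<longleftrightarrow> plane_smooth p \<and> (\<forall>u. u \<notin> square \<longrightarrow> p u = 0)"

lemma square_fun_outside: "square_fun p \<Longrightarrow> u \<notin> square \<Longrightarrow> p u = 0"
  unfolding square_fun_def by blast

lemma square_fun_continuous: "square_fun p \<Longrightarrow> continuous_on S p"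
  by (simp add: square_fun_def plane_smooth_continuous)

lemma square_fun_borel [measurable_dest]: "square_fun p \<Longrightarrow> p \<in> borel_measurable borel"
  by (intro borel_measurable_continuous_onI square_fun_continuous)

lemma compact_square: "compact square"
  by (simp add: square_cbox)

lemma square_fun_bounded:
  assumes "square_fun p" obtains M where "0 \<le> M" "\<And>u. norm (p u) \<le> M"
proof -
  have "bounded (p ` square)"
    by (intro compact_imp_bounded compact_continuous_image square_fun_continuous assms compact_square)
  then obtain M where M: "\<And>u. u \<in> square \<Longrightarrow> norm (p u) \<le> M" by (auto simp: bounded_iff)
  show ?thesis
  proof (rule that[of "max 0 M"])
    show "norm (p u) \<le> max 0 M" for u
      using M[of u] square_fun_outside[OF assms, of u] by (cases "u \<in> square") auto
  qed simp
qed

lemma integrable_square_mult: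
  fixes q :: "real \<times> real \<Rightarrow> complex"
  assumes "square_fun p" "continuous_on square q"
  shows "integrable lborel (\<lambda>u. p u * q u)"
proof -
  have "integrable lborel (\<lambda>u. indicator square u *\<^sub>R (p u * q u))"
    by (intro borel_integrable_compact compact_square continuous_on_mult square_fun_continuous assms)
  moreover have "(\<lambda>u. indicator square u *\<^sub>R (p u * q u)) = (\<lambda>u. p u * q u)"
    using square_fun_outside[OF assms(1)] by (auto simp: indicator_def fun_eq_iff)
  ultimately show ?thesis by simp
qed

lemma integrable_square_fun: "square_fun p \<Longrightarrow> integrable lborel p"
  using integrable_square_mult[of p "\<lambda>_. 1"] by simp

lemma integrable_fourier: "square_fun p \<Longrightarrow> integrable lborel (\<lambda>u. p u * cis (- (\<xi> \<bullet> u)))"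
  by (intro integrable_square_mult continuous_intros)

lemma integral_translate:
  fixes g :: "'a::euclidean_space \<Rightarrow> complex"
  assumes "g \<in> borel_measurable borel"
  shows "(LINT u|lborel. g (h + u)) = (LINT u|lborel. g u)"
  using integral_distr[of "(+) h" lborel borel g] assms by (simp add: lborel_distr_plus)

text \<open>Translation by half a period reverses the sign of the exponential, so that
  a Fourier coefficient is at most half the \<open>L\<^sup>1\<close>-norm of a small difference.\<close>

lemma riemann_lebesgue:
  assumes p: "square_fun p" and "\<xi> \<noteq> 0"
  shows "((\<lambda>l. fourier p (l *\<^sub>R \<xi>)) \<longlongrightarrow> 0) at_top"
proof -
  define h where "h l = (pi / l) *\<^sub>R (\<xi> /\<^sub>R (\<xi> \<bullet> \<xi>))" for l
  obtain M where M: "0 \<le> M" "\<And>u. norm (p u) \<le> M" using square_fun_bounded[OF p] by blast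
  have h0: "(h \<longlongrightarrow> 0) at_top"
  proof -
    have "((\<lambda>l::real. pi / l) \<longlongrightarrow> 0) at_top" by real_asymp
    from tendsto_scaleR[OF this tendsto_const[of "\<xi> /\<^sub>R (\<xi> \<bullet> \<xi>)"]]
    show ?thesis unfolding h_def[abs_def] by (simp only: scaleR_zero_left)
  qed
  have [measurable]: "p \<in> borel_measurable borel" using p by measurable
  have bound: "norm (fourier p (l *\<^sub>R \<xi>)) \<le> (LINT u|lborel. norm (p u - p (h l + u)))" if "l > 0" for l
  proof -
    have phase: "cis (- ((l *\<^sub>R \<xi>) \<bullet> (h l + u))) = - cis (- ((l *\<^sub>R \<xi>) \<bullet> u))" for u
    proof -
      have "(l *\<^sub>R \<xi>) \<bullet> h l = pi" using that assms(2) by (simp add: h_def)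
      then have "- ((l *\<^sub>R \<xi>) \<bullet> (h l + u)) = - ((l *\<^sub>R \<xi>) \<bullet> u) - pi"
        by (simp only: inner_add_right)
      then show ?thesis by (simp only: cis_divide[symmetric] cis_pi) simp
    qed
    have "integrable lborel (\<lambda>u. p (h l + u) * cis (- ((l *\<^sub>R \<xi>) \<bullet> (h l + u))))"
      using integrable_distr[of "(+) (h l)" lborel borel "\<lambda>u. p u * cis (- ((l *\<^sub>R \<xi>) \<bullet> u))"]
        integrable_fourier[OF p, of "l *\<^sub>R \<xi>"] by (simp only: lborel_distr_plus) simp
    then have int: "integrable lborel (\<lambda>u. p (h l + u) * cis (- ((l *\<^sub>R \<xi>) \<bullet> u)))"
      unfolding phase mult_minus_right by (drule_tac Bochner_Integration.integrable_minus) simp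
    have "fourier p (l *\<^sub>R \<xi>) = (LINT u|lborel. p (h l + u) * cis (- ((l *\<^sub>R \<xi>) \<bullet> (h l + u))))"
      unfolding fourier_def by (rule integral_translate[symmetric])
        (use borel_measurable_integrable[OF integrable_fourier[OF p, of "l *\<^sub>R \<xi>"]] in simp)
    also have "\<dots> = - (LINT u|lborel. p (h l + u) * cis (- ((l *\<^sub>R \<xi>) \<bullet> u)))"
      by (simp only: phase mult_minus_right integral_minus)
    finally have "2 * fourier p (l *\<^sub>R \<xi>) = (LINT u|lborel. (p u - p (h l + u)) * cis (- ((l *\<^sub>R \<xi>) \<bullet> u)))"
      using int integrable_fourier[OF p, of "l *\<^sub>R \<xi>"]
      by (simp add: fourier_def left_diff_distrib)
    then have "norm (2 * fourier p (l *\<^sub>R \<xi>)) \<le> (LINT u|lborel. norm ((p u - p (h l + u)) * cis (- ((l *\<^sub>R \<xi>) \<bullet> u))))"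
      by (simp only: integral_norm_bound)
    then have "2 * norm (fourier p (l *\<^sub>R \<xi>)) \<le> (LINT u|lborel. norm (p u - p (h l + u)))"
      by (simp add: norm_mult)
    then show ?thesis by (smt (verit) norm_ge_zero)
  qed
  have "((\<lambda>l. LINT u|lborel. norm (p u - p (h l + u))) \<longlongrightarrow> (LINT u::real\<times>real|lborel. 0)) at_top"
  proof (rule integral_dominated_convergence_at_top)
    show "integrable lborel (\<lambda>u. indicator (cbox (-2, -2) (2, 2)) u *\<^sub>R (2 * M) :: real)"
      by (rule borel_integrable_compact) auto
    have "\<forall>\<^sub>F l in at_top. dist (h l) 0 < 1" using h0 by (rule tendstoD) simp
    then show "\<forall>\<^sub>F l in at_top. AE u in lborel. norm (norm (p u - p (h l + u))) \<le> indicator (cbox (-2, -2) (2, 2)) u *\<^sub>R (2 * M)"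
    proof eventually_elim
      case (elim l)
      have "norm (p u - p (h l + u)) \<le> indicator (cbox (-2, -2) (2, 2)) u *\<^sub>R (2 * M)" for u
      proof (cases "u \<in> cbox (-2, -2) (2, 2)")
        case True
        then show ?thesis using norm_triangle_ineq4[of "p u" "p (h l + u)"] M(2)[of u] M(2)[of "h l + u"] by simp
      next
        case False
        have "\<bar>fst (h l)\<bar> < 1" "\<bar>snd (h l)\<bar> < 1"
          using elim norm_fst_le[of "fst (h l)" "snd (h l)"] norm_snd_le[of "snd (h l)" "fst (h l)"] by simp_all
        then have "u \<notin> square" "h l + u \<notin> square"
          using False by (cases u; cases "h l"; force simp: square_def cbox_Pair_eq)+
        then show ?thesis using square_fun_outside[OF p] M(1) by simp
      qed
      then show ?case by simp
    qed
    have "((\<lambda>l. norm (p u - p (h l + u))) \<longlongrightarrow> norm (p u - p (0 + u))) at_top" for u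
      by (intro tendsto_intros continuous_on_tendsto_compose[OF square_fun_continuous[OF p, of UNIV]] h0) auto
    then show "AE u in lborel. ((\<lambda>l. norm (p u - p (h l + u))) \<longlongrightarrow> 0) at_top" by simp
  qed auto
  then have "((\<lambda>l. LINT u|lborel. norm (p u - p (h l + u))) \<longlongrightarrow> 0) at_top" by simp
  then show ?thesis
    by (rule Lim_null_comparison[rotated]) (use bound in \<open>auto simp: eventually_at_top_dense\<close>)
qed

definition riesz_factor :: "real \<Rightarrow> real \<Rightarrow> real \<times> real \<Rightarrow> real \<times> real \<Rightarrow> complex" where
  "riesz_factor c L \<xi> u = 1 + \<i> * complex_of_real (c * cos (L * (\<xi> \<bullet> u)))"

lemma square_fun_riesz_factor:
  assumes "square_fun p" shows "square_fun (\<lambda>u. p u * riesz_factor c L \<xi> u)"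
proof -
  have "plane_smooth (\<lambda>u. p u * (1 + (\<i> * complex_of_real c) * complex_of_real (cos ((L *\<^sub>R \<xi>) \<bullet> u + 0))))"
    using assms by (intro plane_smooth_mult plane_smooth_add plane_smooth_const plane_smooth_ridge smooth1_cos)
      (simp add: square_fun_def)
  then show ?thesis
    using assms by (simp add: square_fun_def riesz_factor_def mult.assoc)
qed

lemma norm_riesz_factor: "norm (riesz_factor c L \<xi> u) \<le> sqrt (1 + c\<^sup>2)"
proof -
  have "(c * cos (L * (\<xi> \<bullet> u)))\<^sup>2 \<le> c\<^sup>2 * 1"
    unfolding power_mult_distrib by (intro mult_left_mono) (auto simp: abs_square_le_1)
  then show ?thesis by (simp add: riesz_factor_def cmod_def)
qed

lemma fourier_riesz_factor:
  assumes p: "square_fun p"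
  shows "fourier (\<lambda>u. p u * riesz_factor c L \<xi> u) (t *\<^sub>R \<xi>) =
    fourier p (t *\<^sub>R \<xi>) + (\<i> * c / 2) * (fourier p ((t - L) *\<^sub>R \<xi>) + fourier p ((t + L) *\<^sub>R \<xi>))"
proof -
  have cos_cis: "complex_of_real (cos x) = (cis x + cis (- x)) / 2" for x
    by (auto simp: complex_eq_iff)
  have "p u * riesz_factor c L \<xi> u * cis (- ((t *\<^sub>R \<xi>) \<bullet> u)) =
     p u * cis (- ((t *\<^sub>R \<xi>) \<bullet> u)) + (\<i> * c / 2) * (p u * cis (- (((t - L) *\<^sub>R \<xi>) \<bullet> u)) + p u * cis (- (((t + L) *\<^sub>R \<xi>) \<bullet> u)))" for u
  proof -
    have e: "cis (- (((t - L) *\<^sub>R \<xi>) \<bullet> u)) = cis (- ((t *\<^sub>R \<xi>) \<bullet> u)) * cis (L * (\<xi> \<bullet> u))"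
      "cis (- (((t + L) *\<^sub>R \<xi>) \<bullet> u)) = cis (- ((t *\<^sub>R \<xi>) \<bullet> u)) * cis (- (L * (\<xi> \<bullet> u)))"
      unfolding cis_mult by (auto intro!: arg_cong[where f = cis] simp: algebra_simps)
    show ?thesis unfolding e riesz_factor_def of_real_mult cos_cis by (simp add: field_simps)
  qed
  then show ?thesis
    unfolding fourier_def
    by (simp only: Bochner_Integration.integral_add integrable_fourier[OF p] integral_mult_right_zero
        integrable_mult_right Bochner_Integration.integrable_add)
qed

text \<open>Each new frequency is chosen after the product of the previous factors, so far out that
  the Riemann-Lebesgue lemma makes all interactions negligible.\<close>

lemma riesz_product_exists:
  fixes p0 :: "real \<times> real \<Rightarrow> complex"
  assumes p0: "square_fun p0" "\<And>u. norm (p0 u) \<le> 1" and \<xi>: "\<xi> \<noteq> 0" and c: "0 < c" "c \<le> 1" and "0 < \<epsilon>"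
  shows "\<exists>l p. square_fun p \<and> (\<forall>u. norm (p u) \<le> sqrt (1 + c\<^sup>2) ^ N) \<and>
    (\<forall>k<N. 1 \<le> l k) \<and> (\<forall>k<N. \<forall>j<k. B * l j < l k) \<and> norm (fourier p 0 - fourier p0 0) < \<epsilon> \<and>
    (\<forall>k<N. norm (fourier p0 (l k *\<^sub>R \<xi>)) < \<epsilon> \<and>
       norm (fourier p (l k *\<^sub>R \<xi>) - (\<i> * c / 2) * fourier p0 0) < \<epsilon>)"
  using \<open>0 < \<epsilon>\<close>
proof (induction N arbitrary: \<epsilon>)
  case 0
  then show ?case using p0 by (intro exI[of _ "\<lambda>_. 1"] exI[of _ p0]) auto
next
  case (Suc N)
  then have "0 < \<epsilon> / 2" by simp
  from Suc.IH[OF this] obtain l p where p: "square_fun p" "\<And>u. norm (p u) \<le> sqrt (1 + c\<^sup>2) ^ N"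
    and l: "\<And>k. k < N \<Longrightarrow> 1 \<le> l k" "\<And>k j. k < N \<Longrightarrow> j < k \<Longrightarrow> B * l j < l k"
    and F0: "norm (fourier p 0 - fourier p0 0) < \<epsilon> / 2"
    and F: "\<And>k. k < N \<Longrightarrow> norm (fourier p0 (l k *\<^sub>R \<xi>)) < \<epsilon> / 2"
      "\<And>k. k < N \<Longrightarrow> norm (fourier p (l k *\<^sub>R \<xi>) - (\<i> * c / 2) * fourier p0 0) < \<epsilon> / 2"
    by blast
  have "0 < \<epsilon> / 4" using Suc.prems by simp
  have small: "\<forall>\<^sub>F L in at_top. norm (fourier q (g L *\<^sub>R \<xi>)) < \<epsilon> / 4"
    if "square_fun q" "filterlim g at_top at_top" for q g
    using tendstoD[OF filterlim_compose[OF riemann_lebesgue[OF that(1) \<xi>] that(2)] \<open>0 < \<epsilon> / 4\<close>] by simp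
  have small': "\<forall>\<^sub>F L in at_top. norm (fourier p ((t - L) *\<^sub>R \<xi>)) < \<epsilon> / 4" for t
  proof -
    have "filterlim (\<lambda>L::real. L - t) at_top at_top" by real_asymp
    from filterlim_compose[OF riemann_lebesgue[OF p(1), of "- \<xi>"] this] \<xi>
    have "((\<lambda>L. fourier p ((L - t) *\<^sub>R - \<xi>)) \<longlongrightarrow> 0) at_top" by simp
    from tendstoD[OF this \<open>0 < \<epsilon> / 4\<close>] show ?thesis by (simp add: algebra_simps)
  qed
  \<comment> \<open>the frequencies at which the transform of the old product must survive the new factor\<close>
  define K where "K = insert 0 (l ` {..<N})"
  have "finite K" by (simp add: K_def)
  have "\<forall>\<^sub>F L in at_top. \<forall>t\<in>K. norm (fourier p ((t - L) *\<^sub>R \<xi>)) < \<epsilon> / 4"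
    using small' \<open>finite K\<close> by (intro eventually_ball_finite) auto
  moreover have "\<forall>\<^sub>F L in at_top. \<forall>t\<in>K. norm (fourier p ((t + L) *\<^sub>R \<xi>)) < \<epsilon> / 4"
    using \<open>finite K\<close> by (intro eventually_ball_finite ballI small[OF p(1)]) (auto, real_asymp)
  moreover have "\<forall>\<^sub>F L in at_top. norm (fourier p ((2 * L) *\<^sub>R \<xi>)) < \<epsilon> / 4"
    by (rule small[OF p(1)]) real_asymp
  moreover have "\<forall>\<^sub>F L in at_top. norm (fourier p0 (L *\<^sub>R \<xi>)) < \<epsilon> / 4"
    by (rule small[OF p0(1)]) real_asymp
  moreover have "\<forall>\<^sub>F L::real in at_top. 1 \<le> L" by (rule eventually_ge_at_top)
  moreover have "\<forall>\<^sub>F L::real in at_top. \<forall>t\<in>K. B * t < L"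
    using \<open>finite K\<close> by (intro eventually_ball_finite ballI eventually_gt_at_top)
  ultimately have "\<forall>\<^sub>F L in at_top. (\<forall>t\<in>K. norm (fourier p ((t - L) *\<^sub>R \<xi>)) < \<epsilon> / 4) \<and>
      (\<forall>t\<in>K. norm (fourier p ((t + L) *\<^sub>R \<xi>)) < \<epsilon> / 4) \<and> norm (fourier p ((2 * L) *\<^sub>R \<xi>)) < \<epsilon> / 4 \<and>
      norm (fourier p0 (L *\<^sub>R \<xi>)) < \<epsilon> / 4 \<and> 1 \<le> L \<and> (\<forall>t\<in>K. B * t < L)"
    by eventually_elim blast
  then have "\<exists>L. (\<forall>t\<in>K. norm (fourier p ((t - L) *\<^sub>R \<xi>)) < \<epsilon> / 4) \<and>
      (\<forall>t\<in>K. norm (fourier p ((t + L) *\<^sub>R \<xi>)) < \<epsilon> / 4) \<and> norm (fourier p ((2 * L) *\<^sub>R \<xi>)) < \<epsilon> / 4 \<and>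
      norm (fourier p0 (L *\<^sub>R \<xi>)) < \<epsilon> / 4 \<and> 1 \<le> L \<and> (\<forall>t\<in>K. B * t < L)"
    by (rule eventually_happens'[OF trivial_limit_at_top_linorder])
  then obtain L where L: "\<And>t. t \<in> K \<Longrightarrow> norm (fourier p ((t - L) *\<^sub>R \<xi>)) < \<epsilon> / 4"
      "\<And>t. t \<in> K \<Longrightarrow> norm (fourier p ((t + L) *\<^sub>R \<xi>)) < \<epsilon> / 4" "norm (fourier p ((2 * L) *\<^sub>R \<xi>)) < \<epsilon> / 4"
      "norm (fourier p0 (L *\<^sub>R \<xi>)) < \<epsilon> / 4" "1 \<le> L" "\<And>t. t \<in> K \<Longrightarrow> B * t < L"
    by blast
  define p' where "p' u = p u * riesz_factor c L \<xi> u" for u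
  define l' where "l' = l(N := L)"
  have step: "fourier p' (t *\<^sub>R \<xi>) = fourier p (t *\<^sub>R \<xi>) +
      (\<i> * c / 2) * (fourier p ((t - L) *\<^sub>R \<xi>) + fourier p ((t + L) *\<^sub>R \<xi>))" for t
    unfolding p'_def by (rule fourier_riesz_factor[OF p(1)])
  have half: "norm (\<i> * c / 2 * z) \<le> norm z / 2" for z :: complex
    using c by (simp add: norm_mult norm_divide mult_left_le_one_le)
  have old: "norm (fourier p' (t *\<^sub>R \<xi>) - w) < \<epsilon>" if "t \<in> K" "norm (fourier p (t *\<^sub>R \<xi>) - w) < \<epsilon> / 2" for t w
  proof -
    have "fourier p' (t *\<^sub>R \<xi>) - w = (fourier p (t *\<^sub>R \<xi>) - w) +
      (\<i> * c / 2) * (fourier p ((t - L) *\<^sub>R \<xi>) + fourier p ((t + L) *\<^sub>R \<xi>))"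
      by (simp add: step)
    also have "norm \<dots> \<le> norm (fourier p (t *\<^sub>R \<xi>) - w) +
       (norm (fourier p ((t - L) *\<^sub>R \<xi>)) + norm (fourier p ((t + L) *\<^sub>R \<xi>))) / 2"
      by (rule order_trans[OF norm_triangle_ineq])
        (use half order_trans[OF half divide_right_mono[OF norm_triangle_ineq]] in auto)
    finally have "norm (fourier p' (t *\<^sub>R \<xi>) - w) \<le> norm (fourier p (t *\<^sub>R \<xi>) - w) +
       (norm (fourier p ((t - L) *\<^sub>R \<xi>)) + norm (fourier p ((t + L) *\<^sub>R \<xi>))) / 2" .
    then show ?thesis using that(2) L(1,2)[OF that(1)] Suc.prems by (simp add: field_simps)
  qed
  have new: "norm (fourier p' (L *\<^sub>R \<xi>) - (\<i> * c / 2) * fourier p0 0) < \<epsilon>"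
  proof -
    have "fourier p' (L *\<^sub>R \<xi>) - (\<i> * c / 2) * fourier p0 0 = fourier p ((0 + L) *\<^sub>R \<xi>) +
      (\<i> * c / 2) * ((fourier p 0 - fourier p0 0) + fourier p ((2 * L) *\<^sub>R \<xi>))"
      by (simp add: step field_simps)
    also have "norm \<dots> \<le> norm (fourier p ((0 + L) *\<^sub>R \<xi>)) +
       (norm (fourier p 0 - fourier p0 0) + norm (fourier p ((2 * L) *\<^sub>R \<xi>))) / 2"
      by (rule order_trans[OF norm_triangle_ineq])
        (use half order_trans[OF half divide_right_mono[OF norm_triangle_ineq]] in auto)
    finally have "norm (fourier p' (L *\<^sub>R \<xi>) - (\<i> * c / 2) * fourier p0 0) \<le> norm (fourier p ((0 + L) *\<^sub>R \<xi>)) +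
       (norm (fourier p 0 - fourier p0 0) + norm (fourier p ((2 * L) *\<^sub>R \<xi>))) / 2" .
    moreover have "norm (fourier p ((0 + L) *\<^sub>R \<xi>)) < \<epsilon> / 4" by (rule L(2)) (simp add: K_def)
    ultimately show ?thesis using F0 L(3) Suc.prems by (simp only: field_simps)
  qed
  have K: "0 \<in> K" "\<And>k. k < N \<Longrightarrow> l k \<in> K" by (auto simp: K_def)
  show ?case
  proof (intro exI[of _ l'] exI[of _ p'] conjI allI impI)
    show "square_fun p'" unfolding p'_def by (rule square_fun_riesz_factor[OF p(1)])
    show "norm (p' u) \<le> sqrt (1 + c\<^sup>2) ^ Suc N" for u
      unfolding p'_def norm_mult power_Suc2 by (intro mult_mono p norm_riesz_factor) auto
    show "1 \<le> l' k" if "k < Suc N" for k using that l L(5) by (auto simp: l'_def less_Suc_eq)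
    show "B * l' j < l' k" if "k < Suc N" "j < k" for j k
      using that l L(6)[OF K(2)] by (auto simp: l'_def less_Suc_eq)
    show "norm (fourier p' 0 - fourier p0 0) < \<epsilon>" using old[OF K(1)] F0 by simp
    show "norm (fourier p0 (l' k *\<^sub>R \<xi>)) < \<epsilon>" if "k < Suc N" for k
      using that F(1)[of k] L(4) Suc.prems by (auto simp: l'_def less_Suc_eq)
    show "norm (fourier p' (l' k *\<^sub>R \<xi>) - (\<i> * c / 2) * fourier p0 0) < \<epsilon>" if "k < Suc N" for k
      using that old[OF K(2) F(2)] new by (auto simp: l'_def less_Suc_eq)
  qed
qed

section \<open>Multipliers of convolution operators on the plane\<close>

lemma continuous_on_cis_compose [continuous_intros]:
  "continuous_on S f \<Longrightarrow> continuous_on S (\<lambda>x. cis (f x))"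
  unfolding cis_conv_exp by (intro continuous_intros)

lemma borel_measurable_cis [measurable]: "cis \<in> borel_measurable borel"
  by (intro borel_measurable_continuous_onI continuous_intros)

lemma borel_measurable_fst_snd [measurable]:
  "(fst :: 'a::topological_space \<times> 'b::topological_space \<Rightarrow> 'a) \<in> borel \<rightarrow>\<^sub>M borel"
  "(snd :: 'a::topological_space \<times> 'b::topological_space \<Rightarrow> 'b) \<in> borel \<rightarrow>\<^sub>M borel"
  by (intro borel_measurable_continuous_onI continuous_intros)+

lemma lborel_Fubini:
  fixes f :: "'a::euclidean_space \<Rightarrow> 'b::euclidean_space \<Rightarrow> complex"
  assumes meas: "(\<lambda>z. f (fst z) (snd z)) \<in> borel_measurable borel"
    and fin: "(\<integral>\<^sup>+x. \<integral>\<^sup>+y. norm (f x y) \<partial>lborel \<partial>lborel) < \<infinity>"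
  shows "integrable lborel (\<lambda>x. LINT y|lborel. f x y)"
    and "(LINT x|lborel. LINT y|lborel. f x y) = (LINT y|lborel. LINT x|lborel. f x y)"
    and "integrable lborel (\<lambda>z. f (fst z) (snd z))"
    and "(LINT z|lborel. f (fst z) (snd z)) = (LINT x|lborel. LINT y|lborel. f x y)"
proof -
  have m: "(\<lambda>z. f (fst z) (snd z)) \<in> borel_measurable (lborel \<Otimes>\<^sub>M lborel)"
    using meas by (simp add: lborel_prod)
  have "(\<integral>\<^sup>+z. norm (f (fst z) (snd z)) \<partial>(lborel \<Otimes>\<^sub>M lborel)) =
     (\<integral>\<^sup>+x. \<integral>\<^sup>+y. norm (f x y) \<partial>lborel \<partial>lborel)"
    using m by (subst lborel.nn_integral_fst[symmetric]) auto
  then have i: "integrable (lborel \<Otimes>\<^sub>M lborel) (\<lambda>z. f (fst z) (snd z))"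
    using m fin by (intro integrableI_bounded) auto
  then have i': "integrable (lborel \<Otimes>\<^sub>M lborel) (\<lambda>(x, y). f x y)"
    by (simp only: case_prod_unfold)
  show "integrable lborel (\<lambda>x. LINT y|lborel. f x y)"
    using lborel_pair.integrable_fst'[OF i] by simp
  show "(LINT x|lborel. LINT y|lborel. f x y) = (LINT y|lborel. LINT x|lborel. f x y)"
    using lborel_pair.Fubini_integral[OF i'] by simp
  show "integrable lborel (\<lambda>z. f (fst z) (snd z))" using i by (simp add: lborel_prod)
  show "(LINT z|lborel. f (fst z) (snd z)) = (LINT x|lborel. LINT y|lborel. f x y)"
    using lborel_pair.integral_fst'[OF i] by (simp add: lborel_prod)
qed

lemma lborel_integral_product:
  fixes f :: "'a::euclidean_space \<Rightarrow> complex" and g :: "'b::euclidean_space \<Rightarrow> complex"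
  assumes f: "integrable lborel f" and g: "integrable lborel g"
  shows "integrable lborel (\<lambda>z. f (fst z) * g (snd z))"
    and "(LINT z|lborel. f (fst z) * g (snd z)) = (LINT x|lborel. f x) * (LINT y|lborel. g y)"
proof -
  have [measurable]: "f \<in> borel_measurable borel" "g \<in> borel_measurable borel"
    using f g by auto
  have "(\<integral>\<^sup>+x. \<integral>\<^sup>+y. norm (f x * g y) \<partial>lborel \<partial>lborel) =
      (\<integral>\<^sup>+x. norm (f x) \<partial>lborel) * (\<integral>\<^sup>+y. norm (g y) \<partial>lborel)"
    by (simp add: norm_mult ennreal_mult nn_integral_cmult nn_integral_multc)
  also have "\<dots> < \<infinity>"
    using f g by (auto simp: integrable_iff_bounded ennreal_mult_less_top)
  finally have fin: "(\<integral>\<^sup>+x. \<integral>\<^sup>+y. norm (f x * g y) \<partial>lborel \<partial>lborel) < \<infinity>" .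
  have meas: "(\<lambda>z. f (fst z) * g (snd z)) \<in> borel_measurable borel" by measurable
  from lborel_Fubini(3,4)[OF meas fin]
  show "integrable lborel (\<lambda>z. f (fst z) * g (snd z))"
    and "(LINT z|lborel. f (fst z) * g (snd z)) = (LINT x|lborel. f x) * (LINT y|lborel. g y)"
    by simp_all
qed

lemma integral_affine:
  fixes g :: "'a::euclidean_space \<Rightarrow> complex"
  assumes [measurable]: "g \<in> borel_measurable borel" and "c \<noteq> 0"
  shows "(LINT w|lborel. g w) = \<bar>c\<bar> ^ DIM('a) *\<^sub>R (LINT v|lborel. g (t + c *\<^sub>R v))"
proof -
  have "(LINT w|lborel. g w) =
      (LINT w|density (distr lborel borel (\<lambda>x. t + c *\<^sub>R x)) (\<lambda>_. ennreal (\<bar>c\<bar> ^ DIM('a))). g w)"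
    using lborel_affine[OF assms(2), of t] by (simp add: ennreal_power)
  also have "\<dots> = (LINT v|lborel. \<bar>c\<bar> ^ DIM('a) *\<^sub>R g (t + c *\<^sub>R v))"
    by (subst integral_density) (auto simp: integral_distr)
  finally show ?thesis by simp
qed

definition gauss :: "real \<times> real \<Rightarrow> real" where
  "gauss v = std_normal_density (fst v) * std_normal_density (snd v)"

lemma gauss_measurable [measurable]: "gauss \<in> borel_measurable borel"
  unfolding gauss_def[abs_def] by measurable

lemma gauss_nonneg: "0 \<le> gauss v" by (simp add: gauss_def)

lemma gauss_explicit: "gauss v = exp (- (v \<bullet> v) / 2) / (2 * pi)"
  by (simp add: gauss_def std_normal_density_def inner_prod_def power2_eq_square
      exp_add[symmetric] diff_divide_distrib add_divide_distrib)

lemma integrable_gauss: "integrable lborel gauss"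
proof -
  have "integrable lborel (\<lambda>z::real\<times>real. complex_of_real (std_normal_density (fst z)) * complex_of_real (std_normal_density (snd z)))"
    by (intro lborel_integral_product integrable_of_real) simp_all
  then have "integrable lborel (\<lambda>z. complex_of_real (gauss z))" by (simp add: gauss_def)
  from integrable_Re[OF this] show ?thesis by simp
qed

lemma gauss_fourier: "(LINT v|lborel. complex_of_real (gauss v) * cis (v \<bullet> w)) = exp (- (w \<bullet> w) / 2)"
proof -
  have one: "integrable lborel (\<lambda>x. complex_of_real (std_normal_density x) * cis (x * t))" for t
    by (rule Bochner_Integration.integrable_bound[of _ "\<lambda>x. std_normal_density x"])
       (auto simp: norm_mult)
  have char: "(LINT x|lborel. complex_of_real (std_normal_density x) * cis (x * t)) = exp (- (t\<^sup>2) / 2)" for t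
  proof -
    have "complex_of_real (exp (- (t\<^sup>2) / 2)) = char std_normal_distribution t"
      by (simp add: char_std_normal_distribution)
    also have "\<dots> = (LINT x|lborel. std_normal_density x *\<^sub>R iexp (t * x))"
      unfolding char_def by (subst integral_density) auto
    finally show ?thesis by (simp add: cis_conv_exp scaleR_conv_of_real mult.commute)
  qed
  have "(LINT v|lborel. complex_of_real (gauss v) * cis (v \<bullet> w)) =
     (LINT v|lborel. (complex_of_real (std_normal_density (fst v)) * cis (fst v * fst w)) *
        (complex_of_real (std_normal_density (snd v)) * cis (snd v * snd w)))"
    by (simp add: gauss_def inner_prod_def cis_mult[symmetric] mult_ac)
  also have "\<dots> = complex_of_real (exp (- ((fst w)\<^sup>2) / 2)) * complex_of_real (exp (- ((snd w)\<^sup>2) / 2))"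
    by (simp only: lborel_integral_product(2)[OF one one] char)
  also have "\<dots> = complex_of_real (exp (- ((fst w)\<^sup>2) / 2) * exp (- ((snd w)\<^sup>2) / 2))"
    by (simp only: of_real_mult)
  also have "exp (- ((fst w)\<^sup>2) / 2) * exp (- ((snd w)\<^sup>2) / 2) = exp (- (w \<bullet> w) / 2)"
    by (simp add: exp_add[symmetric] inner_prod_def power2_eq_square diff_divide_distrib add_divide_distrib)
  finally show ?thesis .
qed

text \<open>Integrating \<open>fourier k (n \<xi>)\<close> against \<open>gauss \<xi> * cis (n (\<xi> \<bullet> w0))\<close> gives, up to a factor, the average
  of \<open>k\<close> over a Gaussian neighbourhood of \<open>w0\<close> of radius \<open>1/n\<close>.  If the transform vanishes away from
  the origin, all these averages do, and in the limit so does \<open>k w0\<close>.\<close>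

lemma fourier_nonzero_exists:
  fixes k :: "real \<times> real \<Rightarrow> complex"
  assumes int: "integrable lborel k" and cont: "continuous_on UNIV k"
    and bnd: "\<And>w. norm (k w) \<le> M" and w0: "k w0 \<noteq> 0"
  shows "\<exists>\<xi>. \<xi> \<noteq> 0 \<and> fourier k \<xi> \<noteq> 0"
proof (rule ccontr)
  assume "\<not> ?thesis"
  then have zero: "\<xi> \<noteq> 0 \<Longrightarrow> fourier k \<xi> = 0" for \<xi> by blast
  have [measurable]: "k \<in> borel_measurable borel" using int by auto
  have avg: "(LINT v|lborel. k (w0 + (1 / real (Suc n)) *\<^sub>R v) * complex_of_real (gauss v)) = 0" for n
  proof -
    define N where "N = real (Suc n)"
    have N: "N > 0" by (simp add: N_def)
    define f where "f \<xi> w = complex_of_real (gauss \<xi>) * cis (N * (\<xi> \<bullet> w0)) * (k w * cis (- ((N *\<^sub>R \<xi>) \<bullet> w)))" for \<xi> w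
    have meas: "(\<lambda>z. f (fst z) (snd z)) \<in> borel_measurable borel"
      unfolding f_def by measurable
    have "(\<integral>\<^sup>+\<xi>. \<integral>\<^sup>+w. norm (f \<xi> w) \<partial>lborel \<partial>lborel) =
        (\<integral>\<^sup>+\<xi>. ennreal (gauss \<xi>) \<partial>lborel) * (\<integral>\<^sup>+w. norm (k w) \<partial>lborel)"
      by (simp add: f_def norm_mult gauss_nonneg ennreal_mult nn_integral_cmult nn_integral_multc)
    also have "\<dots> < \<infinity>"
      using integrable_gauss int
      by (auto simp: integrable_iff_bounded ennreal_mult_less_top gauss_nonneg)
    finally have fin: "(\<integral>\<^sup>+\<xi>. \<integral>\<^sup>+w. norm (f \<xi> w) \<partial>lborel \<partial>lborel) < \<infinity>" .
    have "(LINT w|lborel. f \<xi> w) = complex_of_real (gauss \<xi>) * cis (N * (\<xi> \<bullet> w0)) * fourier k (N *\<^sub>R \<xi>)" for \<xi>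
      by (simp add: f_def fourier_def)
    then have "(LINT \<xi>|lborel. LINT w|lborel. f \<xi> w) =
       (LINT \<xi>|lborel. complex_of_real (gauss \<xi>) * cis (N * (\<xi> \<bullet> w0)) * fourier k (N *\<^sub>R \<xi>))" by simp
    also have "\<dots> = 0"
    proof (rule integral_eq_zero_AE)
      show "AE \<xi> in lborel. complex_of_real (gauss \<xi>) * cis (N * (\<xi> \<bullet> w0)) * fourier k (N *\<^sub>R \<xi>) = 0"
        using AE_lborel_singleton[of "0::real\<times>real"] by eventually_elim (use N zero in auto)
    qed
    finally have "0 = (LINT w|lborel. LINT \<xi>|lborel. f \<xi> w)"
      using lborel_Fubini(2)[OF meas fin] by simp
    also have "\<dots> = (LINT w|lborel. k w * complex_of_real (2 * pi * gauss (N *\<^sub>R (w0 - w))))"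
    proof (rule Bochner_Integration.integral_cong[OF refl])
      fix w
      have "f \<xi> w = k w * (complex_of_real (gauss \<xi>) * cis (\<xi> \<bullet> (N *\<^sub>R (w0 - w))))" for \<xi>
      proof -
        have "cis (\<xi> \<bullet> (N *\<^sub>R (w0 - w))) = cis (N * (\<xi> \<bullet> w0)) * cis (- ((N *\<^sub>R \<xi>) \<bullet> w))"
          unfolding cis_mult by (simp add: inner_diff_right algebra_simps)
        then show ?thesis by (simp add: f_def)
      qed
      then have "(LINT \<xi>|lborel. f \<xi> w) = k w * (LINT \<xi>|lborel. complex_of_real (gauss \<xi>) * cis (\<xi> \<bullet> (N *\<^sub>R (w0 - w))))"
        by simp
      also have "\<dots> = k w * exp (- ((N *\<^sub>R (w0 - w)) \<bullet> (N *\<^sub>R (w0 - w))) / 2)"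
        by (simp only: gauss_fourier)
      finally show "(LINT \<xi>|lborel. f \<xi> w) = k w * complex_of_real (2 * pi * gauss (N *\<^sub>R (w0 - w)))"
        by (simp add: gauss_explicit)
    qed
    also have "\<dots> =
      \<bar>1 / N\<bar> ^ DIM(real \<times> real) *\<^sub>R (LINT v|lborel. k (w0 + (1 / N) *\<^sub>R v) *
         complex_of_real (2 * pi * gauss (N *\<^sub>R (w0 - (w0 + (1 / N) *\<^sub>R v)))))"
      by (rule integral_affine) (use N in auto)
    finally have "0 = (LINT v|lborel. k (w0 + (1 / N) *\<^sub>R v) * complex_of_real (2 * pi * gauss (- v)))"
      using N by simp
    also have "\<dots> = (LINT v|lborel. complex_of_real (2 * pi) * (k (w0 + (1 / N) *\<^sub>R v) * complex_of_real (gauss v)))"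
      by (intro Bochner_Integration.integral_cong) (auto simp: gauss_explicit)
    finally show ?thesis by (simp add: N_def)
  qed
  have "(\<lambda>n. LINT v|lborel. k (w0 + (1 / real (Suc n)) *\<^sub>R v) * complex_of_real (gauss v)) \<longlonglongrightarrow>
     (LINT v|lborel. k w0 * complex_of_real (gauss v))"
  proof (rule integral_dominated_convergence)
    show "integrable lborel (\<lambda>v. M * gauss v)" using integrable_gauss by simp
    show "AE v in lborel. (\<lambda>n. k (w0 + (1 / real (Suc n)) *\<^sub>R v) * complex_of_real (gauss v)) \<longlonglongrightarrow> k w0 * complex_of_real (gauss v)"
    proof (rule AE_I2)
      fix v :: "real \<times> real"
      have "(\<lambda>n. w0 + (1 / real (Suc n)) *\<^sub>R v) \<longlonglongrightarrow> w0 + 0 *\<^sub>R v"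
        by (intro tendsto_intros LIMSEQ_Suc lim_1_over_n)
      then have "(\<lambda>n. w0 + (1 / real (Suc n)) *\<^sub>R v) \<longlonglongrightarrow> w0" by simp
      then show "(\<lambda>n. k (w0 + (1 / real (Suc n)) *\<^sub>R v) * complex_of_real (gauss v)) \<longlonglongrightarrow> k w0 * complex_of_real (gauss v)"
        by (intro tendsto_intros continuous_on_tendsto_compose[OF cont]) auto
    qed
    show "AE v in lborel. norm (k (w0 + (1 / real (Suc n)) *\<^sub>R v) * complex_of_real (gauss v)) \<le> M * gauss v" for n
      unfolding norm_mult norm_of_real abs_of_nonneg[OF gauss_nonneg]
      by (intro AE_I2 mult_right_mono bnd gauss_nonneg)
  qed measurable
  then have "(LINT v|lborel. k w0 * complex_of_real (gauss v)) = 0"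
    unfolding avg by (simp add: LIMSEQ_const_iff)
  moreover have "(LINT v|lborel. complex_of_real (gauss v)) = 1"
    using gauss_fourier[of 0] by simp
  ultimately show False using w0 by simp
qed

lemma continuous_fourier:
  assumes int: "integrable lborel k"
  shows "continuous_on UNIV (fourier k)"
  unfolding continuous_on_sequentially comp_def
proof (intro allI impI ballI, elim conjE)
  fix s :: "nat \<Rightarrow> real \<times> real" and \<xi> assume s: "s \<longlonglongrightarrow> \<xi>"
  have [measurable]: "k \<in> borel_measurable borel" using int by auto
  show "(\<lambda>n. fourier k (s n)) \<longlonglongrightarrow> fourier k \<xi>"
    unfolding fourier_def
  proof (rule integral_dominated_convergence)
    show "integrable lborel (\<lambda>u. norm (k u))" using int by simp
    have "(\<lambda>n. cis (- (s n \<bullet> u))) \<longlonglongrightarrow> cis (- (\<xi> \<bullet> u))" for u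
      unfolding cis_conv_exp by (intro tendsto_intros s)
    then show "AE u in lborel. (\<lambda>n. k u * cis (- (s n \<bullet> u))) \<longlonglongrightarrow> k u * cis (- (\<xi> \<bullet> u))"
      by (intro AE_I2 tendsto_mult tendsto_const)
  qed (auto simp: norm_mult)
qed

text \<open>Fubini's theorem makes the transform multiplicative under convolution, and the transform of
  an integrable function is bounded by its \<open>L\<^sup>1\<close>-norm.\<close>

lemma norm_fourier_convolution_le:
  assumes p: "integrable lborel p" and k: "integrable lborel k"
  shows "ennreal (norm (fourier p \<xi> * fourier k \<xi>)) \<le>
    (\<integral>\<^sup>+x. norm (LINT u|lborel. p u * k (x - u)) \<partial>lborel)"
proof -
  have [measurable]: "p \<in> borel_measurable borel" "k \<in> borel_measurable borel" using p k by auto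
  define f where "f u x = p u * k (x - u) * cis (- (\<xi> \<bullet> x))" for u x
  have meas: "(\<lambda>z. f (fst z) (snd z)) \<in> borel_measurable borel"
    unfolding f_def by measurable
  have meas': "(\<lambda>z. f (snd z) (fst z)) \<in> borel_measurable borel"
    unfolding f_def by measurable
  have shift: "(\<integral>\<^sup>+x. norm (k (x - u)) \<partial>lborel) = (\<integral>\<^sup>+x. norm (k x) \<partial>lborel)" for u
    using nn_integral_distr[of "(+) (- u)" lborel borel "\<lambda>x. ennreal (norm (k x))"] by (simp add: lborel_distr_plus)
  have "(\<integral>\<^sup>+u. \<integral>\<^sup>+x. norm (f u x) \<partial>lborel \<partial>lborel) = (\<integral>\<^sup>+u. norm (p u) \<partial>lborel) * (\<integral>\<^sup>+x. norm (k x) \<partial>lborel)"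
    by (simp add: f_def norm_mult ennreal_mult nn_integral_cmult nn_integral_multc shift)
  also have "\<dots> < \<infinity>"
    using p k by (auto simp: integrable_iff_bounded ennreal_mult_less_top)
  finally have fin: "(\<integral>\<^sup>+u. \<integral>\<^sup>+x. norm (f u x) \<partial>lborel \<partial>lborel) < \<infinity>" .
  have "(\<integral>\<^sup>+x. \<integral>\<^sup>+u. norm (f u x) \<partial>lborel \<partial>lborel) = (\<integral>\<^sup>+u. \<integral>\<^sup>+x. norm (f u x) \<partial>lborel \<partial>lborel)"
    using meas by (intro lborel_pair.Fubini') (simp add: lborel_prod case_prod_beta)
  with fin have fin': "(\<integral>\<^sup>+x. \<integral>\<^sup>+u. norm (f u x) \<partial>lborel \<partial>lborel) < \<infinity>" by simp
  have "(LINT x|lborel. f u x) = p u * cis (- (\<xi> \<bullet> u)) * fourier k \<xi>" for u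
  proof -
    have "(LINT x|lborel. f u x) = (LINT x|lborel. f u (u + x))"
      by (rule integral_translate[symmetric]) (simp add: f_def)
    also have "\<dots> = (LINT x|lborel. p u * cis (- (\<xi> \<bullet> u)) * (k x * cis (- (\<xi> \<bullet> x))))"
      unfolding f_def inner_add_right minus_add_distrib cis_mult[symmetric] by (simp add: mult_ac)
    finally show ?thesis by (simp add: fourier_def)
  qed
  then have "fourier p \<xi> * fourier k \<xi> = (LINT u|lborel. LINT x|lborel. f u x)"
    by (simp add: fourier_def)
  also have "\<dots> = (LINT x|lborel. LINT u|lborel. f u x)"
    by (rule lborel_Fubini(2)[OF meas fin])
  finally have "ennreal (norm (fourier p \<xi> * fourier k \<xi>)) = ennreal (norm (LINT x|lborel. LINT u|lborel. f u x))"
    by simp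
  also have "\<dots> \<le> (\<integral>\<^sup>+x. norm (LINT u|lborel. f u x) \<partial>lborel)"
    by (rule integral_norm_bound_ennreal[OF lborel_Fubini(1)[OF meas' fin']])
  also have "\<dots> = (\<integral>\<^sup>+x. norm (LINT u|lborel. p u * k (x - u)) \<partial>lborel)"
    by (simp add: f_def norm_mult)
  finally show ?thesis .
qed

section \<open>The kernels of the potential and of its derivatives\<close>

text \<open>For \<open>z = (u, b)\<close> and \<open>x = (v, a)\<close> in \<open>G\<close>, the value \<open>W (z\<inverse> x)\<close> is \<open>b\<^sup>2\<close> times \<open>K0 (v - u, a) b\<close>.  As a function of
  \<open>x\<close>, the kernel \<open>K0\<close> has the left-invariant derivatives \<open>X\<^sub>j K0 = K1 j\<close> and \<open>X\<^sub>i X\<^sub>j K0 = K2 i j\<close>.  The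
  coordinates are numbered like the vector fields: the height is coordinate \<open>0\<close>.\<close>

definition co :: "nat \<Rightarrow> pt \<Rightarrow> real" where
  "co i z = (if i = 0 then snd (snd z) else if i = 1 then fst z else fst (snd z))"

lemma co_simps [simp]: "co 0 (w1, w2, a) = a" "co (Suc 0) (w1, w2, a) = w1" "co 2 (w1, w2, a) = w2"
  by (auto simp: co_def)

definition ssum :: "pt \<Rightarrow> real \<Rightarrow> real" where
  "ssum z b = (co 0 z)\<^sup>2 + (co 1 z)\<^sup>2 + (co 2 z)\<^sup>2 + b\<^sup>2"

text \<open>The derivative of \<open>disc\<close> in the direction of the coordinate \<open>i\<close> is \<open>4 * co i z * ssum' i z b\<close>.\<close>

definition ssum' :: "nat \<Rightarrow> pt \<Rightarrow> real \<Rightarrow> real" where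
  "ssum' i z b = ssum z b - (if i = 0 then 2 * b\<^sup>2 else 0)"

definition disc :: "pt \<Rightarrow> real \<Rightarrow> real" where
  "disc z b = (ssum z b)\<^sup>2 - 4 * (co 0 z)\<^sup>2 * b\<^sup>2"

definition K0 :: "pt \<Rightarrow> real \<Rightarrow> real" where
  "K0 z b = 1 / sqrt (disc z b) / (2 * pi)"

definition K1 :: "nat \<Rightarrow> pt \<Rightarrow> real \<Rightarrow> real" where
  "K1 j z b = - 2 * co 0 z * co j z * ssum' j z b * (1 / (disc z b * sqrt (disc z b))) / (2 * pi)"

definition K2 :: "nat \<Rightarrow> nat \<Rightarrow> pt \<Rightarrow> real \<Rightarrow> real" where
  "K2 i j z b =
    (- 2 * co 0 z * (of_bool (i = 0) * co j z * ssum' j z b + co 0 z * of_bool (i = j) * ssum' j z b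
        + 2 * co 0 z * co i z * co j z) * (1 / (disc z b * sqrt (disc z b)))
     + 12 * (co 0 z)\<^sup>2 * co i z * co j z * ssum' i z b * ssum' j z b * (1 / ((disc z b)\<^sup>2 * sqrt (disc z b)))) / (2 * pi)"

text \<open>The form factors into the squared distances of \<open>(w, a)\<close> from \<open>(0, b)\<close> and from the mirror image \<open>(0, -b)\<close>.\<close>

lemma disc_pos:
  assumes "0 \<le> b" "b < co 0 z" shows "0 < disc z b"
proof -
  have "disc z b = ((co 1 z)\<^sup>2 + (co 2 z)\<^sup>2 + (co 0 z - b)\<^sup>2) * ((co 1 z)\<^sup>2 + (co 2 z)\<^sup>2 + (co 0 z + b)\<^sup>2)"
    by (simp add: disc_def ssum_def power2_eq_square algebra_simps)
  moreover have "0 < (co 0 z - b)\<^sup>2" "0 < (co 0 z + b)\<^sup>2" using assms by auto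
  ultimately show ?thesis
    by (simp add: add_nonneg_pos mult_pos_pos)
qed

lemma DERIV_disc:
  assumes "\<And>j. j \<in> {0, 1, 2} \<Longrightarrow> ((\<lambda>t. co j (z t)) has_real_derivative of_bool (i = j)) (at t)"
    and "i \<in> {0, 1, 2}"
  shows "((\<lambda>t. disc (z t) b) has_real_derivative 4 * co i (z t) * ssum' i (z t) b) (at t)"
proof -
  note [derivative_intros] = assms(1)[of 0, simplified] assms(1)[of 1, simplified] assms(1)[of 2, simplified]
  show ?thesis using assms(2)
    unfolding disc_def ssum_def ssum'_def
    by (auto intro!: derivative_eq_intros simp: algebra_simps power2_eq_square)
qed

lemma DERIV_inverse_sqrt:
  assumes "(f has_real_derivative d) (at t)" "0 < f t"
  shows "((\<lambda>t. 1 / sqrt (f t)) has_real_derivative - d / 2 * (1 / (f t * sqrt (f t)))) (at t)"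
    and "((\<lambda>t. 1 / (f t * sqrt (f t))) has_real_derivative - 3 * d / 2 * (1 / ((f t)\<^sup>2 * sqrt (f t)))) (at t)"
proof -
  have s: "sqrt (f t) * sqrt (f t) = f t" using assms(2) by simp
  show "((\<lambda>t. 1 / sqrt (f t)) has_real_derivative - d / 2 * (1 / (f t * sqrt (f t)))) (at t)"
    using assms(2) s by (auto intro!: derivative_eq_intros assms(1) simp: divide_simps)
  show "((\<lambda>t. 1 / (f t * sqrt (f t))) has_real_derivative - 3 * d / 2 * (1 / ((f t)\<^sup>2 * sqrt (f t)))) (at t)"
    using assms(2)
    by (auto intro!: derivative_eq_intros assms(1) simp: divide_simps power2_eq_square)
qed

text \<open>Along a curve on which the \<open>i\<close>-th coordinate moves with unit speed and the others stand still,
  the left-invariant field \<open>X\<^sub>i\<close> is the derivative times the height.\<close>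

lemma DERIV_K0:
  assumes "\<And>j. j \<in> {0, 1, 2} \<Longrightarrow> ((\<lambda>t. co j (z t)) has_real_derivative of_bool (i = j)) (at t)"
    and "i \<in> {0, 1, 2}" "0 \<le> b" "b < co 0 (z t)"
  shows "((\<lambda>t. K0 (z t) b) has_real_derivative K1 i (z t) b / co 0 (z t)) (at t)"
proof -
  have "((\<lambda>t. K0 (z t) b) has_real_derivative
      - (4 * co i (z t) * ssum' i (z t) b) / 2 * (1 / (disc (z t) b * sqrt (disc (z t) b))) / (2 * pi)) (at t)"
    unfolding K0_def
    by (rule DERIV_cdivide[OF DERIV_inverse_sqrt(1)[OF DERIV_disc[OF assms(1,2)] disc_pos[OF assms(3,4)]]])
  also have "- (4 * co i (z t) * ssum' i (z t) b) / 2 * (1 / (disc (z t) b * sqrt (disc (z t) b))) / (2 * pi) =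
      K1 i (z t) b / co 0 (z t)"
    using assms(3,4) unfolding K1_def by simp
  finally show ?thesis .
qed

lemma DERIV_K1:
  assumes d: "\<And>j. j \<in> {0, 1, 2} \<Longrightarrow> ((\<lambda>t. co j (z t)) has_real_derivative of_bool (i = j)) (at t)"
    and i: "i \<in> {0, 1, 2}" and j: "j \<in> {0, 1, 2}" and b: "0 \<le> b" "b < co 0 (z t)"
  shows "((\<lambda>t. K1 j (z t) b) has_real_derivative K2 i j (z t) b / co 0 (z t)) (at t)"
proof -
  have ring_id: "((- 2 * e0 * vj + e * (- 2 * v0)) * Sj + 2 * vi * (- 2 * v0 * vj)) * q + - 3 * (4 * vi * Si) / 2 * r * (- 2 * v0 * vj * Sj) =
     - 2 * (e0 * vj * Sj + v0 * e * Sj + 2 * v0 * vi * vj) * q + 12 * v0 * vi * vj * Si * Sj * r"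
    for e0 vj e v0 Sj vi q Si r :: real
    by (simp add: algebra_simps)
  have cancel: "(- 2 * A * q + 12 * v0 * vi * vj * Si * Sj * r) / m = (- 2 * v0 * A * q + 12 * v0\<^sup>2 * vi * vj * Si * Sj * r) / m / v0"
    if "v0 \<noteq> 0" for A q v0 vi vj Si Sj r m :: real
    using that by (simp add: add_divide_distrib diff_divide_distrib power2_eq_square)
  note D = d[of 0, simplified] d[of 1, simplified] d[of 2, simplified]
  have dS: "((\<lambda>t. ssum' j (z t) b) has_real_derivative 2 * co i (z t)) (at t)"
    using i j D unfolding ssum'_def ssum_def by (auto intro!: derivative_eq_intros)
  have d0: "((\<lambda>t. co 0 (z t)) has_real_derivative of_bool (i = 0)) (at t)" by (rule d) simp
  have dj: "((\<lambda>t. co j (z t)) has_real_derivative of_bool (i = j)) (at t)" by (rule d[OF j])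
  have dP: "((\<lambda>t. 1 / (disc (z t) b * sqrt (disc (z t) b))) has_real_derivative
     - 3 * (4 * co i (z t) * ssum' i (z t) b) / 2 * (1 / ((disc (z t) b)\<^sup>2 * sqrt (disc (z t) b)))) (at t)"
    by (intro DERIV_inverse_sqrt DERIV_disc[OF d i] disc_pos b)
  have "((\<lambda>t. - 2 * co 0 (z t) * co j (z t) * ssum' j (z t) b * (1 / (disc (z t) b * sqrt (disc (z t) b)))) has_real_derivative
     (- 2 * (of_bool (i = 0) * co j (z t) * ssum' j (z t) b + co 0 (z t) * of_bool (i = j) * ssum' j (z t) b
        + 2 * co 0 (z t) * co i (z t) * co j (z t)) * (1 / (disc (z t) b * sqrt (disc (z t) b)))
     + 12 * co 0 (z t) * co i (z t) * co j (z t) * ssum' i (z t) b * ssum' j (z t) b * (1 / ((disc (z t) b)\<^sup>2 * sqrt (disc (z t) b))))) (at t)"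
    by (rule DERIV_cong[OF DERIV_mult[OF DERIV_mult[OF DERIV_mult[OF DERIV_cmult[OF d0] dj] dS] dP]])
      (rule ring_id)
  then have "((\<lambda>t. K1 j (z t) b) has_real_derivative
     (- 2 * (of_bool (i = 0) * co j (z t) * ssum' j (z t) b + co 0 (z t) * of_bool (i = j) * ssum' j (z t) b
        + 2 * co 0 (z t) * co i (z t) * co j (z t)) * (1 / (disc (z t) b * sqrt (disc (z t) b)))
     + 12 * co 0 (z t) * co i (z t) * co j (z t) * ssum' i (z t) b * ssum' j (z t) b * (1 / ((disc (z t) b)\<^sup>2 * sqrt (disc (z t) b)))) / (2 * pi)) (at t)"
    unfolding K1_def by (rule DERIV_cdivide)
  also have "(- 2 * (of_bool (i = 0) * co j (z t) * ssum' j (z t) b + co 0 (z t) * of_bool (i = j) * ssum' j (z t) b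
        + 2 * co 0 (z t) * co i (z t) * co j (z t)) * (1 / (disc (z t) b * sqrt (disc (z t) b)))
     + 12 * co 0 (z t) * co i (z t) * co j (z t) * ssum' i (z t) b * ssum' j (z t) b * (1 / ((disc (z t) b)\<^sup>2 * sqrt (disc (z t) b)))) / (2 * pi)
     = K2 i j (z t) b / co 0 (z t)"
    unfolding K2_def by (rule cancel) (use b in auto)
  finally show ?thesis .
qed

lemma continuous_on_co [continuous_intros]: "continuous_on A f \<Longrightarrow> continuous_on A (\<lambda>x. co j (f x))"
  unfolding co_def by (cases "j = 0"; cases "j = 1") (auto intro: continuous_intros)

lemma continuous_on_kernels:
  assumes "continuous_on A z" "continuous_on A b" "\<And>x. x \<in> A \<Longrightarrow> 0 \<le> b x" "\<And>x. x \<in> A \<Longrightarrow> b x < co 0 (z x)"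
  shows "continuous_on A (\<lambda>x. K0 (z x) (b x))"
    and "continuous_on A (\<lambda>x. K1 j (z x) (b x))"
    and "continuous_on A (\<lambda>x. K2 i j (z x) (b x))"
proof -
  have ssum: "continuous_on A (\<lambda>x. ssum (z x) (b x))" unfolding ssum_def by (intro continuous_intros assms)
  have ssum': "continuous_on A (\<lambda>x. ssum' j (z x) (b x))" for j
    unfolding ssum'_def by (cases "j = 0") (auto intro!: continuous_intros ssum assms)
  have disc: "continuous_on A (\<lambda>x. disc (z x) (b x))" unfolding disc_def by (intro continuous_intros ssum assms)
  have pos: "disc (z x) (b x) \<noteq> 0" "sqrt (disc (z x) (b x)) \<noteq> 0" if "x \<in> A" for x
    using disc_pos[OF assms(3,4)[OF that]] by auto
  have Q: "continuous_on A (\<lambda>x. 1 / sqrt (disc (z x) (b x)))"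
    "continuous_on A (\<lambda>x. 1 / (disc (z x) (b x) * sqrt (disc (z x) (b x))))"
    "continuous_on A (\<lambda>x. 1 / ((disc (z x) (b x))\<^sup>2 * sqrt (disc (z x) (b x))))"
    using pos by (auto intro!: continuous_intros disc)
  show "continuous_on A (\<lambda>x. K0 (z x) (b x))" unfolding K0_def by (intro continuous_intros Q) auto
  show "continuous_on A (\<lambda>x. K1 j (z x) (b x))"
    unfolding K1_def by (intro continuous_intros Q ssum' assms) auto
  show "continuous_on A (\<lambda>x. K2 i j (z x) (b x))"
    unfolding K2_def
    by (intro continuous_on_divide continuous_on_add continuous_on_mult continuous_on_power continuous_on_const
        Q ssum' continuous_on_co assms(1)) auto
qed

section \<open>The limit kernel\<close>

text \<open>At \<open>b = 0\<close> the form \<open>disc\<close> is the square of \<open>D = |w|\<^sup>2 + a\<^sup>2\<close>, and \<open>K0\<close> becomes \<open>1 / (2\<pi> D)\<close>.\<close>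

definition lim_kernel :: "nat \<Rightarrow> nat \<Rightarrow> real \<Rightarrow> real \<times> real \<Rightarrow> real" where
  "lim_kernel i j a w = K2 i j (fst w, snd w, a) 0"

lemma lim_kernel_explicit:
  assumes "a > 0"
  shows "lim_kernel i j a w = (let z = (fst w, snd w, a); D = a\<^sup>2 + (fst w)\<^sup>2 + (snd w)\<^sup>2 in
    (- 2 * a * (of_bool (i = 0) * co j z + a * of_bool (i = j)) / D\<^sup>2 + 8 * a\<^sup>2 * co i z * co j z / D ^ 3) / (2 * pi))"
proof -
  define D where "D = a\<^sup>2 + (fst w)\<^sup>2 + (snd w)\<^sup>2"
  have D: "D > 0" using assms by (simp add: D_def add_pos_nonneg)
  have ssum: "ssum (fst w, snd w, a) 0 = D" "ssum' i (fst w, snd w, a) 0 = D" for i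
    by (simp_all add: ssum_def ssum'_def D_def)
  have disc: "disc (fst w, snd w, a) 0 = D\<^sup>2" "sqrt (D\<^sup>2) = D" using D by (simp_all add: disc_def ssum)
  have id: "- 2 * a * (T * D + a * e * D + 2 * a * ci * cj) * (1 / (D\<^sup>2 * D)) + 12 * a\<^sup>2 * ci * cj * D * D * (1 / ((D\<^sup>2)\<^sup>2 * D)) =
     - 2 * a * (T + a * e) / D\<^sup>2 + 8 * a\<^sup>2 * ci * cj / D ^ 3" for T e ci cj :: real
  proof -
    have "1 / (D\<^sup>2 * D) = 1 / D ^ 3" by (simp add: power2_eq_square power3_eq_cube)
    moreover have "12 * a\<^sup>2 * ci * cj * D * D * (1 / ((D\<^sup>2)\<^sup>2 * D)) = 12 * a\<^sup>2 * ci * cj / D ^ 3"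
      using D by (simp add: power2_eq_square power3_eq_cube)
    moreover have "- 2 * a * (T * D + a * e * D + 2 * a * ci * cj) * (1 / D ^ 3) =
        - 2 * a * (T + a * e) * D / D ^ 3 - 4 * a\<^sup>2 * ci * cj / D ^ 3"
      by (simp add: diff_divide_distrib add_divide_distrib power2_eq_square algebra_simps)
    moreover have "- 2 * a * (T + a * e) * D / D ^ 3 = - 2 * a * (T + a * e) / D\<^sup>2"
      using D by (simp add: power2_eq_square power3_eq_cube)
    ultimately show ?thesis by (simp only:)
  qed
  show ?thesis
    unfolding lim_kernel_def K2_def Let_def ssum disc D_def[symmetric] co_simps id ..
qed

lemma lim_kernel_homogeneous:
  assumes "a > 0" shows "lim_kernel i j a (a *\<^sub>R v) = lim_kernel i j 1 v / a\<^sup>2"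
proof -
  have D: "a\<^sup>2 + (fst (a *\<^sub>R v))\<^sup>2 + (snd (a *\<^sub>R v))\<^sup>2 = a\<^sup>2 * (1\<^sup>2 + (fst v)\<^sup>2 + (snd v)\<^sup>2)"
    by (simp add: power_mult_distrib algebra_simps)
  have c: "co i (fst (a *\<^sub>R v), snd (a *\<^sub>R v), a) = a * co i (fst v, snd v, 1)" for i
    by (simp add: co_def)
  have scale: "(- 2 * a * (e0 * (a * cj) + a * e) / (a\<^sup>2 * D)\<^sup>2 + 8 * a\<^sup>2 * (a * ci) * (a * cj) / (a\<^sup>2 * D) ^ 3) / p =
      (- 2 * 1 * (e0 * cj + 1 * e) / D\<^sup>2 + 8 * 1\<^sup>2 * ci * cj / D ^ 3) / p / a\<^sup>2" for e0 e ci cj D p :: real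
  proof -
    have "- 2 * a * (e0 * (a * cj) + a * e) / (a\<^sup>2 * D)\<^sup>2 = (a\<^sup>2 * (- 2 * (e0 * cj + e))) / (a\<^sup>2 * (D\<^sup>2 * a\<^sup>2))"
      by (intro arg_cong2[where f = "(/)"]) (simp_all add: algebra_simps power2_eq_square)
    moreover have "8 * a\<^sup>2 * (a * ci) * (a * cj) / (a\<^sup>2 * D) ^ 3 = (a\<^sup>2 * a\<^sup>2) * (8 * ci * cj) / ((a\<^sup>2 * a\<^sup>2) * (D ^ 3 * a\<^sup>2))"
      by (intro arg_cong2[where f = "(/)"]) (simp_all add: algebra_simps power2_eq_square power3_eq_cube)
    moreover have "(a\<^sup>2 * (- 2 * (e0 * cj + e))) / (a\<^sup>2 * (D\<^sup>2 * a\<^sup>2)) = - 2 * (e0 * cj + e) / (D\<^sup>2 * a\<^sup>2)"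
      using assms by (intro mult_divide_mult_cancel_left) simp
    moreover have "(a\<^sup>2 * a\<^sup>2) * (8 * ci * cj) / ((a\<^sup>2 * a\<^sup>2) * (D ^ 3 * a\<^sup>2)) = 8 * ci * cj / (D ^ 3 * a\<^sup>2)"
      using assms by (intro mult_divide_mult_cancel_left) simp
    ultimately show ?thesis by (simp add: add_divide_distrib diff_divide_distrib mult_ac)
  qed
  show ?thesis
    unfolding lim_kernel_explicit[OF assms] lim_kernel_explicit[OF zero_less_one] Let_def D c scale ..
qed

lemma lim_kernel_nonzero:
  assumes "i \<in> {0, 1, 2}" "j \<in> {0, 1, 2}" shows "lim_kernel i j 1 (1, 1) \<noteq> 0"
  using assms by (auto simp: lim_kernel_explicit Let_def power2_eq_square power3_eq_cube)

lemma continuous_lim_kernel: "a > 0 \<Longrightarrow> continuous_on UNIV (lim_kernel i j a)"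
  unfolding lim_kernel_def[abs_def] by (intro continuous_on_kernels(3) continuous_intros) auto

text \<open>Numerators are estimated by \<open>|co i z| \<le> sqrt D\<close>.  The resulting decay \<open>|w|\<^sup>-\<^sup>3\<close> is attained for
  \<open>i = 0\<close> and \<open>j \<noteq> 0\<close>, and it is integrable on the plane.\<close>

lemma lim_kernel_bound:
  assumes "i \<in> {0, 1, 2}" "j \<in> {0, 1, 2}"
  shows "\<bar>lim_kernel i j 1 w\<bar> \<le> 12 / ((1 + (fst w)\<^sup>2 + (snd w)\<^sup>2) * sqrt (1 + (fst w)\<^sup>2 + (snd w)\<^sup>2))"
proof -
  define z where "z = (fst w, snd w, 1::real)"
  define D where "D = 1 + (fst w)\<^sup>2 + (snd w)\<^sup>2"
  have D: "D \<ge> 1" by (simp add: D_def)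
  define s where "s = sqrt D"
  have s: "s \<ge> 1" "D = s * s" using D by (auto simp: s_def)
  have co: "\<bar>co i z\<bar> \<le> s" for i
    unfolding s_def by (rule real_le_rsqrt) (auto simp: D_def z_def co_def)
  have A: "\<bar>of_bool (i = 0) * co j z + of_bool (i = j)\<bar> \<le> 2 * s"
    by (rule order_trans[OF abs_triangle_ineq]) (use co[of j] s(1) in auto)
  have B: "\<bar>co i z * co j z\<bar> \<le> D"
    unfolding s(2) abs_mult by (intro mult_mono co) (use s in auto)
  have "\<bar>- 2 * (of_bool (i = 0) * co j z + of_bool (i = j)) / D\<^sup>2 + 8 * (co i z * co j z) / D ^ 3\<bar> \<le>
     2 * \<bar>of_bool (i = 0) * co j z + of_bool (i = j)\<bar> / D\<^sup>2 + 8 * \<bar>co i z * co j z\<bar> / D ^ 3"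
  proof -
    have "\<bar>- 2 * u / D\<^sup>2\<bar> = 2 * \<bar>u\<bar> / D\<^sup>2" "\<bar>8 * u / D ^ 3\<bar> = 8 * \<bar>u\<bar> / D ^ 3" for u
      using D by (simp_all add: abs_mult)
    then show ?thesis by (metis abs_triangle_ineq)
  qed
  also have "\<dots> \<le> 2 * (2 * s) / D\<^sup>2 + 8 * D / D ^ 3"
    using D by (intro add_mono divide_right_mono mult_left_mono A B) auto
  also have "\<dots> = 4 / (D * s) + 8 / (D * D)"
    using s D by (simp add: s(2) power2_eq_square power3_eq_cube)
  also have "\<dots> \<le> 4 / (D * s) + 8 / (D * s)"
    using s D by (intro add_mono divide_left_mono mult_left_mono) (auto simp: s(2))
  also have "\<dots> = 12 / (D * s)" by simp
  finally have le: "\<bar>- 2 * (of_bool (i = 0) * co j z + of_bool (i = j)) / D\<^sup>2 + 8 * (co i z * co j z) / D ^ 3\<bar> \<le> 12 / (D * s)" .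
  have "\<bar>lim_kernel i j 1 w\<bar> = \<bar>- 2 * (of_bool (i = 0) * co j z + of_bool (i = j)) / D\<^sup>2 + 8 * (co i z * co j z) / D ^ 3\<bar> / (2 * pi)"
    by (simp add: lim_kernel_explicit Let_def z_def D_def mult.assoc)
  also have "\<dots> \<le> \<bar>- 2 * (of_bool (i = 0) * co j z + of_bool (i = j)) / D\<^sup>2 + 8 * (co i z * co j z) / D ^ 3\<bar> / 1"
    using pi_gt3 by (intro divide_left_mono) auto
  also note le
  finally show ?thesis by (simp add: D_def s_def)
qed

lemma nn_integral_affine:
  fixes g :: "'a::euclidean_space \<Rightarrow> ennreal"
  assumes [measurable]: "g \<in> borel_measurable borel" and "c \<noteq> 0"
  shows "(\<integral>\<^sup>+w. g w \<partial>lborel) = ennreal (\<bar>c\<bar> ^ DIM('a)) * (\<integral>\<^sup>+v. g (t + c *\<^sub>R v) \<partial>lborel)"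
proof -
  have "(\<integral>\<^sup>+w. g w \<partial>lborel) =
      (\<integral>\<^sup>+w. g w \<partial>density (distr lborel borel (\<lambda>x. t + c *\<^sub>R x)) (\<lambda>_. ennreal (\<bar>c\<bar> ^ DIM('a))))"
    using lborel_affine[OF assms(2), of t] by (simp add: ennreal_power)
  also have "\<dots> = (\<integral>\<^sup>+v. ennreal (\<bar>c\<bar> ^ DIM('a)) * g (t + c *\<^sub>R v) \<partial>lborel)"
    by (subst nn_integral_density) (auto simp: nn_integral_distr)
  also have "\<dots> = ennreal (\<bar>c\<bar> ^ DIM('a)) * (\<integral>\<^sup>+v. g (t + c *\<^sub>R v) \<partial>lborel)"
    by (rule nn_integral_cmult) measurable
  finally show ?thesis .
qed

lemma nn_integral_cauchy_finite: "(\<integral>\<^sup>+t. ennreal (1 / (1 + t\<^sup>2)) \<partial>lborel) < \<infinity>"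
proof -
  have "integrable lborel (\<lambda>t::real. 1 / (1 + t\<^sup>2))"
    using integrable_inverse_1_plus_square by (simp add: set_integrable_def inverse_eq_divide)
  then show ?thesis by (simp add: integrable_iff_bounded abs_of_nonneg)
qed

lemma integrable_lim_kernel:
  assumes "i \<in> {0, 1, 2}" "j \<in> {0, 1, 2}"
  shows "integrable lborel (\<lambda>w. complex_of_real (lim_kernel i j 1 w))"
proof (rule integrableI_bounded)
  have [measurable]: "lim_kernel i j 1 \<in> borel_measurable borel"
    by (intro borel_measurable_continuous_onI continuous_lim_kernel) simp
  show "(\<lambda>w. complex_of_real (lim_kernel i j 1 w)) \<in> borel_measurable lborel" by simp
  define f where "f x y = 1 / ((1 + x\<^sup>2 + y\<^sup>2) * sqrt (1 + x\<^sup>2 + y\<^sup>2))" for x y :: real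
  have f_le: "f x (0 + sqrt (1 + x\<^sup>2) *\<^sub>R t) \<le> 1 / ((1 + x\<^sup>2) * sqrt (1 + x\<^sup>2)) * (1 / (1 + t\<^sup>2))" for x t
  proof -
    have D: "1 + x\<^sup>2 + (0 + sqrt (1 + x\<^sup>2) *\<^sub>R t)\<^sup>2 = (1 + x\<^sup>2) * (1 + t\<^sup>2)"
      by (simp add: power_mult_distrib algebra_simps)
    have "1 * sqrt (1 + x\<^sup>2) \<le> sqrt (1 + t\<^sup>2) * sqrt (1 + x\<^sup>2)" by (intro mult_right_mono) auto
    then have "(1 + x\<^sup>2) * sqrt (1 + x\<^sup>2) * (1 + t\<^sup>2) \<le> ((1 + x\<^sup>2) * (1 + t\<^sup>2)) * sqrt ((1 + x\<^sup>2) * (1 + t\<^sup>2))"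
      unfolding real_sqrt_mult 
      by (drule_tac mult_left_mono[of _ _ "(1 + x\<^sup>2) * (1 + t\<^sup>2)"]) (simp_all add: mult_ac)
    then show ?thesis unfolding f_def D
      by (simp add: frac_le add_pos_nonneg)
  qed
  have inner: "(\<integral>\<^sup>+y. f x y \<partial>lborel) \<le> ennreal (1 / (1 + x\<^sup>2)) * (\<integral>\<^sup>+t. ennreal (1 / (1 + t\<^sup>2)) \<partial>lborel)" for x
  proof -
    have s: "sqrt (1 + x\<^sup>2) > 0" by (simp add: add_pos_nonneg)
    have "(\<integral>\<^sup>+y. f x y \<partial>lborel) = ennreal (\<bar>sqrt (1 + x\<^sup>2)\<bar> ^ DIM(real)) * (\<integral>\<^sup>+t. f x (0 + sqrt (1 + x\<^sup>2) *\<^sub>R t) \<partial>lborel)"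
      by (rule nn_integral_affine) (use s in \<open>auto simp: f_def\<close>)
    also have "\<dots> \<le> ennreal (\<bar>sqrt (1 + x\<^sup>2)\<bar> ^ DIM(real)) *
       (\<integral>\<^sup>+t. ennreal (1 / ((1 + x\<^sup>2) * sqrt (1 + x\<^sup>2))) * ennreal (1 / (1 + t\<^sup>2)) \<partial>lborel)"
      by (intro mult_left_mono nn_integral_mono) (use f_le in \<open>auto simp: ennreal_mult[symmetric] intro!: ennreal_leI\<close>)
    also have "\<dots> = ennreal (sqrt (1 + x\<^sup>2)) * ennreal (1 / ((1 + x\<^sup>2) * sqrt (1 + x\<^sup>2))) * (\<integral>\<^sup>+t. ennreal (1 / (1 + t\<^sup>2)) \<partial>lborel)"
      by (subst nn_integral_cmult) (auto simp: mult.assoc)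
    also have "ennreal (sqrt (1 + x\<^sup>2)) * ennreal (1 / ((1 + x\<^sup>2) * sqrt (1 + x\<^sup>2))) = ennreal (1 / (1 + x\<^sup>2))"
      using s by (simp add: ennreal_mult[symmetric])
    finally show ?thesis .
  qed
  have "(\<integral>\<^sup>+w. ennreal (f (fst w) (snd w)) \<partial>lborel) = (\<integral>\<^sup>+x. \<integral>\<^sup>+y. f x y \<partial>lborel \<partial>lborel)"
    by (subst lborel_prod[symmetric], subst lborel.nn_integral_fst[symmetric]) (auto simp: f_def)
  also have "\<dots> \<le> (\<integral>\<^sup>+x. ennreal (1 / (1 + x\<^sup>2)) * (\<integral>\<^sup>+t. ennreal (1 / (1 + t\<^sup>2)) \<partial>lborel) \<partial>lborel)"
    by (intro nn_integral_mono inner)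
  also have "\<dots> = (\<integral>\<^sup>+t. ennreal (1 / (1 + t\<^sup>2)) \<partial>lborel) * (\<integral>\<^sup>+t. ennreal (1 / (1 + t\<^sup>2)) \<partial>lborel)"
    by (rule nn_integral_multc) simp
  finally have le: "(\<integral>\<^sup>+w. ennreal (f (fst w) (snd w)) \<partial>lborel) \<le>
     (\<integral>\<^sup>+t. ennreal (1 / (1 + t\<^sup>2)) \<partial>lborel) * (\<integral>\<^sup>+t. ennreal (1 / (1 + t\<^sup>2)) \<partial>lborel)" .
  have "(\<integral>\<^sup>+w. norm (complex_of_real (lim_kernel i j 1 w)) \<partial>lborel) \<le> (\<integral>\<^sup>+w. ennreal 12 * ennreal (f (fst w) (snd w)) \<partial>lborel)"
  proof (rule nn_integral_mono)
    fix w
    have "norm (complex_of_real (lim_kernel i j 1 w)) \<le> 12 * f (fst w) (snd w)"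
      using lim_kernel_bound[OF assms, of w] by (simp add: f_def)
    then have "ennreal (norm (complex_of_real (lim_kernel i j 1 w))) \<le> ennreal (12 * f (fst w) (snd w))"
      by (rule ennreal_leI)
    also have "\<dots> = ennreal 12 * ennreal (f (fst w) (snd w))"
      by (rule ennreal_mult) (auto simp: f_def)
    finally show "ennreal (norm (complex_of_real (lim_kernel i j 1 w))) \<le> ennreal 12 * ennreal (f (fst w) (snd w))" .
  qed
  also have "\<dots> = ennreal 12 * (\<integral>\<^sup>+w. ennreal (f (fst w) (snd w)) \<partial>lborel)"
    by (rule nn_integral_cmult) (simp add: f_def)
  also have "\<dots> \<le> ennreal 12 *
     ((\<integral>\<^sup>+t. ennreal (1 / (1 + t\<^sup>2)) \<partial>lborel) * (\<integral>\<^sup>+t. ennreal (1 / (1 + t\<^sup>2)) \<partial>lborel))"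
    by (rule mult_left_mono[OF le]) simp
  also have "\<dots> < \<infinity>"
    using nn_integral_cauchy_finite by (simp add: ennreal_mult_less_top)
  finally show "(\<integral>\<^sup>+w. norm (complex_of_real (lim_kernel i j 1 w)) \<partial>lborel) < \<infinity>" .
qed

text \<open>Homogeneity of degree \<open>-2\<close> cancels the Jacobian of a dilation of the plane.\<close>

lemma fourier_lim_kernel:
  assumes "a > 0"
  shows "fourier (\<lambda>w. complex_of_real (lim_kernel i j a w)) \<xi> = fourier (\<lambda>w. complex_of_real (lim_kernel i j 1 w)) (a *\<^sub>R \<xi>)"
proof -
  have [measurable]: "lim_kernel i j a \<in> borel_measurable borel"
    by (intro borel_measurable_continuous_onI continuous_lim_kernel assms)
  have "fourier (\<lambda>w. complex_of_real (lim_kernel i j a w)) \<xi> = \<bar>a\<bar> ^ DIM(real \<times> real) *\<^sub>R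
      (LINT v|lborel. complex_of_real (lim_kernel i j a (0 + a *\<^sub>R v)) * cis (- (\<xi> \<bullet> (0 + a *\<^sub>R v))))"
    unfolding fourier_def by (rule integral_affine) (use assms in auto)
  also have "\<dots> = complex_of_real (a\<^sup>2) * (LINT v|lborel. complex_of_real (1 / a\<^sup>2) *
       (complex_of_real (lim_kernel i j 1 v) * cis (- ((a *\<^sub>R \<xi>) \<bullet> v))))"
    using assms by (simp add: lim_kernel_homogeneous power2_eq_square scaleR_conv_of_real)
  finally show ?thesis using assms by (simp add: fourier_def)
qed

lemma integrable_lim_kernel_height:
  assumes "i \<in> {0, 1, 2}" "j \<in> {0, 1, 2}" "a > 0"
  shows "integrable lborel (\<lambda>w. complex_of_real (lim_kernel i j a w))"
proof (rule integrableI_bounded)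
  have [measurable]: "lim_kernel i j a \<in> borel_measurable borel"
    by (intro borel_measurable_continuous_onI continuous_lim_kernel assms)
  have [measurable]: "lim_kernel i j 1 \<in> borel_measurable borel"
    by (intro borel_measurable_continuous_onI continuous_lim_kernel) simp
  show "(\<lambda>w. complex_of_real (lim_kernel i j a w)) \<in> borel_measurable lborel" by simp
  have "(\<integral>\<^sup>+w. norm (complex_of_real (lim_kernel i j a w)) \<partial>lborel) = ennreal (\<bar>a\<bar> ^ DIM(real \<times> real)) *
      (\<integral>\<^sup>+v. norm (complex_of_real (lim_kernel i j a (0 + a *\<^sub>R v))) \<partial>lborel)"
    by (rule nn_integral_affine) (use assms in auto)
  also have "(\<integral>\<^sup>+v. norm (complex_of_real (lim_kernel i j a (0 + a *\<^sub>R v))) \<partial>lborel) =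
     (\<integral>\<^sup>+v. ennreal (1 / a\<^sup>2) * norm (complex_of_real (lim_kernel i j 1 v)) \<partial>lborel)"
  proof (rule nn_integral_cong)
    fix v
    have "\<bar>lim_kernel i j 1 v / a\<^sup>2\<bar> = 1 / a\<^sup>2 * \<bar>lim_kernel i j 1 v\<bar>" by (simp add: abs_divide)
    then show "ennreal (norm (complex_of_real (lim_kernel i j a (0 + a *\<^sub>R v)))) =
        ennreal (1 / a\<^sup>2) * ennreal (norm (complex_of_real (lim_kernel i j 1 v)))"
      using assms(3) by (simp only: norm_of_real add_0 lim_kernel_homogeneous ennreal_mult[symmetric]) (simp add: ennreal_mult[symmetric])
  qed
  also have "\<dots> = ennreal (1 / a\<^sup>2) * (\<integral>\<^sup>+v. norm (complex_of_real (lim_kernel i j 1 v)) \<partial>lborel)"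
    by (rule nn_integral_cmult) simp
  also have "ennreal (\<bar>a\<bar> ^ DIM(real \<times> real)) * \<dots> < \<infinity>"
    using integrable_lim_kernel[OF assms(1,2)]
    by (simp add: integrable_iff_bounded ennreal_mult_less_top)
  finally show "(\<integral>\<^sup>+w. norm (complex_of_real (lim_kernel i j a w)) \<partial>lborel) < \<infinity>" .
qed

section \<open>Integration over the group\<close>

lemma nn_integral_lborel_pt:
  fixes H :: "pt \<Rightarrow> ennreal"
  assumes [measurable]: "H \<in> borel_measurable borel"
  shows "(\<integral>\<^sup>+z. H z \<partial>lborel) = (\<integral>\<^sup>+g. \<integral>\<^sup>+u. H (fst u, snd u, g) \<partial>lborel \<partial>lborel)"
proof -
  have "(\<integral>\<^sup>+z. H z \<partial>lborel) = (\<integral>\<^sup>+x. \<integral>\<^sup>+w. H (x, w) \<partial>lborel \<partial>lborel)"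
    by (subst lborel_prod[symmetric], subst lborel.nn_integral_fst[symmetric]) (auto simp: lborel_prod)
  also have "\<dots> = (\<integral>\<^sup>+x. \<integral>\<^sup>+y. \<integral>\<^sup>+g. H (x, y, g) \<partial>lborel \<partial>lborel \<partial>lborel)"
    by (subst lborel_prod[symmetric], subst lborel.nn_integral_fst[symmetric]) (auto simp: lborel_prod)
  also have "\<dots> = (\<integral>\<^sup>+x. \<integral>\<^sup>+g. \<integral>\<^sup>+y. H (x, y, g) \<partial>lborel \<partial>lborel \<partial>lborel)"
    by (intro nn_integral_cong lborel_pair.Fubini') (auto simp: lborel_prod)
  also have "\<dots> = (\<integral>\<^sup>+g. \<integral>\<^sup>+x. \<integral>\<^sup>+y. H (x, y, g) \<partial>lborel \<partial>lborel \<partial>lborel)"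
    by (intro lborel_pair.Fubini') (auto simp: lborel_prod)
  also have "\<dots> = (\<integral>\<^sup>+g. \<integral>\<^sup>+u. H (fst u, snd u, g) \<partial>lborel \<partial>lborel)"
  proof (rule nn_integral_cong)
    fix g :: real
    have "(\<integral>\<^sup>+u. H (fst u, snd u, g) \<partial>(lborel :: (real \<times> real) measure)) =
        (\<integral>\<^sup>+u. H (fst u, snd u, g) \<partial>(lborel \<Otimes>\<^sub>M lborel))"
      by (simp add: lborel_prod)
    also have "\<dots> = (\<integral>\<^sup>+x. \<integral>\<^sup>+y. H (x, y, g) \<partial>lborel \<partial>lborel)"
      by (subst lborel.nn_integral_fst[symmetric]) (auto simp: lborel_prod)
    finally show "(\<integral>\<^sup>+x. \<integral>\<^sup>+y. H (x, y, g) \<partial>lborel \<partial>lborel) = (\<integral>\<^sup>+u. H (fst u, snd u, g) \<partial>lborel)" ..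
  qed
  finally show ?thesis .
qed

lemma G_borel [measurable]: "G \<in> sets borel"
proof -
  have "G = {z. 0 < snd (snd z)}" by (auto simp: G_def)
  also have "\<dots> \<in> sets borel"
    by (intro borel_open open_Collect_less continuous_intros)
  finally show ?thesis .
qed

lemma sets_rho: "sets rho = sets (restrict_space borel G)"
  by (simp add: rho_def sets_restrict_space)

lemma borel_measurable_rho: "h \<in> borel_measurable borel \<Longrightarrow> h \<in> borel_measurable rho"
  by (simp add: measurable_cong_sets[OF sets_rho refl] measurable_restrict_space1)

lemma nn_integral_rho:
  assumes [measurable]: "h \<in> borel_measurable borel"
  shows "(\<integral>\<^sup>+y. h y \<partial>rho) =
    (\<integral>\<^sup>+a. ennreal (indicator {0<..} a / a) * (\<integral>\<^sup>+u. h (fst u, snd u, a) \<partial>lborel) \<partial>lborel)"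
proof -
  have "(\<integral>\<^sup>+y. h y \<partial>rho) = (\<integral>\<^sup>+y. ennreal (1 / snd (snd y)) * h y \<partial>restrict_space lborel G)"
    unfolding rho_def case_prod_unfold
    by (rule nn_integral_density) (auto intro!: measurable_restrict_space1)
  also have "\<dots> = (\<integral>\<^sup>+y. ennreal (1 / snd (snd y)) * h y * indicator G y \<partial>lborel)"
    by (rule nn_integral_restrict_space) simp
  also have "\<dots> = (\<integral>\<^sup>+a. \<integral>\<^sup>+u. ennreal (1 / a) * h (fst u, snd u, a) * indicator G (fst u, snd u, a) \<partial>lborel \<partial>lborel)"
    by (subst nn_integral_lborel_pt) auto
  also have "\<dots> = (\<integral>\<^sup>+a. \<integral>\<^sup>+u. ennreal (indicator {0<..} a / a) * h (fst u, snd u, a) \<partial>lborel \<partial>lborel)"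
    by (intro nn_integral_cong) (auto simp: G_def indicator_def)
  also have "\<dots> = (\<integral>\<^sup>+a. ennreal (indicator {0<..} a / a) * (\<integral>\<^sup>+u. h (fst u, snd u, a) \<partial>lborel) \<partial>lborel)"
    by (intro nn_integral_cong nn_integral_cmult) measurable
  finally show ?thesis .
qed

text \<open>An equality of measures transfers Bochner integrals and integrability at once, and it needs to be
  checked on indicator functions only, where Tonelli's theorem asks for no integrability.\<close>

lemma integral_rho_push:
  fixes h :: "pt \<Rightarrow> complex" and \<Phi> :: "'a::euclidean_space \<Rightarrow> pt"
  assumes h [measurable]: "h \<in> borel_measurable borel"
    and \<Phi> [measurable]: "\<Phi> \<in> borel \<rightarrow>\<^sub>M borel" and d [measurable]: "d \<in> borel_measurable borel" "\<And>z. 0 \<le> d z"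
    and eq: "\<And>A. A \<in> sets borel \<Longrightarrow>
      (\<integral>\<^sup>+y. indicator A y \<partial>rho) = (\<integral>\<^sup>+z. ennreal (d z) * indicator A (\<Phi> z) \<partial>lborel)"
  shows "(LINT y|rho. h y) = (LINT z|lborel. complex_of_real (d z) * h (\<Phi> z))"
    and "integrable rho h \<longleftrightarrow> integrable lborel (\<lambda>z. complex_of_real (d z) * h (\<Phi> z))"
proof -
  have id: "(\<lambda>y. y) \<in> rho \<rightarrow>\<^sub>M borel"
    by (rule borel_measurable_rho) simp
  have "distr rho borel (\<lambda>y. y) = distr (density lborel (\<lambda>z. ennreal (d z))) borel \<Phi>"
  proof (rule measure_eqI)
    fix A assume "A \<in> sets (distr rho borel (\<lambda>y. y))"
    then have A [measurable]: "A \<in> sets borel" by simp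
    have "emeasure (distr rho borel (\<lambda>y. y)) A = (\<integral>\<^sup>+y. indicator A y \<partial>distr rho borel (\<lambda>y. y))" by simp
    also have "\<dots> = (\<integral>\<^sup>+y. indicator A y \<partial>rho)" by (rule nn_integral_distr[OF id]) simp
    also have "\<dots> = (\<integral>\<^sup>+z. ennreal (d z) * indicator A (\<Phi> z) \<partial>lborel)" by (rule eq[OF A])
    also have "\<dots> = (\<integral>\<^sup>+z. indicator A (\<Phi> z) \<partial>density lborel (\<lambda>z. ennreal (d z)))"
      by (rule nn_integral_density[symmetric]) auto
    also have "\<dots> = (\<integral>\<^sup>+y. indicator A y \<partial>distr (density lborel (\<lambda>z. ennreal (d z))) borel \<Phi>)"
      by (rule nn_integral_distr[symmetric]) auto
    finally show "emeasure (distr rho borel (\<lambda>y. y)) A = emeasure (distr (density lborel (\<lambda>z. ennreal (d z))) borel \<Phi>) A"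
      by simp
  qed simp
  note M = this
  have "(LINT y|rho. h y) = (LINT y|distr rho borel (\<lambda>y. y). h y)"
    by (rule integral_distr[OF id h, symmetric])
  also have "\<dots> = (LINT z|density lborel (\<lambda>z. ennreal (d z)). h (\<Phi> z))"
    unfolding M by (rule integral_distr) auto
  also have "\<dots> = (LINT z|lborel. d z *\<^sub>R h (\<Phi> z))"
    by (rule integral_density) (auto simp: d)
  finally show "(LINT y|rho. h y) = (LINT z|lborel. complex_of_real (d z) * h (\<Phi> z))"
    by (simp add: scaleR_conv_of_real)
  have "integrable rho h \<longleftrightarrow> integrable (distr rho borel (\<lambda>y. y)) h"
    by (rule integrable_distr_eq[OF id h, symmetric])
  also have "\<dots> \<longleftrightarrow> integrable (density lborel (\<lambda>z. ennreal (d z))) (\<lambda>z. h (\<Phi> z))"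
    unfolding M by (rule integrable_distr_eq) auto
  also have "\<dots> \<longleftrightarrow> integrable lborel (\<lambda>z. d z *\<^sub>R h (\<Phi> z))"
    by (rule integrable_density) (auto simp: d)
  finally show "integrable rho h \<longleftrightarrow> integrable lborel (\<lambda>z. complex_of_real (d z) * h (\<Phi> z))"
    by (simp add: scaleR_conv_of_real)
qed

lemma nn_integral_plane_line:
  fixes H :: "(real \<times> real) \<times> real \<Rightarrow> ennreal"
  assumes [measurable]: "H \<in> borel_measurable borel"
  shows "(\<integral>\<^sup>+z. H z \<partial>lborel) = (\<integral>\<^sup>+g. \<integral>\<^sup>+u. H (u, g) \<partial>lborel \<partial>lborel)"
proof -
  have "(\<integral>\<^sup>+z. H z \<partial>lborel) = (\<integral>\<^sup>+u. \<integral>\<^sup>+g. H (u, g) \<partial>lborel \<partial>lborel)"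
    by (subst lborel_prod[symmetric], subst lborel.nn_integral_fst[symmetric]) (auto simp: lborel_prod)
  also have "\<dots> = (\<integral>\<^sup>+g. \<integral>\<^sup>+u. H (u, g) \<partial>lborel \<partial>lborel)"
    by (intro lborel_pair.Fubini') (auto simp: lborel_prod)
  finally show ?thesis .
qed

lemma integral_rho_coordinates:
  fixes h :: "pt \<Rightarrow> complex"
  assumes h: "h \<in> borel_measurable borel"
  shows "(LINT y|rho. h y) = (LINT z|lborel. complex_of_real (indicator {0<..} (snd z) / snd z) * h (fst (fst z), snd (fst z), snd z))"
    and "integrable rho h \<longleftrightarrow> integrable lborel (\<lambda>z. complex_of_real (indicator {0<..} (snd z) / snd z) * h (fst (fst z), snd (fst z), snd z))"
proof -
  have *: "(\<integral>\<^sup>+y. indicator A y \<partial>rho) =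
     (\<integral>\<^sup>+z. ennreal (indicator {0<..} (snd z) / snd z) * indicator A (fst (fst z), snd (fst z), snd z) \<partial>(lborel :: ((real\<times>real)\<times>real) measure))"
    if [measurable]: "A \<in> sets borel" for A
    by (subst nn_integral_rho, simp, subst nn_integral_plane_line) (auto simp: nn_integral_cmult)
  have meas: "(\<lambda>z::(real\<times>real)\<times>real. (fst (fst z), snd (fst z), snd z)) \<in> borel \<rightarrow>\<^sub>M borel"
    by (intro borel_measurable_continuous_onI continuous_intros)
  have nonneg: "0 \<le> indicator {0<..} (snd z) / snd z" for z :: "(real\<times>real)\<times>real" by (auto simp: indicator_def)
  show "(LINT y|rho. h y) = (LINT z|lborel. complex_of_real (indicator {0<..} (snd z) / snd z) * h (fst (fst z), snd (fst z), snd z))"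
    and "integrable rho h \<longleftrightarrow> integrable lborel (\<lambda>z. complex_of_real (indicator {0<..} (snd z) / snd z) * h (fst (fst z), snd (fst z), snd z))"
    by (rule integral_rho_push[OF h meas _ nonneg *]; simp)+
qed

text \<open>The substitution \<open>y = z\<inverse>x\<close> turns the convolution into an integral in \<open>z = (u, 1/g)\<close>.  Writing
  the height of \<open>z\<close> as \<open>1/g\<close> makes the substitution affine in each variable separately.\<close>

lemma integral_rho_reflect:
  fixes h :: "pt \<Rightarrow> complex"
  assumes h: "h \<in> borel_measurable borel" and a: "a > 0"
  shows "(LINT y|rho. h y) = (LINT z|lborel. complex_of_real (indicator {0<..} (snd z) * snd z) *
     h (snd z * (x1 - fst (fst z)), snd z * (x2 - snd (fst z)), a * snd z))"
proof (rule integral_rho_push(1)[OF h])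
  show "0 \<le> indicator {0<..} (snd z) * snd z" for z :: "(real\<times>real)\<times>real" by (auto simp: indicator_def)
  fix A :: "pt set" assume [measurable]: "A \<in> sets borel"
  define f where "f c = (\<integral>\<^sup>+u. indicator A (fst u, snd u, c) \<partial>lborel)" for c :: real
  have f [measurable]: "f \<in> borel_measurable borel"
  proof -
    have "(\<lambda>z::real\<times>(real\<times>real). indicator A (fst (snd z), snd (snd z), fst z) :: ennreal) \<in> borel_measurable (borel \<Otimes>\<^sub>M lborel)"
      by (simp add: measurable_cong_sets[OF sets_pair_measure_cong[OF refl sets_lborel] refl] borel_prod)
    from lborel.borel_measurable_nn_integral_fst[OF this] show ?thesis by (simp add: f_def[abs_def])
  qed
  have "(\<integral>\<^sup>+y. indicator A y \<partial>rho) = (\<integral>\<^sup>+c. ennreal (indicator {0<..} c / c) * f c \<partial>lborel)"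
    by (simp add: nn_integral_rho f_def)
  also have "\<dots> = ennreal (\<bar>a\<bar> ^ DIM(real)) * (\<integral>\<^sup>+g. ennreal (indicator {0<..} (0 + a *\<^sub>R g) / (0 + a *\<^sub>R g)) * f (0 + a *\<^sub>R g) \<partial>lborel)"
    by (rule nn_integral_affine) (use a in auto)
  also have "\<dots> = (\<integral>\<^sup>+g. ennreal a * (ennreal (indicator {0<..} (a * g) / (a * g)) * f (a * g)) \<partial>lborel)"
    using a by (simp add: nn_integral_cmult)
  also have "\<dots> = (\<integral>\<^sup>+g. \<integral>\<^sup>+u. ennreal (indicator {0<..} g * g) * indicator A (g * (x1 - fst u), g * (x2 - snd u), a * g) \<partial>lborel \<partial>lborel)"
  proof (rule nn_integral_cong)
    fix g :: real
    show "ennreal a * (ennreal (indicator {0<..} (a * g) / (a * g)) * f (a * g)) =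
      (\<integral>\<^sup>+u. ennreal (indicator {0<..} g * g) * indicator A (g * (x1 - fst u), g * (x2 - snd u), a * g) \<partial>lborel)"
    proof (cases "g > 0")
      case True
      have "f (a * g) = ennreal (\<bar>- g\<bar> ^ DIM(real\<times>real)) *
         (\<integral>\<^sup>+u. indicator A (fst ((g * x1, g * x2) + (- g) *\<^sub>R u), snd ((g * x1, g * x2) + (- g) *\<^sub>R u), a * g) \<partial>lborel)"
        unfolding f_def by (rule nn_integral_affine) (use True in auto)
      also have "\<dots> = ennreal (g * g) * (\<integral>\<^sup>+u. indicator A (g * (x1 - fst u), g * (x2 - snd u), a * g) \<partial>lborel)"
        using True by (simp add: power2_eq_square right_diff_distrib)
      finally have "ennreal a * (ennreal (1 / (a * g)) * f (a * g)) =
         (ennreal a * (ennreal (1 / (a * g)) * ennreal (g * g))) * (\<integral>\<^sup>+u. indicator A (g * (x1 - fst u), g * (x2 - snd u), a * g) \<partial>lborel)"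
        by (simp add: mult.assoc)
      also have "ennreal a * (ennreal (1 / (a * g)) * ennreal (g * g)) = ennreal g"
        using True a by (simp add: ennreal_mult[symmetric])
      finally show ?thesis using True a by (simp add: nn_integral_cmult)
    next
      case False
      then have "\<not> 0 < a * g" using a by (simp add: zero_less_mult_iff)
      then show ?thesis using False by simp
    qed
  qed
  also have "\<dots> = (\<integral>\<^sup>+z. ennreal (indicator {0<..} (snd z) * snd z) *
      indicator A (snd z * (x1 - fst (fst z)), snd z * (x2 - snd (fst z)), a * snd z) \<partial>lborel)"
    by (subst nn_integral_plane_line) auto
  finally show "(\<integral>\<^sup>+y. indicator A y \<partial>rho) = (\<integral>\<^sup>+z. ennreal (indicator {0<..} (snd z) * snd z) *
      indicator A (snd z * (x1 - fst (fst z)), snd z * (x2 - snd (fst z)), a * snd z) \<partial>lborel)" .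
qed measurable

lemma measure_rho_box:
  assumes "0 < \<alpha>" "\<alpha> \<le> \<beta>"
  shows "measure rho ({-1..1} \<times> {-1..1} \<times> {\<alpha>..\<beta>}) = 4 * (ln \<beta> - ln \<alpha>)"
proof -
  let ?R = "{-1..1::real} \<times> {-1..1::real} \<times> {\<alpha>..\<beta>}"
  have R [measurable]: "?R \<in> sets borel"
    by (intro borel_closed closed_Times) auto
  have sq: "emeasure lborel square = 4"
    by (simp add: square_cbox emeasure_lborel_cbox_eq Basis_prod_def)
  have RG: "?R \<subseteq> G" using assms by (auto simp: G_def)
  then have "?R \<in> sets rho"
    by (auto simp: sets_rho sets_restrict_space intro!: image_eqI[of _ _ ?R] R)
  then have "emeasure rho ?R = (\<integral>\<^sup>+y. indicator ?R y \<partial>rho)" by simp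
  also have "\<dots> = (\<integral>\<^sup>+a. ennreal (indicator {0<..} a / a) * (\<integral>\<^sup>+u. indicator ?R (fst u, snd u, a) \<partial>lborel) \<partial>lborel)"
    by (rule nn_integral_rho) simp
  also have "\<dots> = (\<integral>\<^sup>+a. 4 * (ennreal (1 / a) * indicator {\<alpha>..\<beta>} a) \<partial>lborel)"
  proof (rule nn_integral_cong)
    fix a
    have "(\<integral>\<^sup>+u. indicator ?R (fst u, snd u, a) \<partial>lborel) = (\<integral>\<^sup>+u. indicator {\<alpha>..\<beta>} a * indicator square u \<partial>lborel)"
      by (intro nn_integral_cong) (auto simp: indicator_def square_def)
    also have "\<dots> = indicator {\<alpha>..\<beta>} a * (\<integral>\<^sup>+u. indicator square u \<partial>lborel)"
      by (rule nn_integral_cmult) (simp add: square_cbox)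
    also have "(\<integral>\<^sup>+u. indicator square u \<partial>lborel) = emeasure lborel square"
      by (rule nn_integral_indicator) (simp add: square_cbox)
    finally show "ennreal (indicator {0<..} a / a) * (\<integral>\<^sup>+u. indicator ?R (fst u, snd u, a) \<partial>lborel) = 4 * (ennreal (1 / a) * indicator {\<alpha>..\<beta>} a)"
      using assms by (auto simp: sq indicator_def mult.commute)
  qed
  also have "\<dots> = 4 * (\<integral>\<^sup>+a. ennreal (1 / a) * indicator {\<alpha>..\<beta>} a \<partial>lborel)"
    by (rule nn_integral_cmult) simp
  also have "(\<integral>\<^sup>+a. ennreal (1 / a) * indicator {\<alpha>..\<beta>} a \<partial>lborel) = ennreal (ln \<beta> - ln \<alpha>)"
    by (rule nn_integral_FTC_Icc) (use assms in \<open>auto intro!: derivative_eq_intros\<close>)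
  also have "4 * ennreal (ln \<beta> - ln \<alpha>) = ennreal (4 * (ln \<beta> - ln \<alpha>))"
    using assms by (subst ennreal_mult) auto
  finally show ?thesis using assms by (simp add: measure_def)
qed

section \<open>Probes: multiples of atoms concentrated near the boundary\<close>

text \<open>This is the density of the cut-off in the reciprocal height \<open>g = 1/b\<close>: the measure \<open>db/b\<close> is \<open>dg/g\<close>.\<close>

definition dual_cut :: "real \<Rightarrow> real \<Rightarrow> real" where
  "dual_cut r g = indicator {0<..} g * (height_cut r (1 / g) / g)"

definition cut_mass :: "real \<Rightarrow> real" where
  "cut_mass r = (LINT g|lborel. dual_cut r g)"

lemma dual_cut_nonneg: "0 \<le> dual_cut r g"
  by (auto simp: dual_cut_def indicator_def height_cut_bounds)

lemma dual_cut_outside: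
  assumes "g \<notin> {exp (6 * r)..exp (8 * r)}" shows "dual_cut r g = 0"
proof (cases "g > 0")
  case True
  then have "1 / g \<notin> {exp (-8 * r)..exp (-6 * r)}"
    using assms by (auto simp: exp_minus field_simps)
  then show ?thesis by (simp add: dual_cut_def height_cut_outside)
qed (simp add: dual_cut_def)

lemma isCont_smooth1: "smooth1 h \<Longrightarrow> isCont h x"
  by (metis DERIV_isCont smooth1_deriv)

lemma continuous_on_height_cut [continuous_intros]:
  assumes "continuous_on A f" shows "continuous_on A (\<lambda>x. height_cut r (f x))"
proof -
  have "continuous_on UNIV bump"
    by (simp add: continuous_at_imp_continuous_on isCont_smooth1[OF smooth1_bump])
  then have b: "continuous_on A (\<lambda>x. bump (h x))" if "continuous_on A h" for h
    by (rule continuous_on_compose2[OF _ that]) simp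
  show ?thesis unfolding height_cut_def by (intro continuous_on_mult b continuous_intros assms)
qed

lemma continuous_on_square_fun_compose:
  assumes "square_fun p" "continuous_on A f" shows "continuous_on A (\<lambda>x. p (f x))"
  by (rule continuous_on_compose2[OF square_fun_continuous[OF assms(1)] assms(2) subset_UNIV])

lemma continuous_on_dual_cut: "continuous_on {exp (6 * r)..exp (8 * r)} (dual_cut r)"
proof -
  have pos: "g > 0" if "g \<in> {exp (6 * r)..exp (8 * r)}" for g
    using that less_le_trans[OF exp_gt_zero[of "6 * r"]] by simp
  have "continuous_on {exp (6 * r)..exp (8 * r)} (\<lambda>g. height_cut r (1 / g) / g)"
    by (intro continuous_intros) (auto dest!: pos[unfolded atLeastAtMost_iff, OF conjI])
  then show ?thesis
  proof (rule continuous_on_eq)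
    fix g assume "g \<in> {exp (6 * r)..exp (8 * r)}"
    then have "g \<in> {0<..}" unfolding greaterThan_iff by (rule pos)
    then show "height_cut r (1 / g) / g = dual_cut r g"
      unfolding dual_cut_def by (simp only: indicator_simps mult_1)
  qed
qed

lemma integrable_dual_cut: "integrable lborel (dual_cut r)"
proof -
  have "integrable lborel (\<lambda>g. indicator {exp (6 * r)..exp (8 * r)} g *\<^sub>R dual_cut r g)"
    by (intro borel_integrable_compact continuous_on_dual_cut) simp
  also have "(\<lambda>g. indicator {exp (6 * r)..exp (8 * r)} g *\<^sub>R dual_cut r g) = dual_cut r"
    using dual_cut_outside by (force simp: indicator_def fun_eq_iff)
  finally show ?thesis .
qed

lemma cut_mass_ge:
  assumes "1 \<le> r" shows "exp (-2) * r / 2 \<le> cut_mass r"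
proof -
  let ?I = "{2 * exp (6 * r)..exp (8 * r) / 2}"
  have e: "exp (8 * r) = exp (6 * r) * exp (2 * r)" by (simp add: exp_add[symmetric])
  have "2\<^sup>2 \<le> (exp r)\<^sup>2" by (intro power_mono order_trans[OF _ exp_ge_add_one_self]) (use assms in auto)
  then have "2 * 2 \<le> exp (2 * r)" by (simp add: exp_double)
  then have le: "2 * exp (6 * r) \<le> exp (8 * r) / 2" by (simp add: e)
  have int: "has_bochner_integral lborel (\<lambda>g. (1 / g) * indicator ?I g) (ln (exp (8 * r) / 2) - ln (2 * exp (6 * r)))"
  proof (rule has_bochner_integral_FTC_Icc_nonneg[OF _ _ _ le])
    fix g assume "g \<in> ?I"
    then have g: "0 < g" using less_le_trans[of 0 "2 * exp (6 * r)" g] by simp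
    show "DERIV ln g :> 1 / g" "0 \<le> 1 / g"
      using g by (auto intro!: derivative_eq_intros)
  qed simp
  have "ln (exp (8 * r) / 2) - ln (2 * exp (6 * r)) = 2 * r - 2 * ln 2"
    by (simp add: ln_div ln_mult)
  moreover have "ln 2 \<le> (3 / 4 :: real)" using ln2_le_25_over_36 by simp
  ultimately have "r / 2 \<le> (LINT g|lborel. (1 / g) * indicator ?I g)"
    using assms has_bochner_integral_integral_eq[OF int] by simp
  then have "exp (-2) * (r / 2) \<le> exp (-2) * (LINT g|lborel. (1 / g) * indicator ?I g)"
    by (rule mult_left_mono) simp
  then have "exp (-2) * r / 2 \<le> (LINT g|lborel. exp (-2) * ((1 / g) * indicator ?I g))"
    by (simp only: integral_mult_right_zero times_divide_eq_right)
  also have "\<dots> \<le> cut_mass r"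
    unfolding cut_mass_def
  proof (rule integral_mono)
    show "integrable lborel (\<lambda>g. exp (-2) * ((1 / g) * indicator ?I g))"
      using int by (intro integrable_mult_right) (auto simp: has_bochner_integral_iff)
    show "integrable lborel (dual_cut r)" by (rule integrable_dual_cut)
    fix g :: real
    show "exp (-2) * ((1 / g) * indicator ?I g) \<le> dual_cut r g"
    proof (cases "g \<in> ?I")
      case True
      have g: "g > 0" using True by (auto intro: less_le_trans[of 0 "2 * exp (6 * r)"])
      have "exp (-2) \<le> height_cut r (1 / g)"
        using True g by (intro height_cut_ge) (auto simp: exp_minus field_simps)
      then show ?thesis using g True by (simp add: dual_cut_def divide_right_mono)
    qed (simp add: dual_cut_nonneg)
  qed
  finally show ?thesis .
qed

lemma cut_mass_pos: "1 \<le> r \<Longrightarrow> 0 < cut_mass r"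
  by (rule less_le_trans[OF _ cut_mass_ge[of r]]) auto

text \<open>Letting \<open>r\<close> grow moves the probe towards the boundary \<open>a = 0\<close>.\<close>

definition probe :: "(real \<times> real \<Rightarrow> complex) \<Rightarrow> real \<Rightarrow> pt \<Rightarrow> complex" where
  "probe p r = (\<lambda>(u1, u2, b). p (u1, u2) * complex_of_real (1 / cut_mass r * height_cut r b))"

lemma test_fun_probe: "square_fun p \<Longrightarrow> test_fun (probe p r)"
  unfolding probe_def by (rule test_fun_product) (auto simp: square_fun_def)

lemma continuous_probe:
  assumes "square_fun p" shows "continuous_on UNIV (probe p r)"
proof -
  have "continuous_on UNIV (\<lambda>z::pt. p (fst z, fst (snd z)) * complex_of_real (1 / cut_mass r * height_cut r (snd (snd z))))"
    by (intro continuous_on_mult continuous_on_square_fun_compose[OF assms] continuous_intros)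
  then show ?thesis by (simp add: probe_def case_prod_unfold)
qed

lemma borel_measurable_probe [measurable_dest]: "square_fun p \<Longrightarrow> probe p r \<in> borel_measurable borel"
  by (intro borel_measurable_continuous_onI continuous_probe)

lemma probe_integral:
  assumes p: "square_fun p" and "(LINT u|lborel. p u) = 0"
  shows "integrable rho (probe p r)" and "(LINT y|rho. probe p r y) = 0"
proof -
  define h where "h b = complex_of_real (indicator {0<..} b / b * (1 / cut_mass r * height_cut r b))" for b
  have "continuous_on {exp (-8 * r)..exp (-6 * r)} (\<lambda>b. complex_of_real (1 / b * (1 / cut_mass r * height_cut r b)))"
    by (intro continuous_intros) (auto simp: not_le[symmetric])
  then have "integrable lborel (\<lambda>b. indicator {exp (-8 * r)..exp (-6 * r)} b *\<^sub>R complex_of_real (1 / b * (1 / cut_mass r * height_cut r b)))"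
    by (intro borel_integrable_compact) simp_all
  also have "(\<lambda>b. indicator {exp (-8 * r)..exp (-6 * r)} b *\<^sub>R complex_of_real (1 / b * (1 / cut_mass r * height_cut r b))) = h"
  proof (rule ext)
    fix b
    show "indicator {exp (-8 * r)..exp (-6 * r)} b *\<^sub>R complex_of_real (1 / b * (1 / cut_mass r * height_cut r b)) = h b"
    proof (cases "b \<in> {exp (-8 * r)..exp (-6 * r)}")
      case True
      then have "b > 0" using less_le_trans[OF exp_gt_zero] by auto
      with True show ?thesis by (simp add: h_def)
    qed (simp add: h_def height_cut_outside)
  qed
  finally have h: "integrable lborel h" .
  have eq: "complex_of_real (indicator {0<..} (snd z) / snd z) * probe p r (fst (fst z), snd (fst z), snd z) = p (fst z) * h (snd z)" for z
    by (simp add: probe_def h_def)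
  have meas: "probe p r \<in> borel_measurable borel" using p by measurable
  note lp = lborel_integral_product[OF integrable_square_fun[OF p] h]
  show "integrable rho (probe p r)"
    unfolding integral_rho_coordinates(2)[OF meas] eq by (rule lp(1))
  show "(LINT y|rho. probe p r y) = 0"
    unfolding integral_rho_coordinates(1)[OF meas] eq lp(2) assms(2) by simp
qed

lemma cz_set_box:
  assumes "1 \<le> r"
  shows "cz_set ({-1..1} \<times> {-1..1} \<times> {exp (-8 * r)..exp (-6 * r)})"
proof -
  have "exp (-7 * r) * exp (2 * r) \<le> exp 0" using assms unfolding exp_add[symmetric] exp_le_cancel_iff by simp
  moreover have "exp (-7 * r) * exp (8 * r) = exp r" unfolding exp_add[symmetric] by simp
  moreover have "2 < exp r"
  proof -
    have "(3 / 2)\<^sup>2 \<le> (exp (r / 2))\<^sup>2"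
      by (intro power_mono order_trans[OF _ exp_ge_add_one_self]) (use assms in auto)
    also have "(exp (r / 2))\<^sup>2 = exp r" by (simp add: exp_double[symmetric])
    finally show ?thesis by (simp add: power2_eq_square)
  qed
  moreover have "exp (-7 * r) * exp (- r) = exp (-8 * r)" "exp (-7 * r) * exp r = exp (-6 * r)"
    unfolding exp_add[symmetric] by simp_all
  ultimately show ?thesis
    unfolding cz_set_def
    by (intro exI[of _ 0] exI[of _ 2] exI[of _ r] exI[of _ "exp (-7 * r)"]) (use assms in auto)
qed

text \<open>A single atom is a series with one term.\<close>

lemma H1_normI:
  assumes A: "atom A" and f: "f = (\<lambda>x. c * A x)"
  shows "f \<in> H1" and "H1_norm f \<le> norm c"
proof -
  define cs where "cs j = (if j = 0 then c else 0)" for j :: nat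
  have sums: "(\<lambda>j. norm (cs j)) sums norm c"
    using sums_single[of 0 "\<lambda>j. norm c"] by (simp add: cs_def if_distrib[of norm] cong: if_cong)
  have part: "(\<Sum>j<n. cs j * A x) = c * A x" if "n > 0" for n x
  proof -
    have "(\<Sum>j<n. cs j * A x) = (\<Sum>j<n. if j = 0 then c * A x else 0)" by (intro sum.cong) (auto simp: cs_def)
    then show ?thesis using that by (simp add: sum.delta)
  qed
  have "(\<lambda>n. LINT x|rho. norm (f x - (\<Sum>j<n. cs j * A x))) \<longlonglongrightarrow> 0"
    by (rule Lim_transform_eventually[of "\<lambda>_. 0"])
      (auto simp: eventually_sequentially f part intro!: exI[of _ 1])
  then have dec: "atomic_decomp f cs (\<lambda>_. A)"
    using A sums by (auto simp: atomic_decomp_def sums_iff)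
  then show "f \<in> H1"
    using A f by (auto simp: H1_def atom_def)
  have "H1_norm f \<le> (\<Sum>j. norm (cs j))"
    unfolding H1_norm_def
    by (rule cInf_lower) (use dec in \<open>auto intro!: bdd_belowI[of _ 0] suminf_nonneg simp: atomic_decomp_def\<close>)
  then show "H1_norm f \<le> norm c" using sums by (simp add: sums_iff)
qed

text \<open>The mass of the cut-off is at least a constant times \<open>r\<close> and the measure of the box is \<open>8r\<close>, so
  that the supremum of the probe and the reciprocal of the measure are comparable.\<close>

lemma probe_H1:
  assumes p: "square_fun p" and mean: "(LINT u|lborel. p u) = 0" and bnd: "\<And>u. norm (p u) \<le> 4" and r: "1 \<le> r"
  shows "probe p r \<in> H1" and "H1_norm (probe p r) \<le> 64 * exp 2"
proof -
  define c :: complex where "c = complex_of_real (64 * exp 2)"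
  define A where "A x = probe p r x / c" for x
  let ?R = "{-1..1} \<times> {-1..1} \<times> {exp (-8 * r)..exp (-6 * r)}"
  have R: "measure rho ?R = 8 * r"
    using r by (subst measure_rho_box) auto
  have "atom A"
    unfolding atom_def
  proof (intro conjI exI[of _ ?R] cz_set_box r AE_I2 impI)
    show "integrable rho A" "(LINT x|rho. A x) = 0"
      using probe_integral[OF p mean, of r] unfolding A_def
      by (auto intro: integrable_divide)
    fix x :: pt
    obtain u1 u2 b where x: "x = (u1, u2, b)" by (cases x)
    show "A x = 0" if "x \<notin> ?R"
    proof -
      have "(u1, u2) \<notin> square \<or> b \<notin> {exp (-8 * r)..exp (-6 * r)}"
        using that by (auto simp: x square_def)
      then show ?thesis
        using square_fun_outside[OF p] height_cut_outside[of b r] by (auto simp: A_def probe_def x)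
    qed
    have m: "1 / cut_mass r \<le> 2 * exp 2 / r"
    proof -
      have "1 / cut_mass r \<le> 1 / (exp (-2) * r / 2)"
        by (rule divide_left_mono[OF cut_mass_ge[OF r]]) (use r cut_mass_pos[OF r] in auto)
      then show ?thesis by (simp add: exp_minus field_simps)
    qed
    have "norm (probe p r x) = norm (p (u1, u2)) * (1 / cut_mass r * height_cut r b)"
      using cut_mass_pos[OF r] height_cut_bounds[of r b] by (simp add: x probe_def norm_mult norm_divide)
    also have "\<dots> \<le> 4 * (2 * exp 2 / r * 1)"
      using r cut_mass_pos[OF r] by (intro mult_mono bnd m height_cut_bounds mult_nonneg_nonneg) auto
    finally have "norm (probe p r x) \<le> 8 * exp 2 / r" by simp
    then have "norm (probe p r x) / (64 * exp 2) \<le> (8 * exp 2 / r) / (64 * exp 2)"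
      by (rule divide_right_mono) simp
    moreover have "norm (A x) = norm (probe p r x) / (64 * exp 2)"
      unfolding A_def c_def norm_divide norm_of_real by simp
    ultimately have "norm (A x) \<le> (8 * exp 2 / r) / (64 * exp 2)" by simp
    then show "norm (A x) \<le> 1 / measure rho ?R" unfolding R by simp
  qed
  from H1_normI[OF this, of "probe p r" c]
  show "probe p r \<in> H1" and "H1_norm (probe p r) \<le> 64 * exp 2"
    by (auto simp: A_def c_def fun_eq_iff norm_mult)
qed

section \<open>The potential of a probe\<close>

text \<open>The substitution \<open>z = (u, 1/g)\<close> turns a convolution with a probe into an average of the kernel against
  \<open>weight\<close>, whose part in \<open>g\<close> has integral one.  The kernel stays a parameter because differentiation replaces it
  by its derivative.\<close>

definition weight :: "(real \<times> real \<Rightarrow> complex) \<Rightarrow> real \<Rightarrow> (real \<times> real) \<times> real \<Rightarrow> complex" where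
  "weight p r z = p (fst z) * complex_of_real (dual_cut r (snd z) / cut_mass r)"

definition base_shift :: "pt \<Rightarrow> real \<times> real \<Rightarrow> pt" where
  "base_shift x u = (fst x - fst u, fst (snd x) - snd u, snd (snd x))"

definition potential :: "(real \<times> real \<Rightarrow> complex) \<Rightarrow> real \<Rightarrow> (pt \<Rightarrow> real \<Rightarrow> real) \<Rightarrow> pt \<Rightarrow> complex" where
  "potential p r K x = (LINT z|lborel. weight p r z * complex_of_real (K (base_shift x (fst z)) (1 / snd z)))"

lemma W_explicit:
  assumes "c > 0"
  shows "W (y1, y2, c) = 1 / (4 * pi) * (1 / c) * (1 / sqrt ((cosh_dist (y1, y2, c))\<^sup>2 - 1))"
proof -
  have G: "(y1, y2, c) \<in> G" using assms by (simp add: G_def)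
  have "sinh (dist_e (y1, y2, c)) = sqrt ((cosh_dist (y1, y2, c))\<^sup>2 - 1)"
    using cosh_dist_e[OF G] sinh_square_eq[of "dist_e (y1, y2, c)"]
    by (metis real_sqrt_unique sinh_real_nonneg_iff)
  moreover have "(1 / c\<^sup>2) powr (1 / 2) = 1 / c"
    using assms by (simp add: powr_half_sqrt real_sqrt_divide)
  ultimately show ?thesis by (simp add: W_def)
qed

lemma W_reflect:
  assumes "a > 0" "g > 0"
  shows "W (g * w1, g * w2, a * g) = K0 (w1, w2, a) (1 / g) / g\<^sup>2"
proof -
  have C: "cosh_dist (g * w1, g * w2, a * g) = ssum (w1, w2, a) (1 / g) * (g / (2 * a))"
    using assms by (simp add: ssum_def field_simps power2_eq_square)
  have "(cosh_dist (g * w1, g * w2, a * g))\<^sup>2 - 1 = disc (w1, w2, a) (1 / g) * (g / (2 * a))\<^sup>2"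
    unfolding C disc_def using assms by (simp add: power_mult_distrib field_simps power2_eq_square)
  then have "sqrt ((cosh_dist (g * w1, g * w2, a * g))\<^sup>2 - 1) = sqrt (disc (w1, w2, a) (1 / g)) * (g / (2 * a))"
    using assms by (simp add: real_sqrt_mult)
  then show ?thesis
    using assms by (simp add: W_explicit K0_def power2_eq_square)
qed

lemma conv_probe:
  assumes p: "square_fun p" and "snd (snd x) > 0"
  shows "conv (probe p r) (\<lambda>x. complex_of_real (W x)) x = potential p r K0 x"
proof -
  obtain x1 x2 a where x: "x = (x1, x2, a)" by (cases x)
  have a: "a > 0" using assms(2) by (simp add: x)
  \<comment> \<open>a Borel function on the whole space that agrees with the integrand on \<open>G\<close>\<close>
  define h where "h y = probe p r (x1 + a * (- fst y / snd (snd y)), x2 + a * (- fst (snd y) / snd (snd y)), a * (1 / snd (snd y))) *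
     complex_of_real (1 / (4 * pi) * (1 / snd (snd y)) * (1 / sqrt (((snd (snd y) + 1 / snd (snd y) + ((fst y)\<^sup>2 + (fst (snd y))\<^sup>2) / snd (snd y)) / 2)\<^sup>2 - 1)))" for y
  have [measurable]: "probe p r \<in> borel_measurable borel" using p by measurable
  have h_meas: "h \<in> borel_measurable borel"
    unfolding h_def[abs_def] by measurable
  have h_eq: "probe p r (gmult x (ginv y)) * complex_of_real (W y) = h y" if "y \<in> G" for y
    using that by (cases y) (simp add: h_def x G_def W_explicit)
  have "conv (probe p r) (\<lambda>x. complex_of_real (W x)) x = (LINT y|rho. h y)"
    unfolding conv_def by (intro Bochner_Integration.integral_cong refl h_eq) (simp add: space_rho)
  also have "\<dots> = (LINT z|lborel. complex_of_real (indicator {0<..} (snd z) * snd z) *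
     h (snd z * (x1 - fst (fst z)), snd z * (x2 - snd (fst z)), a * snd z))"
    by (rule integral_rho_reflect[OF h_meas a])
  also have "\<dots> = potential p r K0 x"
    unfolding potential_def
  proof (intro Bochner_Integration.integral_cong refl)
    fix z :: "(real \<times> real) \<times> real"
    obtain u1 u2 g where z: "z = ((u1, u2), g)" by (metis surj_pair)
    show "complex_of_real (indicator {0<..} (snd z) * snd z) * h (snd z * (x1 - fst (fst z)), snd z * (x2 - snd (fst z)), a * snd z) =
       weight p r z * complex_of_real (K0 (base_shift x (fst z)) (1 / snd z))"
    proof (cases "g > 0")
      case True
      have yG: "(g * (x1 - u1), g * (x2 - u2), a * g) \<in> G" using True a by (simp add: G_def)
      have inv: "gmult x (ginv (g * (x1 - u1), g * (x2 - u2), a * g)) = (u1, u2, 1 / g)"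
        using True a by (simp add: x)
      have "h (g * (x1 - u1), g * (x2 - u2), a * g) = probe p r (u1, u2, 1 / g) * complex_of_real (K0 (x1 - u1, x2 - u2, a) (1 / g) / g\<^sup>2)"
        using h_eq[OF yG] unfolding inv W_reflect[OF a True] by simp
      then show ?thesis using True
        by (simp add: z x weight_def base_shift_def probe_def dual_cut_def power2_eq_square mult_ac)
    next
      case False
      then show ?thesis by (simp add: z weight_def dual_cut_def)
    qed
  qed
  finally show ?thesis .
qed

section \<open>Differentiating the potential and letting the probe approach the boundary\<close>

definition probe_box :: "real \<Rightarrow> ((real \<times> real) \<times> real) set" where
  "probe_box r = cbox ((-1, -1), exp (6 * r)) ((1, 1), exp (8 * r))"

lemma mem_probe_box: "z \<in> probe_box r \<longleftrightarrow> fst z \<in> square \<and> snd z \<in> {exp (6 * r)..exp (8 * r)}"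
  by (cases z) (auto simp: probe_box_def square_cbox cbox_Pair_eq)

lemma probe_box_height:
  assumes "z \<in> probe_box r" shows "0 < snd z" "1 / snd z \<le> exp (-6 * r)"
proof -
  have "exp (6 * r) \<le> snd z" using assms by (simp add: mem_probe_box)
  moreover from this show "0 < snd z" by (rule less_le_trans[OF exp_gt_zero])
  ultimately show "1 / snd z \<le> exp (-6 * r)" by (simp add: exp_minus field_simps)
qed

lemma weight_outside: "square_fun p \<Longrightarrow> z \<notin> probe_box r \<Longrightarrow> weight p r z = 0"
  unfolding mem_probe_box weight_def by (auto simp: square_fun_outside dual_cut_outside)

lemma continuous_on_weight:
  assumes "square_fun p" shows "continuous_on (probe_box r) (weight p r)"
proof -
  have "continuous_on (probe_box r) (\<lambda>z. dual_cut r (snd z))"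
    by (rule continuous_on_compose2[OF continuous_on_dual_cut])
      (auto simp: mem_probe_box intro!: continuous_intros)
  then show ?thesis unfolding weight_def[abs_def] divide_inverse
    by (intro continuous_on_mult continuous_on_of_real continuous_on_const
        continuous_on_square_fun_compose[OF assms] continuous_on_fst continuous_on_id)
qed

lemma weight_integrable_mult:
  assumes p: "square_fun p" and h: "continuous_on (probe_box r) h"
  shows "integrable lborel (\<lambda>z. weight p r z * h z)"
    and "(LINT z|lborel. weight p r z * h z) = integral (probe_box r) (\<lambda>z. weight p r z * h z)"
    and "(\<lambda>z. weight p r z * h z) integrable_on probe_box r"
proof -
  have eq: "(\<lambda>z. indicator (probe_box r) z *\<^sub>R (weight p r z * h z)) = (\<lambda>z. weight p r z * h z)"
    using weight_outside[OF p] by (force simp: indicator_def fun_eq_iff)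
  have int: "integrable lborel (\<lambda>z. indicator (probe_box r) z *\<^sub>R (weight p r z * h z))"
    by (intro borel_integrable_compact continuous_on_mult continuous_on_weight p h)
      (simp add: probe_box_def)
  then show "integrable lborel (\<lambda>z. weight p r z * h z)" by (simp only: eq)
  from int have "set_integrable lborel (probe_box r) (\<lambda>z. weight p r z * h z)"
    by (simp add: set_integrable_def)
  from set_borel_integral_eq_integral[OF this]
  show "(LINT z|lborel. weight p r z * h z) = integral (probe_box r) (\<lambda>z. weight p r z * h z)"
    and "(\<lambda>z. weight p r z * h z) integrable_on probe_box r"
    by (simp_all only: set_lebesgue_integral_def eq)
qed

text \<open>The coordinate line through \<open>x\<close> along which \<open>X i\<close> differentiates.\<close>

definition move :: "nat \<Rightarrow> pt \<Rightarrow> real \<Rightarrow> pt" where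
  "move i x t = (if i = 0 then (fst x, fst (snd x), t)
     else if i = 1 then (t, fst (snd x), snd (snd x)) else (fst x, t, snd (snd x)))"

lemma move_co: "i \<in> {0, 1, 2} \<Longrightarrow> move i x (co i x) = x"
  by (cases x) (auto simp: move_def co_def)

lemma X_eq: "i \<in> {0, 1, 2} \<Longrightarrow> X i F x = co 0 x *\<^sub>R vector_derivative (\<lambda>t. F (move i x t)) (at (co i x))"
  by (cases x) (auto simp: X_def move_def co_def)

lemma DERIV_base_shift_move:
  assumes "i \<in> {0, 1, 2}" "j \<in> {0, 1, 2}"
  shows "((\<lambda>t. co j (base_shift (move i x t) u)) has_real_derivative of_bool (i = j)) (at t)"
  using assms by (cases x) (auto simp: move_def co_def base_shift_def intro!: derivative_eq_intros)

lemma co_0_base_shift: "co 0 (base_shift x u) = co 0 x"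
  by (simp add: co_def base_shift_def)

lemma continuous_on_base_shift_move [continuous_intros]:
  assumes "continuous_on A f" "continuous_on A g" shows "continuous_on A (\<lambda>z. base_shift (move i x (f z)) (g z))"
  unfolding base_shift_def move_def
  by (cases "i = 0"; cases "i = 1") (auto intro!: continuous_intros assms)

text \<open>Above the height of the probe the kernel has no singularity, and one may differentiate
  under the integral sign.\<close>

lemma X_potential:
  assumes p: "square_fun p" and i: "i \<in> {0, 1, 2}"
    and D: "\<And>z t b. (\<And>j. j \<in> {0, 1, 2} \<Longrightarrow> ((\<lambda>t. co j (z t)) has_real_derivative of_bool (i = j)) (at t)) \<Longrightarrow>
        0 \<le> b \<Longrightarrow> b < co 0 (z t) \<Longrightarrow> ((\<lambda>t. K (z t) b) has_real_derivative K' (z t) b / co 0 (z t)) (at t)"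
    and K: "\<And>A z b. continuous_on A z \<Longrightarrow> continuous_on A b \<Longrightarrow> (\<And>x::(real\<times>real)\<times>real. x \<in> A \<Longrightarrow> 0 \<le> b x) \<Longrightarrow>
        (\<And>x. x \<in> A \<Longrightarrow> b x < co 0 (z x)) \<Longrightarrow> continuous_on A (\<lambda>x. K (z x) (b x))"
    and K': "\<And>A z b. continuous_on A z \<Longrightarrow> continuous_on A b \<Longrightarrow> (\<And>x::real\<times>(real\<times>real)\<times>real. x \<in> A \<Longrightarrow> 0 \<le> b x) \<Longrightarrow>
        (\<And>x. x \<in> A \<Longrightarrow> b x < co 0 (z x)) \<Longrightarrow> continuous_on A (\<lambda>x. K' (z x) (b x))"
    and F: "\<And>x. exp (-6 * r) < co 0 x \<Longrightarrow> F x = potential p r K x"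
    and x: "exp (-6 * r) < co 0 x"
  shows "X i F x = potential p r K' x"
proof -
  \<comment> \<open>the parameters for which the coordinate line stays above the support of the probe\<close>
  define U where "U = (if i = 0 then {exp (-6 * r)<..} else UNIV)"
  have U: "open U" "convex U" "co i x \<in> U" using x by (auto simp: U_def)
  have high: "exp (-6 * r) < co 0 (move i x t)" if "t \<in> U" for t
    using that x i by (auto simp: U_def move_def co_def split: if_splits)
  have low: "0 \<le> 1 / snd z" "1 / snd z < co 0 (base_shift (move i x t) (fst z))" if "z \<in> probe_box r" "t \<in> U" for z t
    using probe_box_height[OF that(1)] high[OF that(2)] by (auto simp: co_0_base_shift)
  define f where "f t z = weight p r z * complex_of_real (K (base_shift (move i x t) (fst z)) (1 / snd z))" for t z
  define f' where "f' t z = weight p r z * complex_of_real (K' (base_shift (move i x t) (fst z)) (1 / snd z) / co 0 (move i x t))" for t z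
  have nz: "snd z \<noteq> 0" if "z \<in> probe_box r" for z using probe_box_height(1)[OF that] by simp
  have contK: "continuous_on (probe_box r) (\<lambda>z. complex_of_real (K (base_shift (move i x t) (fst z)) (1 / snd z)))" if "t \<in> U" for t
    by (intro continuous_on_of_real K continuous_intros low(1)[OF _ that] low(2)[OF _ that]) (use nz in auto)
  have contK': "continuous_on (U \<times> probe_box r) (\<lambda>y. K' (base_shift (move i x (fst y)) (fst (snd y))) (1 / snd (snd y)))"
  proof -
    have "snd (snd y) \<noteq> 0" "0 \<le> 1 / snd (snd y)"
      "1 / snd (snd y) < co 0 (base_shift (move i x (fst y)) (fst (snd y)))" if "y \<in> U \<times> probe_box r" for y
    proof -
      have y: "snd y \<in> probe_box r" "fst y \<in> U" using that by auto
      show "snd (snd y) \<noteq> 0" by (rule nz[OF y(1)])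
      show "0 \<le> 1 / snd (snd y)" by (rule low(1)[OF y])
      show "1 / snd (snd y) < co 0 (base_shift (move i x (fst y)) (fst (snd y)))" by (rule low(2)[OF y])
    qed
    then show ?thesis by (intro K' continuous_intros ballI)
  qed
  have conth: "continuous_on (U \<times> probe_box r) (\<lambda>y. co 0 (move i x (fst y)))"
    unfolding move_def by (cases "i = 0"; cases "i = 1") (auto intro!: continuous_intros)
  have h_nz: "co 0 (move i x t) \<noteq> 0" if "t \<in> U" for t
    using high[OF that] less_trans[OF exp_gt_zero high[OF that]] by simp
  have cont: "continuous_on (U \<times> probe_box r) (\<lambda>(t, z). f' t z)"
  proof -
    have "continuous_on (U \<times> probe_box r) (\<lambda>y. weight p r (snd y))"
      by (rule continuous_on_compose2[OF continuous_on_weight[OF p]]) (auto intro!: continuous_intros)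
    then show ?thesis
      unfolding f'_def case_prod_unfold
      by (intro continuous_on_mult continuous_on_of_real continuous_on_divide contK' conth) (use h_nz in auto)
  qed
  have der: "((\<lambda>t. f t z) has_vector_derivative f' t z) (at t within U)" if "t \<in> U" "z \<in> probe_box r" for t z
  proof -
    have "((\<lambda>t. K (base_shift (move i x t) (fst z)) (1 / snd z)) has_real_derivative
       K' (base_shift (move i x t) (fst z)) (1 / snd z) / co 0 (base_shift (move i x t) (fst z))) (at t)"
      by (intro D DERIV_base_shift_move i low[OF that(2,1)])
    then have "((\<lambda>t. complex_of_real (K (base_shift (move i x t) (fst z)) (1 / snd z))) has_vector_derivative
       complex_of_real (K' (base_shift (move i x t) (fst z)) (1 / snd z) / co 0 (move i x t))) (at t)"
      unfolding co_0_base_shift by (intro has_vector_derivative_of_real) (simp add: has_real_derivative_iff_has_vector_derivative)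
    from has_vector_derivative_mult_right[OF this, of "weight p r z"] show ?thesis
      unfolding f_def f'_def by (rule has_vector_derivative_at_within)
  qed
  have "((\<lambda>t. integral (probe_box r) (f t)) has_vector_derivative integral (probe_box r) (f' (co i x))) (at (co i x) within U)"
    unfolding probe_box_def
    by (rule leibniz_rule_vector_derivative[OF _ _ _ U(3,2)])
      (use der cont weight_integrable_mult(3)[OF p contK] in \<open>simp_all add: f_def probe_box_def\<close>)
  then have "((\<lambda>t. integral (probe_box r) (f t)) has_vector_derivative integral (probe_box r) (f' (co i x))) (at (co i x))"
    using at_within_open[OF U(3,1)] by simp
  then have "((\<lambda>t. F (move i x t)) has_vector_derivative integral (probe_box r) (f' (co i x))) (at (co i x))"
  proof (rule has_vector_derivative_transform_within_open[OF _ U(1,3)])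
    fix t assume t: "t \<in> U"
    show "integral (probe_box r) (f t) = F (move i x t)"
      unfolding F[OF high[OF t]] potential_def f_def
      by (rule weight_integrable_mult(2)[OF p contK[OF t], symmetric])
  qed
  then have "X i F x = co 0 x *\<^sub>R integral (probe_box r) (f' (co i x))"
    by (simp add: X_eq[OF i] vector_derivative_at)
  also have "\<dots> = integral (probe_box r) (\<lambda>z. co 0 x *\<^sub>R f' (co i x) z)"
    by (rule integral_cmul[symmetric])
  also have "(\<lambda>z. co 0 x *\<^sub>R f' (co i x) z) = (\<lambda>z. weight p r z * complex_of_real (K' (base_shift x (fst z)) (1 / snd z)))"
    using h_nz[OF U(3)] by (simp add: f'_def move_co[OF i] scaleR_conv_of_real fun_eq_iff)
  also have "integral (probe_box r) \<dots> = potential p r K' x"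
  proof -
    have "continuous_on (probe_box r) (\<lambda>z. (\<lambda>y. K' (base_shift (move i x (fst y)) (fst (snd y))) (1 / snd (snd y))) (co i x, z))"
      by (rule continuous_on_compose2[OF contK']) (use U in \<open>auto intro!: continuous_intros\<close>)
    then have "continuous_on (probe_box r) (\<lambda>z. complex_of_real (K' (base_shift x (fst z)) (1 / snd z)))"
      by (intro continuous_on_of_real) (simp add: move_co[OF i])
    from weight_integrable_mult(2)[OF p this] show ?thesis by (simp add: potential_def)
  qed
  finally show ?thesis .
qed

lemma riesz_probe:
  assumes p: "square_fun p" and i: "i \<in> {0, 1, 2}" and j: "j \<in> {0, 1, 2}" and x: "exp (-6 * r) < co 0 x"
  shows "riesz i j (probe p r) x = potential p r (K2 i j) x"
proof -
  have pot: "conv (probe p r) (\<lambda>x. complex_of_real (W x)) y = potential p r K0 y" if "exp (-6 * r) < co 0 y" for y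
    using that less_trans[OF exp_gt_zero that] by (intro conv_probe p) (simp add: co_def)
  have first: "X j (conv (probe p r) (\<lambda>x. complex_of_real (W x))) y = potential p r (K1 j) y" if "exp (-6 * r) < co 0 y" for y
    by (rule X_potential[OF p j DERIV_K0[OF _ j] continuous_on_kernels(1) continuous_on_kernels(2) pot that])
  show ?thesis
    unfolding riesz_def
    by (rule X_potential[OF p i DERIV_K1[OF _ i j] continuous_on_kernels(2) continuous_on_kernels(3) first x])
qed

definition boundary_riesz :: "nat \<Rightarrow> nat \<Rightarrow> (real \<times> real \<Rightarrow> complex) \<Rightarrow> pt \<Rightarrow> complex" where
  "boundary_riesz i j p x = (LINT u|lborel. p u * complex_of_real (K2 i j (base_shift x u) 0))"

text \<open>On the support of the weight the heights \<open>1/g\<close> tend to \<open>0\<close> uniformly, while the kernel at the fixed point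
  \<open>x\<close> is uniformly continuous down to \<open>b = 0\<close>.  The part of the weight in \<open>g\<close> integrates to one and drops out.\<close>

lemma riesz_probe_tendsto:
  assumes p: "square_fun p" and i: "i \<in> {0, 1, 2}" and j: "j \<in> {0, 1, 2}" and x: "x \<in> G"
  shows "(\<lambda>n. riesz i j (probe p (real (Suc n))) x) \<longlonglongrightarrow> boundary_riesz i j p x"
proof -
  define a where "a = co 0 x"
  have a: "a > 0" using x by (auto simp: a_def G_def)
  define k where "k y = K2 i j (base_shift x (fst y)) (snd y)" for y
  define C where "C = square \<times> {0..a / 2}"
  have cs: "continuous_on A (\<lambda>y. base_shift x (g y))" if "continuous_on A g" for A :: "'b::topological_space set" and g
    unfolding base_shift_def by (intro continuous_intros that)
  have "continuous_on C k"
    unfolding k_def[abs_def] using a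
    by (intro continuous_on_kernels(3) cs continuous_intros) (auto simp: C_def co_0_base_shift a_def[symmetric])
  moreover have "compact C" unfolding C_def by (intro compact_Times compact_square compact_Icc)
  ultimately have unif: "uniformly_continuous_on C k" by (rule compact_uniformly_continuous)
  define M where "M = (LINT u|lborel. complex_of_real (norm (p u)))"
  have int_norm: "integrable lborel (\<lambda>u. complex_of_real (norm (p u)))"
    using integrable_square_fun[OF p] by (intro integrable_of_real integrable_norm)
  have int_cut: "integrable lborel (\<lambda>g. complex_of_real (dual_cut r g / cut_mass r))" for r
    by (intro integrable_of_real integrable_divide integrable_dual_cut)
  have cut_one: "(LINT g|lborel. complex_of_real (dual_cut r g / cut_mass r)) = 1" if "1 \<le> r" for r
    using cut_mass_pos[OF that] by (simp add: cut_mass_def[symmetric])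
  have weight_norm: "(LINT z|lborel. norm (weight p r z)) = norm M" "integrable lborel (\<lambda>z. norm (weight p r z))" if r: "1 \<le> r" for r
  proof -
    note lp = lborel_integral_product[OF int_norm int_cut]
    have eq: "complex_of_real (norm (p (fst z))) * complex_of_real (dual_cut r (snd z) / cut_mass r) = complex_of_real (norm (weight p r z))" for z
      using dual_cut_nonneg[of r] cut_mass_pos[OF r] by (simp add: weight_def norm_mult norm_divide)
    have "complex_of_real (LINT z|lborel. norm (weight p r z)) = M"
      using lp(2)[of r] by (simp only: eq cut_one[OF r] mult_1_right) (simp only: M_def integral_complex_of_real)
    moreover have "0 \<le> (LINT z|lborel. norm (weight p r z))" by simp
    ultimately show "(LINT z|lborel. norm (weight p r z)) = norm M"
      by (metis abs_of_nonneg norm_of_real)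
    show "integrable lborel (\<lambda>z. norm (weight p r z))"
      using integrable_Re[OF lp(1)[of r]] unfolding eq by simp
  qed
  show ?thesis
  proof (rule tendstoI)
    fix e :: real assume e: "0 < e"
    define e' where "e' = e / (norm M + 1)"
    have e': "e' > 0" using e by (simp add: e'_def add_nonneg_pos)
    obtain \<delta> where \<delta>: "\<delta> > 0" "\<And>y y'. y \<in> C \<Longrightarrow> y' \<in> C \<Longrightarrow> dist y' y < \<delta> \<Longrightarrow> dist (k y') (k y) < e'"
      using unif e' unfolding uniformly_continuous_on_def by metis
    have "((\<lambda>n. exp (-6 * real (Suc n))) \<longlonglongrightarrow> 0)" by real_asymp
    then have "\<forall>\<^sub>F n in sequentially. exp (-6 * real (Suc n)) < min \<delta> (a / 2)"
      using \<delta>(1) a by (intro order_tendstoD) auto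
    then show "\<forall>\<^sub>F n in sequentially. dist (riesz i j (probe p (real (Suc n))) x) (boundary_riesz i j p x) < e"
    proof eventually_elim
      case (elim n)
      define r where "r = real (Suc n)"
      have r: "1 \<le> r" by (simp add: r_def)
      have small: "exp (-6 * r) < \<delta>" "exp (-6 * r) < a / 2" using elim by (auto simp: r_def)
      define kg where "kg z = complex_of_real (k (fst z, 1 / snd z))" for z :: "(real \<times> real) \<times> real"
      define kb where "kb z = complex_of_real (k (fst z, 0))" for z :: "(real \<times> real) \<times> real"
      have memC: "(fst z, 1 / snd z) \<in> C" "(fst z, 0) \<in> C" if "z \<in> probe_box r" for z
        using probe_box_height[OF that] small that a by (auto simp: C_def mem_probe_box)
      have close: "norm (kg z - kb z) \<le> e'" if "z \<in> probe_box r" for z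
      proof -
        have "dist (fst z, 1 / snd z) (fst z, 0) < \<delta>"
          using probe_box_height[OF that] small by (simp add: dist_Pair_Pair dist_real_def)
        from \<delta>(2)[OF memC(2,1)[OF that] this] show ?thesis
          by (simp add: kg_def kb_def dist_real_def flip: of_real_diff)
      qed
      have kg: "continuous_on (probe_box r) kg"
        unfolding kg_def
        by (intro continuous_on_of_real continuous_on_compose2[OF \<open>continuous_on C k\<close>] image_subsetI memC(1) continuous_intros)
          (use probe_box_height in force)+
      have kb: "continuous_on (probe_box r) kb"
        unfolding kb_def
        by (intro continuous_on_of_real continuous_on_compose2[OF \<open>continuous_on C k\<close>] image_subsetI memC(2) continuous_intros)
      have "exp (-6 * r) < co 0 x" using small a by (simp add: a_def)
      then have "riesz i j (probe p r) x = (LINT z|lborel. weight p r z * kg z)"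
        by (simp add: riesz_probe[OF p i j] potential_def kg_def k_def)
      moreover have "boundary_riesz i j p x = (LINT z|lborel. weight p r z * kb z)"
      proof -
        have ck: "continuous_on square (\<lambda>u. complex_of_real (k (u, 0)))"
          by (intro continuous_on_of_real continuous_on_compose2[OF \<open>continuous_on C k\<close>] continuous_intros)
            (use a in \<open>auto simp: C_def\<close>)
        have "(LINT z|lborel. (p (fst z) * complex_of_real (k (fst z, 0))) * complex_of_real (dual_cut r (snd z) / cut_mass r)) =
           (LINT u|lborel. p u * complex_of_real (k (u, 0)))"
          by (subst lborel_integral_product(2)[OF integrable_square_mult[OF p ck] int_cut]) (simp only: cut_one[OF r] mult_1_right)
        then show ?thesis by (simp add: boundary_riesz_def k_def kb_def weight_def mult_ac)
      qed
      ultimately have "riesz i j (probe p r) x - boundary_riesz i j p x = (LINT z|lborel. weight p r z * kg z - weight p r z * kb z)"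
        using weight_integrable_mult(1)[OF p kg] weight_integrable_mult(1)[OF p kb] by simp
      then have "norm (riesz i j (probe p r) x - boundary_riesz i j p x) \<le> (LINT z|lborel. norm (weight p r z * kg z - weight p r z * kb z))"
        by (simp only: integral_norm_bound)
      also have "\<dots> \<le> (LINT z|lborel. norm (weight p r z) * e')"
      proof (rule integral_mono)
        show "integrable lborel (\<lambda>z. norm (weight p r z * kg z - weight p r z * kb z))"
          using weight_integrable_mult(1)[OF p kg] weight_integrable_mult(1)[OF p kb] by simp
        show "integrable lborel (\<lambda>z. norm (weight p r z) * e')" using weight_norm(2)[OF r] by simp
        fix z
        show "norm (weight p r z * kg z - weight p r z * kb z) \<le> norm (weight p r z) * e'"
          using close[of z] weight_outside[OF p, of z r]
          by (cases "z \<in> probe_box r") (auto simp: norm_mult right_diff_distrib[symmetric] mult_left_mono)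
      qed
      also have "\<dots> = norm M * e'" by (simp add: weight_norm(1)[OF r])
      also have "\<dots> < (norm M + 1) * e'" using e' by simp
      also have "\<dots> = e" by (simp add: e'_def add_nonneg_pos[THEN less_imp_neq, symmetric])
      finally show ?case by (simp add: dist_norm r_def)
    qed
  qed
qed

lemma boundary_riesz_convolution:
  "boundary_riesz i j p (fst v, snd v, a) = (LINT u|lborel. p u * complex_of_real (lim_kernel i j a (v - u)))"
  by (simp add: boundary_riesz_def lim_kernel_def base_shift_def)

lemma borel_measurable_boundary_riesz:
  assumes "square_fun p" shows "boundary_riesz i j p \<in> borel_measurable borel"
proof -
  have [measurable]: "p \<in> borel_measurable borel" using assms by measurable
  have [measurable]: "co l \<in> borel_measurable borel" for l
    by (intro borel_measurable_continuous_onI continuous_intros)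
  have [measurable]: "(\<lambda>z. K2 i j z 0) \<in> borel_measurable borel"
    unfolding K2_def disc_def ssum'_def ssum_def by measurable
  have [measurable]: "(\<lambda>y::pt \<times> real \<times> real. base_shift (fst y) (snd y)) \<in> borel \<rightarrow>\<^sub>M borel"
    unfolding base_shift_def by (intro borel_measurable_continuous_onI continuous_intros)
  have "(\<lambda>y::pt \<times> real \<times> real. p (snd y) * complex_of_real (K2 i j (base_shift (fst y) (snd y)) 0)) \<in> borel_measurable borel"
    by measurable
  then have "(\<lambda>(x, u). p u * complex_of_real (K2 i j (base_shift x u) 0)) \<in> borel_measurable (borel \<Otimes>\<^sub>M lborel)"
    by (simp add: case_prod_unfold measurable_cong_sets[OF sets_pair_measure_cong[OF refl sets_lborel] refl] borel_prod)
  from lborel.borel_measurable_lebesgue_integral[OF this] show ?thesis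
    by (simp add: boundary_riesz_def[abs_def])
qed

section \<open>Unboundedness of the boundary operator\<close>

lemma plane_bump_mass_pos: "0 < (LINT u|lborel. plane_bump u)"
proof -
  have half: "exp (-2) \<le> bump t" if "1 / 2 \<le> t" for t
    using that by (auto simp: bump_def field_simps)
  let ?B = "cbox (- 1 / 2 :: real, - 1 / 2 :: real) (1 / 2, 1 / 2)"
  have int: "integrable lborel plane_bump"
  proof -
    have "square_fun (\<lambda>u. complex_of_real (plane_bump u))"
      by (simp add: square_fun_def plane_smooth_plane_bump plane_bump_outside)
    from integrable_Re[OF integrable_square_fun[OF this]] show ?thesis by simp
  qed
  have "0 < exp (-2) * exp (-2) * (exp (-2) * exp (-2)) * (1::real)" by simp
  also have "\<dots> = (LINT u|lborel. exp (-2) * exp (-2) * (exp (-2) * exp (-2)) * indicator ?B u)"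
    by (simp add: measure_lborel_cbox_eq Basis_prod_def cbox_Pair_eq[symmetric])
  also have "\<dots> \<le> (LINT u|lborel. plane_bump u)"
  proof (rule integral_mono)
    show "integrable lborel (\<lambda>u::real \<times> real. exp (-2) * exp (-2) * (exp (-2) * exp (-2)) * indicator ?B u :: real)"
      by (intro integrable_mult_right integrable_real_indicator) (auto intro: emeasure_lborel_cbox_finite[unfolded infinity_ennreal_def])
    show "integrable lborel plane_bump" by (rule int)
    fix u :: "real \<times> real"
    show "exp (-2) * exp (-2) * (exp (-2) * exp (-2)) * indicator ?B u \<le> plane_bump u"
    proof (cases "u \<in> ?B")
      case True
      then have "\<bar>fst u\<bar> \<le> 1 / 2" "\<bar>snd u\<bar> \<le> 1 / 2" by (cases u; auto simp: cbox_Pair_eq)+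
      then have "exp (-2) * exp (-2) * (exp (-2) * exp (-2)) \<le> plane_bump u"
        unfolding plane_bump_def by (intro mult_mono half mult_nonneg_nonneg bump_nonneg) auto
      then show ?thesis using True by simp
    qed (simp add: plane_bump_bounds)
  qed
  finally show ?thesis .
qed

lemma riesz_norm_bound:
  assumes "0 < N" shows "sqrt (1 + (1 / sqrt (real N))\<^sup>2) ^ N \<le> 2"
proof -
  have "(sqrt (1 + (1 / sqrt (real N))\<^sup>2) ^ N)\<^sup>2 = (1 + 1 / real N) ^ N"
    by (simp add: power_divide power_mult[symmetric] mult.commute[of N 2]) (simp add: power_mult)
  also have "\<dots> \<le> exp (1 / real N) ^ N"
    using exp_ge_add_one_self[of "1 / real N"] by (intro power_mono) auto
  also have "\<dots> = exp 1" using assms by (simp add: exp_of_nat_mult[symmetric])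
  also have "\<dots> \<le> 2\<^sup>2" using exp_le by simp
  finally show ?thesis by (rule power2_le_imp_le) simp
qed

text \<open>With amplitude \<open>1/sqrt N\<close> the Riesz product stays bounded while each of its \<open>N\<close>
  distinguished Fourier coefficients has size \<open>1/sqrt N\<close>.  Subtracting a multiple of the initial
  bump makes the mean zero; it hardly changes these coefficients, because the transform of the
  bump is small at the frequencies \<open>l k\<close>.\<close>

lemma lacunary_test_exists:
  assumes \<xi>: "\<xi> \<noteq> 0" and N: "0 < N"
  shows "\<exists>l p. square_fun p \<and> (LINT u|lborel. p u) = 0 \<and> (\<forall>u. norm (p u) \<le> 4) \<and>
    (\<forall>k<N. 1 \<le> l k) \<and> (\<forall>k<N. \<forall>j<k. B * l j < l k) \<and>
    (\<forall>k<N. (LINT u|lborel. plane_bump u) / (4 * sqrt (real N)) \<le> norm (fourier p (l k *\<^sub>R \<xi>)))"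
proof -
  define p0 where "p0 u = complex_of_real (plane_bump u)" for u
  define d where "d = (LINT u|lborel. plane_bump u)"
  define c where "c = 1 / sqrt (real N)"
  have d: "d > 0" unfolding d_def by (rule plane_bump_mass_pos)
  have c: "0 < c" "c \<le> 1" using N by (auto simp: c_def)
  have p0: "square_fun p0" "\<And>u. norm (p0 u) \<le> 1"
    using plane_bump_bounds unfolding p0_def[abs_def]
    by (auto simp: square_fun_def plane_smooth_plane_bump plane_bump_outside)
  have F0: "fourier p0 0 = complex_of_real d" by (simp add: fourier_def p0_def d_def)
  define \<epsilon> where "\<epsilon> = c * d / 16"
  have \<epsilon>: "0 < \<epsilon>" using c d by (simp add: \<epsilon>_def)
  have "c * d \<le> 1 * d" using c d by (intro mult_right_mono) auto
  then have \<epsilon>d: "\<epsilon> \<le> d" using d by (simp add: \<epsilon>_def)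
  from riesz_product_exists[OF p0 \<xi> c \<epsilon>, of N B] obtain l p where
    p: "square_fun p" "\<And>u. norm (p u) \<le> sqrt (1 + c\<^sup>2) ^ N" and
    l: "\<And>k. k < N \<Longrightarrow> 1 \<le> l k" "\<And>k j. k < N \<Longrightarrow> j < k \<Longrightarrow> B * l j < l k" and
    m: "norm (fourier p 0 - fourier p0 0) < \<epsilon>" and
    F: "\<And>k. k < N \<Longrightarrow> norm (fourier p0 (l k *\<^sub>R \<xi>)) < \<epsilon>"
      "\<And>k. k < N \<Longrightarrow> norm (fourier p (l k *\<^sub>R \<xi>) - (\<i> * c / 2) * fourier p0 0) < \<epsilon>"
    by blast
  define \<kappa> where "\<kappa> = fourier p 0 / complex_of_real d"
  have \<kappa>: "norm \<kappa> \<le> 2"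
  proof -
    have "norm (fourier p 0) \<le> norm (fourier p 0 - fourier p0 0) + norm (fourier p0 0)"
      using norm_triangle_ineq[of "fourier p 0 - fourier p0 0" "fourier p0 0"] by simp
    also have "\<dots> \<le> 2 * d" using m \<epsilon>d d by (simp add: F0)
    finally show ?thesis using d by (simp add: \<kappa>_def norm_divide divide_le_eq)
  qed
  define q where "q u = p u + (- \<kappa>) * p0 u" for u
  have q: "square_fun q"
    unfolding square_fun_def q_def
  proof (intro conjI allI impI plane_smooth_add plane_smooth_mult plane_smooth_const)
    show "plane_smooth p" "plane_smooth p0" using p(1) p0(1) by (simp_all add: square_fun_def)
    show "p u + - \<kappa> * p0 u = 0" if "u \<notin> square" for u
      using square_fun_outside[OF p(1) that] square_fun_outside[OF p0(1) that] by simp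
  qed
  have Fq: "fourier q \<eta> = fourier p \<eta> - \<kappa> * fourier p0 \<eta>" for \<eta>
  proof -
    have "fourier q \<eta> = (LINT u|lborel. p u * cis (- (\<eta> \<bullet> u)) - \<kappa> * (p0 u * cis (- (\<eta> \<bullet> u))))"
      unfolding fourier_def q_def by (intro Bochner_Integration.integral_cong) (auto simp: algebra_simps)
    then show ?thesis
      using integrable_fourier[OF p(1)] integrable_fourier[OF p0(1)] by (simp add: fourier_def)
  qed
  show ?thesis
  proof (intro exI[of _ l] exI[of _ q] conjI allI impI l q)
    have "(LINT u|lborel. q u) = fourier q 0" by (simp add: fourier_def)
    also have "\<dots> = 0" using d by (simp add: Fq F0 \<kappa>_def)
    finally show "(LINT u|lborel. q u) = 0" .
    show "norm (q u) \<le> 4" for u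
    proof -
      have "norm (q u) \<le> norm (p u) + norm \<kappa> * norm (p0 u)"
        unfolding q_def by (rule order_trans[OF norm_triangle_ineq]) (simp add: norm_mult)
      also have "\<dots> \<le> 2 + 2 * 1"
        using riesz_norm_bound[OF N] p(2)[of u] unfolding c_def[symmetric]
        by (intro add_mono mult_mono \<kappa> p0) auto
      finally show ?thesis by simp
    qed
    show "(LINT u|lborel. plane_bump u) / (4 * sqrt (real N)) \<le> norm (fourier q (l k *\<^sub>R \<xi>))" if k: "k < N" for k
    proof -
      let ?e = "l k *\<^sub>R \<xi>"
      have main: "norm ((\<i> * c / 2) * fourier p0 0) = c * d / 2"
        using c d by (simp add: F0 norm_mult norm_divide)
      have "(\<i> * c / 2) * fourier p0 0 = fourier q ?e + \<kappa> * fourier p0 ?e - (fourier p ?e - (\<i> * c / 2) * fourier p0 0)"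
        by (simp add: Fq)
      then have "norm ((\<i> * c / 2) * fourier p0 0) \<le> norm (fourier q ?e) + norm (\<kappa> * fourier p0 ?e) + norm (fourier p ?e - (\<i> * c / 2) * fourier p0 0)"
        by (metis norm_triangle_ineq4 norm_triangle_ineq add_right_mono order_trans)
      moreover have "norm (\<kappa> * fourier p0 ?e) \<le> 2 * \<epsilon>"
        unfolding norm_mult using \<kappa> F(1)[OF k] by (intro mult_mono) auto
      ultimately have "c * d / 2 - 3 * \<epsilon> \<le> norm (fourier q ?e)"
        using F(2)[OF k] unfolding main by linarith
      moreover have "c * d / 4 \<le> c * d / 2 - 3 * \<epsilon>" using c d by (simp add: \<epsilon>_def)
      ultimately show ?thesis by (simp add: c_def d_def field_simps)
    qed
  qed
qed

text \<open>The bound for \<open>H1\<close> is uniform over the probes of one test function, and Fatou's lemma passes it to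
  the pointwise limit.\<close>

lemma boundary_riesz_bounded:
  assumes bdd: "bounded_H1_L1 (riesz i j)" and i: "i \<in> {0, 1, 2}" and j: "j \<in> {0, 1, 2}"
  shows "\<exists>C. \<forall>p. square_fun p \<longrightarrow> (LINT u|lborel. p u) = 0 \<longrightarrow> (\<forall>u. norm (p u) \<le> 4) \<longrightarrow>
    (\<integral>\<^sup>+x. ennreal (norm (boundary_riesz i j p x)) \<partial>rho) \<le> ennreal C"
proof -
  obtain C where C: "\<And>f. test_fun f \<Longrightarrow> f \<in> H1 \<Longrightarrow> integrable rho (riesz i j f)"
      "\<And>f. test_fun f \<Longrightarrow> f \<in> H1 \<Longrightarrow> (LINT x|rho. norm (riesz i j f x)) \<le> C * H1_norm f"
    using bdd unfolding bounded_H1_L1_def by blast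
  have "(\<integral>\<^sup>+x. ennreal (norm (boundary_riesz i j p x)) \<partial>rho) \<le> ennreal (\<bar>C\<bar> * (64 * exp 2))"
    if p: "square_fun p" "(LINT u|lborel. p u) = 0" "\<And>u. norm (p u) \<le> 4" for p
  proof -
    define R where "R n = riesz i j (probe p (real (Suc n)))" for n
    have R: "integrable rho (R n)" "(LINT x|rho. norm (R n x)) \<le> \<bar>C\<bar> * (64 * exp 2)" for n
    proof -
      note H = probe_H1[OF p, of "real (Suc n)", simplified] test_fun_probe[OF p(1), of "real (Suc n)", simplified]
      show "integrable rho (R n)" unfolding R_def using C(1) H by simp
      have "0 \<le> H1_norm (probe p (real (Suc n)))"
      proof -
        obtain c A where "atomic_decomp (probe p (real (Suc n))) c A" using H(1) by (auto simp: H1_def)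
        then have "(\<Sum>j. norm (c j)) \<in> {(\<Sum>j. norm (c j)) | c A. atomic_decomp (probe p (real (Suc n))) c A}" by blast
        then show ?thesis unfolding H1_norm_def
          by (intro cInf_greatest) (auto simp: atomic_decomp_def intro!: suminf_nonneg)
      qed
      then have "C * H1_norm (probe p (real (Suc n))) \<le> \<bar>C\<bar> * (64 * exp 2)"
        using H(2) by (intro mult_mono) auto
      then show "(LINT x|rho. norm (R n x)) \<le> \<bar>C\<bar> * (64 * exp 2)"
        unfolding R_def using C(2)[of "probe p (real (Suc n))"] H by simp
    qed
    have "(\<integral>\<^sup>+x. ennreal (norm (boundary_riesz i j p x)) \<partial>rho) = (\<integral>\<^sup>+x. liminf (\<lambda>n. ennreal (norm (R n x))) \<partial>rho)"
    proof (rule nn_integral_cong)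
      fix x assume "x \<in> space rho"
      then have "(\<lambda>n. R n x) \<longlonglongrightarrow> boundary_riesz i j p x"
        unfolding R_def by (intro riesz_probe_tendsto p i j) (simp add: space_rho)
      then have "(\<lambda>n. ennreal (norm (R n x))) \<longlonglongrightarrow> ennreal (norm (boundary_riesz i j p x))"
        by (intro tendsto_intros)
      then show "ennreal (norm (boundary_riesz i j p x)) = liminf (\<lambda>n. ennreal (norm (R n x)))"
        by (intro lim_imp_Liminf[symmetric]) auto
    qed
    also have "\<dots> \<le> liminf (\<lambda>n. \<integral>\<^sup>+x. ennreal (norm (R n x)) \<partial>rho)"
      using R(1) by (intro nn_integral_liminf) (auto dest: borel_measurable_integrable)
    also have "\<dots> \<le> limsup (\<lambda>n. \<integral>\<^sup>+x. ennreal (norm (R n x)) \<partial>rho)"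
      by (rule Liminf_le_Limsup) simp
    also have "\<dots> \<le> ennreal (\<bar>C\<bar> * (64 * exp 2))"
    proof (rule Limsup_bounded, rule always_eventually, rule allI)
      fix n
      have "(\<integral>\<^sup>+x. ennreal (norm (R n x)) \<partial>rho) = ennreal (LINT x|rho. norm (R n x))"
        using R(1) by (intro nn_integral_eq_integral) auto
      also have "\<dots> \<le> ennreal (\<bar>C\<bar> * (64 * exp 2))" by (rule ennreal_leI[OF R(2)])
      finally show "(\<integral>\<^sup>+x. ennreal (norm (R n x)) \<partial>rho) \<le> ennreal (\<bar>C\<bar> * (64 * exp 2))" .
    qed
    finally show ?thesis .
  qed
  then show ?thesis by blast
qed

lemma boundary_riesz_height_bound:
  assumes p: "square_fun p" and i: "i \<in> {0, 1, 2}" and j: "j \<in> {0, 1, 2}" and a: "a > 0"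
  shows "ennreal (norm (fourier p \<xi> * fourier (\<lambda>w. complex_of_real (lim_kernel i j 1 w)) (a *\<^sub>R \<xi>))) \<le>
    (\<integral>\<^sup>+v. ennreal (norm (boundary_riesz i j p (fst v, snd v, a))) \<partial>lborel)"
  using norm_fourier_convolution_le[OF integrable_square_fun[OF p] integrable_lim_kernel_height[OF i j a], of \<xi>]
  by (simp only: fourier_lim_kernel[OF a] boundary_riesz_convolution)

text \<open>The frequency \<open>l k\<close> is detected at the heights \<open>a\<close> with \<open>1 \<le> a * l k \<le> s\<close>.  These ranges of
  heights are disjoint and have the same logarithmic length.\<close>

lemma boundary_riesz_lower_bound:
  assumes p: "square_fun p" and i: "i \<in> {0, 1, 2}" and j: "j \<in> {0, 1, 2}" and s: "1 < s"
    and m: "0 \<le> m" "\<And>t. 1 \<le> t \<Longrightarrow> t \<le> s \<Longrightarrow> m \<le> norm (fourier (\<lambda>w. complex_of_real (lim_kernel i j 1 w)) (t *\<^sub>R \<xi>))"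
    and l: "\<And>k. k < N \<Longrightarrow> 1 \<le> l k" "\<And>k j. k < N \<Longrightarrow> j < k \<Longrightarrow> s * l j < l k"
    and d: "0 \<le> d" "\<And>k. k < N \<Longrightarrow> d \<le> norm (fourier p (l k *\<^sub>R \<xi>))"
  shows "ennreal (real N * (d * m * ln s)) \<le> (\<integral>\<^sup>+x. ennreal (norm (boundary_riesz i j p x)) \<partial>rho)"
proof -
  define I where "I k = {1 / l k..s / l k}" for k
  have I_pos: "0 < a" if "k < N" "a \<in> I k" for a k
    using that l(1)[OF that(1)] by (auto simp: I_def intro: less_le_trans[of 0 "1 / l k"])
  have disj_lt: False if "k < N" "k' < k" "a \<in> I k" "a \<in> I k'" for a k k'
  proof -
    have "1 \<le> l k" "1 \<le> l k'" using that l(1) by auto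
    moreover have "1 / l k' \<le> s / l k" using that by (auto simp: I_def)
    ultimately have "l k \<le> s * l k'" by (simp add: field_simps)
    then show False using l(2)[OF that(1,2)] by simp
  qed
  have window: "(\<integral>\<^sup>+a. ennreal (1 / a) * indicator (I k) a \<partial>lborel) = ennreal (ln s)" if "k < N" for k
  proof -
    have lk: "1 \<le> l k" by (rule l(1)[OF that])
    have "(\<integral>\<^sup>+a. ennreal (1 / a) * indicator (I k) a \<partial>lborel) = ennreal (ln (s / l k) - ln (1 / l k))"
      unfolding I_def
    proof (rule nn_integral_FTC_Icc)
      fix a assume "a \<in> {1 / l k..s / l k}"
      then have "0 < a" using I_pos[OF that] by (simp add: I_def)
      then show "DERIV ln a :> 1 / a" "0 \<le> 1 / a" by (auto intro!: derivative_eq_intros)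
    qed (use lk s in \<open>auto simp: divide_right_mono\<close>)
    also have "ln (s / l k) - ln (1 / l k) = ln s" using lk s by (simp add: ln_div)
    finally show ?thesis .
  qed
  have "ennreal (real N * (d * m * ln s)) = ennreal (d * m) * (\<Sum>k<N. ennreal (ln s))"
    using d m s by (simp add: ennreal_mult ennreal_of_nat_eq_real_of_nat mult_ac)
  also have "\<dots> = ennreal (d * m) * (\<Sum>k<N. \<integral>\<^sup>+a. ennreal (1 / a) * indicator (I k) a \<partial>lborel)"
    by (simp add: window)
  also have "\<dots> = (\<integral>\<^sup>+a. ennreal (d * m) * (\<Sum>k<N. ennreal (1 / a) * indicator (I k) a) \<partial>lborel)"
  proof -
    have [measurable]: "(\<lambda>a. ennreal (1 / a) * indicator (I k) a) \<in> borel_measurable borel" for k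
      by (simp add: I_def)
    have "(\<Sum>k<N. \<integral>\<^sup>+a. ennreal (1 / a) * indicator (I k) a \<partial>lborel) =
        (\<integral>\<^sup>+a. (\<Sum>k<N. ennreal (1 / a) * indicator (I k) a) \<partial>lborel)"
      by (rule nn_integral_sum[symmetric]) measurable
    then show ?thesis by (simp only:) (rule nn_integral_cmult[symmetric], measurable)
  qed
  also have "\<dots> \<le> (\<integral>\<^sup>+a. ennreal (indicator {0<..} a / a) * (\<integral>\<^sup>+v. ennreal (norm (boundary_riesz i j p (fst v, snd v, a))) \<partial>lborel) \<partial>lborel)"
  proof (rule nn_integral_mono)
    fix a :: real
    show "ennreal (d * m) * (\<Sum>k<N. ennreal (1 / a) * indicator (I k) a) \<le>
       ennreal (indicator {0<..} a / a) * (\<integral>\<^sup>+v. ennreal (norm (boundary_riesz i j p (fst v, snd v, a))) \<partial>lborel)"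
    proof (cases "\<exists>k<N. a \<in> I k")
      case True
      then obtain k where k: "k < N" "a \<in> I k" by blast
      have a: "a > 0" by (rule I_pos[OF k])
      have "a \<notin> I k'" if "k' < N" "k' \<noteq> k" for k'
        using disj_lt[of k k' a] disj_lt[of k' k a] k that by (metis nat_neq_iff)
      then have "(\<Sum>k'<N. ennreal (1 / a) * indicator (I k') a) = (\<Sum>k'<N. if k' = k then ennreal (1 / a) else 0)"
        using k by (intro sum.cong) (auto simp: indicator_def)
      then have sum: "(\<Sum>k'<N. ennreal (1 / a) * indicator (I k') a) = ennreal (1 / a)"
        using k by simp
      have lk: "1 \<le> l k" by (rule l(1)[OF k(1)])
      have t: "1 \<le> a * l k" "a * l k \<le> s" using k lk by (auto simp: I_def field_simps)
      have "d * m \<le> norm (fourier p (l k *\<^sub>R \<xi>) * fourier (\<lambda>w. complex_of_real (lim_kernel i j 1 w)) (a *\<^sub>R (l k *\<^sub>R \<xi>)))"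
        unfolding norm_mult scaleR_scaleR by (intro mult_mono d(2)[OF k(1)] m(2) t m(1)) simp
      then have "ennreal (d * m) \<le> (\<integral>\<^sup>+v. ennreal (norm (boundary_riesz i j p (fst v, snd v, a))) \<partial>lborel)"
        by (intro order_trans[OF ennreal_leI boundary_riesz_height_bound[OF p i j a]])
      then have "ennreal (1 / a) * ennreal (d * m) \<le> ennreal (1 / a) * (\<integral>\<^sup>+v. ennreal (norm (boundary_riesz i j p (fst v, snd v, a))) \<partial>lborel)"
        by (rule mult_left_mono) simp
      then show ?thesis unfolding sum using a by (simp add: mult.commute)
    next
      case False
      then have "(\<Sum>k<N. ennreal (1 / a) * indicator (I k) a) = 0" by (intro sum.neutral) auto
      then show ?thesis by (simp only: mult_zero_right zero_le)
    qed
  qed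
  also have "\<dots> = (\<integral>\<^sup>+x. ennreal (norm (boundary_riesz i j p x)) \<partial>rho)"
    using borel_measurable_boundary_riesz[OF p] by (intro nn_integral_rho[symmetric]) measurable
  finally show ?thesis .
qed

theorem mainTheorem6:
  fixes i j :: nat
  assumes "i \<in> {0, 1, 2}" and "j \<in> {0, 1, 2}"
  shows "\<not> bounded_H1_L1 (riesz i j)"
proof
  assume "bounded_H1_L1 (riesz i j)"
  from boundary_riesz_bounded[OF this assms] obtain C where
    C: "\<And>p. square_fun p \<Longrightarrow> (LINT u|lborel. p u) = 0 \<Longrightarrow> (\<And>u. norm (p u) \<le> 4) \<Longrightarrow>
      (\<integral>\<^sup>+x. ennreal (norm (boundary_riesz i j p x)) \<partial>rho) \<le> ennreal C"
    by blast
  define k where "k w = complex_of_real (lim_kernel i j 1 w)" for w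
  have k_int: "integrable lborel k"
    unfolding k_def[abs_def] by (rule integrable_lim_kernel[OF assms])
  have "\<exists>\<xi>. \<xi> \<noteq> 0 \<and> fourier k \<xi> \<noteq> 0"
  proof (rule fourier_nonzero_exists[OF k_int])
    show "continuous_on UNIV k"
      unfolding k_def[abs_def] by (intro continuous_on_of_real continuous_lim_kernel) simp
    show "k (1, 1) \<noteq> 0" using lim_kernel_nonzero[OF assms] by (simp add: k_def)
    show "norm (k w) \<le> 12" for w
    proof -
      have "1 * 1 \<le> (1 + (fst w)\<^sup>2 + (snd w)\<^sup>2) * sqrt (1 + (fst w)\<^sup>2 + (snd w)\<^sup>2)"
        by (intro mult_mono) auto
      then have "12 / ((1 + (fst w)\<^sup>2 + (snd w)\<^sup>2) * sqrt (1 + (fst w)\<^sup>2 + (snd w)\<^sup>2)) \<le> 12 / 1"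
        by (intro divide_left_mono) auto
      then show ?thesis using lim_kernel_bound[OF assms, of w] by (simp add: k_def)
    qed
  qed
  then obtain \<xi> where \<xi>: "\<xi> \<noteq> 0" "fourier k \<xi> \<noteq> 0" by blast
  define m where "m = norm (fourier k \<xi>) / 2"
  have m: "m > 0" using \<xi> by (simp add: m_def)
  obtain \<delta> where \<delta>: "\<delta> > 0" "\<And>t. dist t 1 < \<delta> \<Longrightarrow> dist (fourier k (t *\<^sub>R \<xi>)) (fourier k \<xi>) < m"
  proof -
    have "continuous_on UNIV (\<lambda>t. fourier k (t *\<^sub>R \<xi>))"
      by (rule continuous_on_compose2[OF continuous_fourier[OF k_int]]) (auto intro!: continuous_intros)
    then have "isCont (\<lambda>t. fourier k (t *\<^sub>R \<xi>)) 1"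
      by (simp add: continuous_on_eq_continuous_at)
    then obtain \<delta> where "\<delta> > 0" "\<And>t. dist t 1 < \<delta> \<Longrightarrow> dist (fourier k (t *\<^sub>R \<xi>)) (fourier k (1 *\<^sub>R \<xi>)) < m"
      using m unfolding continuous_at_eps_delta by metis
    then show ?thesis using that by simp
  qed
  define s where "s = 1 + \<delta> / 2"
  have s: "1 < s" using \<delta> by (simp add: s_def)
  have m_le: "m \<le> norm (fourier k (t *\<^sub>R \<xi>))" if "1 \<le> t" "t \<le> s" for t
  proof -
    have "norm (fourier k (t *\<^sub>R \<xi>) - fourier k \<xi>) < m"
      using that \<delta> by (auto simp: s_def dist_norm)
    then show ?thesis using norm_triangle_ineq3[of "fourier k (t *\<^sub>R \<xi>)" "fourier k \<xi>"] by (simp add: m_def)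
  qed
  define d where "d = (LINT u|lborel. plane_bump u)"
  have d: "d > 0" unfolding d_def by (rule plane_bump_mass_pos)
  define D where "D = d / 4 * m * ln s"
  have D: "D > 0" using d m s by (simp add: D_def)
  obtain n :: nat where n: "\<bar>C\<bar> / D < real n" using reals_Archimedean2 by blast
  \<comment> \<open>the lower bound is \<open>sqrt N * D\<close>; a perfect square keeps the root explicit\<close>
  define N where "N = (Suc n)\<^sup>2"
  have N: "0 < N" "sqrt (real N) = real (Suc n)" by (simp_all add: N_def)
  from lacunary_test_exists[OF \<xi>(1) N(1), of s] obtain l p where p: "square_fun p" "(LINT u|lborel. p u) = 0" "\<And>u. norm (p u) \<le> 4"
    and l: "\<And>k. k < N \<Longrightarrow> 1 \<le> l k" "\<And>k j. k < N \<Longrightarrow> j < k \<Longrightarrow> s * l j < l k"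
    and F: "\<And>k. k < N \<Longrightarrow> d / (4 * sqrt (real N)) \<le> norm (fourier p (l k *\<^sub>R \<xi>))"
    unfolding d_def[symmetric] by blast
  have "ennreal (real N * (d / (4 * sqrt (real N)) * m * ln s)) \<le> (\<integral>\<^sup>+x. ennreal (norm (boundary_riesz i j p x)) \<partial>rho)"
    by (rule boundary_riesz_lower_bound[OF p(1) assms s _ m_le[unfolded k_def[abs_def]] l _ F])
      (use m d in auto)
  also have "\<dots> \<le> ennreal C" by (rule C[OF p])
  also have "\<dots> \<le> ennreal \<bar>C\<bar>" by (intro ennreal_leI) simp
  finally have "real N * (d / (4 * sqrt (real N)) * m * ln s) \<le> \<bar>C\<bar>" by simp
  moreover have "real N * (d / (4 * sqrt (real N)) * m * ln s) = real (Suc n) * D"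
    unfolding N(2) by (simp add: N_def D_def power2_eq_square field_simps)
  ultimately have "real (Suc n) * D \<le> \<bar>C\<bar>" by simp
  moreover have "\<bar>C\<bar> < real n * D" using n D by (simp add: divide_less_eq)
  ultimately show False using D by (simp add: algebra_simps)
qed

end
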